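(* Let $\Delta=(\Gamma,(X_a)_{a\in A\Gamma},(G(v))_{v\in V\Gamma})$ be a local action diagram, $\mathbf{T}=(T,\pi,\mathcal{L})$ a $\Delta$-tree and $G:=\mathbf{U}(\mathbf{T},(G(v)))\le\mathrm{Aut}_{\pi}(T)$ the associated universal group. Then $G$ is of type (Fixed vertex) if and only if $\Gamma$ is a tree and $\Delta$ contains a single vertex cotree. The vertices of $T$ fixed by $G$ correspond to the single vertex cotrees of $\Delta$. (Inversion) if and only if $\Delta$ contains a (necessarily unique) cotree consisting of a vertex with a non-orientable loop $a\in A\Gamma$ such that $|X_a|=1$. The unique edge of $T$ inverted by $G$ corresponds to this cotree. (Lineal) if and only if $\Delta$ contains a cyclic cotree $\Gamma'$ with $|X_a|=1$ for all $a\in A\Gamma'$. The two ends of $T$ fixed by $G$ correspond to the cyclic orientations of $\Gamma'$. (Focal) if and only if $\Delta$ contains a cyclic cotree $\Gamma'$ with a cyclic orientation $O\subseteq A\Gamma'$ such that $|X_a|=1$ for all $a\in O$ but there is an $a\in A\Gamma'\setminus O$ with $|X_a|\ge 2$. The unique end of $T$ fixed by $G$ corresponds to the orientation $O$. (Horocyclic) if and only if $\Gamma$ is a tree and $\Delta$ has a unique horocyclic end. The unique end of $T$ fixed by $G$ corresponds to this horocyclic end. (General) if and only if it is of none of the types above. In this case there is a unique smallest cotree of $\Delta$, which is not of the form indicating the fixed vertex, inversion, lineal, or focal type. It corresponds to the unique minimal subtree of $T$ on which $G$ acts geometrically densely. Moreover, $\Delta$ does not have any horocyclic ends.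
   Context: **Graphs.** A graph $\Gamma=(V\Gamma,A\Gamma,o,t,r)$ consists of a vertex set $V\Gamma$, an arc set $A\Gamma$, origin and terminus maps $o,t:A\Gamma\to V\Gamma$ and a reversal $r:A\Gamma\to A\Gamma$, $a\mapsto\overline{a}$, with $r^2=\mathrm{id}$ and $o(\overline{a})=t(a)$. An edge is a pair $\{a,\overline a\}$. A loop is an arc with $o(a)=t(a)$; it is non-orientable if $a=\overline{a}$ and orientable otherwise. A graph is simple if it has no loops and at most one arc from $u$ to $v$ for all vertices $u,v$. A directed path has vertices $(v_i)$ and arcs $(a_i)$ with $o(a_i)=v_i$, $t(a_i)=v_{i+1}$; it is simple if its vertices are distinct. A cycle of length $1$ is a vertex with two mutually reverse (distinct) loops; a cycle of length $2$ is a pair of distinct vertices with two pairs of mutually reverse arcs connecting them; a cycle of length $n\ge3$ is a path $v_0,\dots,v_n$ with $v_0=v_n$ and otherwise distinct vertices. A tree is a non-empty, simple, connected graph without cycles. A ray is a simple path indexed by $\mathbb{N}_0$; two rays are equivalent if some ray contains infinitely many vertices of both; an end is an equivalence class of rays. In a tree, an arc $a$ is oriented towards an end $\xi$ if some ray in $\xi$ (traversed in its direction) contains $a$. **Local action diagrams.** A local action diagram $\Delta=(\Gamma,(X_a)_{a\in A\Gamma},(G(v))_{v\in V\Gamma})$ consists of a connected graph $\Gamma$; pairwise disjoint non-empty sets $X_a$ ($a\in A\Gamma$); and closed subgroups $G(v)\le\mathrm{Sym}(X_v)$ (for the permutation topology, whose basis is the set of left translates of pointwise stabilisers of finite sets),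 where $X_v:=\bigsqcup_{a\in o^{-1}(v)}X_a$, such that the sets $X_a$ ($a\in o^{-1}(v)$) are precisely the orbits of $G(v)$. A $\Delta$-tree $(T,\pi,\mathcal{L})$ consists of a tree $T$, a surjective graph homomorphism $\pi:T\to\Gamma$ and a map $\mathcal{L}:AT\to\bigsqcup_{a\in A\Gamma}X_a$ which for all $v\in VT$ and $a\in o^{-1}(\pi(v))$ restricts to bijections $o^{-1}(v)\to X_{\pi(v)}$ and $\{b\in o^{-1}(v)\mid\pi(b)=a\}\to X_a$. Put $\mathrm{Aut}_\pi(T):=\{g\in\mathrm{Aut}(T)\mid\pi\circ g=\pi\}$ and, for $g\in\mathrm{Aut}_\pi(T)$ and $v\in VT$, let $\sigma_{\mathcal{L},v}(g):=\mathcal{L}\circ g\circ(\mathcal{L}|_{o^{-1}(v)})^{-1}\in\mathrm{Sym}(X_{\pi(v)})$. The universal group is $\mathbf{U}(\mathbf{T},(G(v))):=\{g\in\mathrm{Aut}_\pi(T)\mid\forall v\in VT:\ \sigma_{\mathcal{L},v}(g)\in G(\pi(v))\}$. **Cotrees, cyclic graphs, horocyclic ends.** A directed path with vertices $(v_0,\dots,v_n)$, $n\ge2$, is backtracking if $v_i=v_{i+2}$ for some $i$. For a subgraph $\Gamma'\subseteq\Gamma$, a projecting path from $v$ to $\Gamma'$ is a non-backtracking directed path starting at $v$, ending at a vertex of $\Gamma'$, with no earlier vertex in $V\Gamma'$. A cotree of $\Gamma$ is a non-empty induced subgraph $\Gamma'$ such that every $v\in V\Gamma\setminus V\Gamma'$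 has a unique projecting path to $\Gamma'$. A cotree of $\Delta$ is a cotree $\Gamma'$ of $\Gamma$ such that $|X_a|=1$ for all arcs $a$ belonging to a projecting path to $\Gamma'$. A finite connected graph is cyclic if it is a cycle of some length $n\in\mathbb{N}$, that is, if it consists of a vertex with two mutually reverse (distinct) loops ($n=1$), of a pair of distinct vertices with two pairs of mutually reverse arcs connecting them ($n=2$), or of the vertices and edges of a path $v_0,\dots,v_n$ with $v_0=v_n$ and otherwise distinct vertices ($n\ge3$). An orientation of a graph is a set $O$ of arcs with $A=O\sqcup\overline{O}$; a cyclic orientation of a cyclic graph is an orientation containing exactly one element of $o^{-1}(v)$ for each vertex $v$ (there are exactly two). A horocyclic end of $\Delta$ (where $\Gamma$ is a tree) is an end $\xi\in\partial\Gamma$ such that $|X_a|=1$ for all arcs $a\in A\Gamma$ oriented towards $\xi$. **Types of actions.** A group acting on a tree belongs to exactly one of these types: (Fixed vertex) it fixes a (not necessarily unique) vertex; (Inversion) it preserves a unique edge and contains an inversion of that edge; (Lineal) it fixes exactly two ends and translates the line between them; (Focal) it fixes a unique end and contains a translation towards this end; (Horocyclic) it fixes a unique end but no vertices, and acts without translation; (General) it acts with translation and does not fix any end. A group acts geometrically densely on a tree if it leaves no proper subtree invariant and fixes no end. **Meaning of "corresponds".** A partial orientation of a graph is a set $O$ of arcs with $O\cap\overline{O}=\varnothing$. It is strongly confluent (a scopo) if $|o^{-1}(v)\cap O|\le1$ for all vertices $v$ and, whenever $o^{-1}(v)\cap O=\{a\}$, then $\overline{b}\in O$ for all $b\in o^{-1}(v)\setminus\{a\}$.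 A scopo of $\Delta$ is a scopo $O$ of $\Gamma$ with $|X_a|=1$ for all $a\in O$. For a cotree $\Gamma'$, $O_{\Gamma'}$ is the scopo of all arcs $a$ with $o(a)\notin V\Gamma'$ lying on a projecting path from $o(a)$ to $\Gamma'$; for a cyclic cotree $\Gamma'$, $O_{\Gamma'}^+$ is the union of $O_{\Gamma'}$ with a cyclic orientation of $\Gamma'$; for an end $\xi$ of a tree, $O_\xi$ is the set of arcs oriented towards $\xi$. The $G$-invariant scopos of $T$ are exactly the preimages $\pi^{-1}(O)$ of scopos $O$ of $\Delta$; a $G$-invariant subtree $T'$ (e.g. vertex or edge) or end $\xi$ of $T$ corresponds to a structure in $\Delta$ (cotree, cyclic cotree with a cyclic orientation, or end) if the scopo $O_{T'}$, respectively $O_\xi$, of $T$ is the preimage under $\pi$ of the scopo associated to that structure.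
   Formalization: In (Horocyclic), the right-hand side also requires that Δ contains no single vertex cotree; without this the equivalence fails, e.g. for Γ a ray with all X_a singletons, where Δ has a unique horocyclic end but G is trivial and fixes every vertex. *)

theory Defs
  imports
    "HOL-Algebra.Bij"
    "HOL-Algebra.Coset"
    "HOL-Algebra.Group_Action"
    "HOL-Analysis.Abstract_Topology"
    "HOL-Library.Disjoint_Sets"
    "Graph_Theory.Digraph_Component"
begin

text \<open>
  A graph is a digraph together with a reversal of its arcs. Unlike in
  \<^locale>\<open>bidirected_digraph\<close>, arcs may be fixed by the reversal (non-orientable loops).
\<close>

locale rgraph = wf_digraph G
  for G :: "('v, 'a) pre_digraph" +
  fixes rv :: "'a \<Rightarrow> 'a"
  assumes rv_in_arcs: "a \<in> arcs G \<Longrightarrow> rv a \<in> arcs G"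
    and rv_rv: "a \<in> arcs G \<Longrightarrow> rv (rv a) = a"
    and tail_rv: "a \<in> arcs G \<Longrightarrow> tail G (rv a) = head G a"

definition edges :: "('v, 'a) pre_digraph \<Rightarrow> ('a \<Rightarrow> 'a) \<Rightarrow> 'a set set" where
  "edges G rv = {{a, rv a} | a. a \<in> arcs G}"

text \<open>
  \<^const>\<open>pre_digraph.cycle\<close> demands a closed walk of positive length whose vertices are distinct
  except for the endpoints. In length 1 the loop must be orientable, and in length 2 the two arcs
  must belong to different edges.
\<close>

definition graph_cycle :: "('v, 'a) pre_digraph \<Rightarrow> ('a \<Rightarrow> 'a) \<Rightarrow> 'a list \<Rightarrow> bool" where
  "graph_cycle G rv p \<longleftrightarrow> pre_digraph.cycle G p
     \<and> (length p = 1 \<longrightarrow> rv (p ! 0) \<noteq> p ! 0)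
     \<and> (length p = 2 \<longrightarrow> p ! 1 \<noteq> rv (p ! 0))"

definition cyclic_graph :: "('v, 'a) pre_digraph \<Rightarrow> ('a \<Rightarrow> 'a) \<Rightarrow> bool" where
  "cyclic_graph G rv \<longleftrightarrow> rgraph G rv \<and>
     (\<exists>p. graph_cycle G rv p \<and> verts G = tail G ` set p \<and> arcs G = set p \<union> rv ` set p)"

text \<open>
  In the presence of a reversal, connectedness is \<^const>\<open>strongly_connected\<close>, which includes
  non-emptiness.
\<close>

definition is_tree :: "('v, 'a) pre_digraph \<Rightarrow> ('a \<Rightarrow> 'a) \<Rightarrow> bool" where
  "is_tree G rv \<longleftrightarrow> rgraph G rv \<and> loopfree_digraph G \<and> nomulti_digraph G
     \<and> strongly_connected G \<and> (\<nexists>p. graph_cycle G rv p)"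

definition subtree :: "('v, 'a) pre_digraph \<Rightarrow> ('v, 'a) pre_digraph \<Rightarrow> ('a \<Rightarrow> 'a) \<Rightarrow> bool" where
  "subtree S T rv \<longleftrightarrow> subgraph S T \<and> is_tree S rv"

text \<open>Rays and bi-infinite lines are given by their arcs; the vertices are the origins.\<close>

definition ray :: "('v, 'a) pre_digraph \<Rightarrow> (nat \<Rightarrow> 'a) \<Rightarrow> bool" where
  "ray G r \<longleftrightarrow> (\<forall>i. r i \<in> arcs G \<and> head G (r i) = tail G (r (Suc i)))
     \<and> inj (\<lambda>i. tail G (r i))"

definition ray_equiv :: "('v, 'a) pre_digraph \<Rightarrow> ((nat \<Rightarrow> 'a) \<times> (nat \<Rightarrow> 'a)) set" where
  "ray_equiv G = {(r, s). ray G r \<and> ray G s \<and>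
     (\<exists>q. ray G q
        \<and> infinite (range (\<lambda>i. tail G (q i)) \<inter> range (\<lambda>i. tail G (r i)))
        \<and> infinite (range (\<lambda>i. tail G (q i)) \<inter> range (\<lambda>i. tail G (s i))))}"

definition ends :: "('v, 'a) pre_digraph \<Rightarrow> (nat \<Rightarrow> 'a) set set" where
  "ends G = {r. ray G r} // ray_equiv G"

definition arcs_towards :: "('v, 'a) pre_digraph \<Rightarrow> (nat \<Rightarrow> 'a) set \<Rightarrow> 'a set" where
  "arcs_towards G \<xi> = {a \<in> arcs G. \<exists>r\<in>\<xi>. a \<in> range r}"

definition line :: "('v, 'a) pre_digraph \<Rightarrow> (int \<Rightarrow> 'a) \<Rightarrow> bool" where
  "line G l \<longleftrightarrow> (\<forall>i. l i \<in> arcs G \<and> head G (l i) = tail G (l (i + 1)))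
     \<and> inj (\<lambda>i. tail G (l i))"

definition forward_ray :: "(int \<Rightarrow> 'a) \<Rightarrow> nat \<Rightarrow> 'a" where
  "forward_ray l i = l (int i)"

definition backward_ray :: "('a \<Rightarrow> 'a) \<Rightarrow> (int \<Rightarrow> 'a) \<Rightarrow> nat \<Rightarrow> 'a" where
  "backward_ray rv l i = rv (l (- 1 - int i))"


section \<open>Automorphisms and types of actions\<close>

text \<open>
  An automorphism is a pair of a vertex and an arc permutation, both extensional, so that distinct
  pairs are distinct automorphisms.
\<close>

definition graph_Aut ::
    "('v, 'a) pre_digraph \<Rightarrow> ('a \<Rightarrow> 'a) \<Rightarrow> (('v \<Rightarrow> 'v) \<times> ('a \<Rightarrow> 'a)) set" where
  "graph_Aut G rv = {g. fst g \<in> Bij (verts G) \<and> snd g \<in> Bij (arcs G) \<and>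
     (\<forall>a\<in>arcs G. tail G (snd g a) = fst g (tail G a) \<and> head G (snd g a) = fst g (head G a)
        \<and> snd g (rv a) = rv (snd g a))}"

definition fixed_vertices ::
    "('v, 'a) pre_digraph \<Rightarrow> (('v \<Rightarrow> 'v) \<times> ('a \<Rightarrow> 'a)) set \<Rightarrow> 'v set" where
  "fixed_vertices T H = {x \<in> verts T. \<forall>g\<in>H. fst g x = x}"

definition fixed_ends ::
    "('v, 'a) pre_digraph \<Rightarrow> (('v \<Rightarrow> 'v) \<times> ('a \<Rightarrow> 'a)) set \<Rightarrow> (nat \<Rightarrow> 'a) set set" where
  "fixed_ends T H = {\<xi> \<in> ends T. \<forall>g\<in>H. (\<lambda>r. snd g \<circ> r) ` \<xi> = \<xi>}"

definition preserved_edges ::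
    "('v, 'a) pre_digraph \<Rightarrow> ('a \<Rightarrow> 'a) \<Rightarrow> (('v \<Rightarrow> 'v) \<times> ('a \<Rightarrow> 'a)) set \<Rightarrow> 'a set set" where
  "preserved_edges T rv H = {e \<in> edges T rv. \<forall>g\<in>H. snd g ` e = e}"

definition inverted_edges ::
    "('v, 'a) pre_digraph \<Rightarrow> ('a \<Rightarrow> 'a) \<Rightarrow> (('v \<Rightarrow> 'v) \<times> ('a \<Rightarrow> 'a)) set \<Rightarrow> 'a set set" where
  "inverted_edges T rv H = {e \<in> preserved_edges T rv H. \<exists>g\<in>H. \<forall>a\<in>e. snd g a = rv a}"

definition translates ::
    "('v, 'a) pre_digraph \<Rightarrow> ('v \<Rightarrow> 'v) \<times> ('a \<Rightarrow> 'a) \<Rightarrow> (int \<Rightarrow> 'a) \<Rightarrow> bool" where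
  "translates T g l \<longleftrightarrow> line T l \<and> (\<exists>n>0. \<forall>i. snd g (l i) = l (i + n))"

definition has_translation ::
    "('v, 'a) pre_digraph \<Rightarrow> (('v \<Rightarrow> 'v) \<times> ('a \<Rightarrow> 'a)) set \<Rightarrow> bool" where
  "has_translation T H \<longleftrightarrow> (\<exists>g\<in>H. \<exists>l. translates T g l)"

definition fixed_vertex_type where
  "fixed_vertex_type T H \<longleftrightarrow> fixed_vertices T H \<noteq> {}"

definition inversion_type where
  "inversion_type T rv H \<longleftrightarrow> (\<exists>e. preserved_edges T rv H = {e} \<and> e \<in> inverted_edges T rv H)"

definition lineal_type where
  "lineal_type T rv H \<longleftrightarrow> (\<exists>\<xi> \<eta>. \<xi> \<noteq> \<eta> \<and> fixed_ends T H = {\<xi>, \<eta>} \<and>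
     (\<exists>g\<in>H. \<exists>l. translates T g l \<and> forward_ray l \<in> \<xi> \<and> backward_ray rv l \<in> \<eta>))"

definition focal_type where
  "focal_type T H \<longleftrightarrow> (\<exists>\<xi>. fixed_ends T H = {\<xi>} \<and>
     (\<exists>g\<in>H. \<exists>l. translates T g l \<and> forward_ray l \<in> \<xi>))"

definition horocyclic_type where
  "horocyclic_type T H \<longleftrightarrow> (\<exists>\<xi>. fixed_ends T H = {\<xi>}) \<and> fixed_vertices T H = {}
     \<and> \<not> has_translation T H"

definition general_type where
  "general_type T H \<longleftrightarrow> has_translation T H \<and> fixed_ends T H = {}"

definition invariant_subtree ::
    "('v, 'a) pre_digraph \<Rightarrow> ('a \<Rightarrow> 'a) \<Rightarrow> (('v \<Rightarrow> 'v) \<times> ('a \<Rightarrow> 'a)) set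
      \<Rightarrow> ('v, 'a) pre_digraph \<Rightarrow> bool" where
  "invariant_subtree T rv H S \<longleftrightarrow> subtree S T rv
     \<and> (\<forall>g\<in>H. fst g ` verts S = verts S \<and> snd g ` arcs S = arcs S)"

definition minimal_invariant_subtree ::
    "('v, 'a) pre_digraph \<Rightarrow> ('a \<Rightarrow> 'a) \<Rightarrow> (('v \<Rightarrow> 'v) \<times> ('a \<Rightarrow> 'a)) set
      \<Rightarrow> ('v, 'a) pre_digraph \<Rightarrow> bool" where
  "minimal_invariant_subtree T rv H S \<longleftrightarrow> invariant_subtree T rv H S
     \<and> (\<forall>S'. invariant_subtree T rv H S' \<and> subgraph S' S \<longrightarrow> S' = S)"

definition geometrically_dense ::
    "('v, 'a) pre_digraph \<Rightarrow> ('a \<Rightarrow> 'a) \<Rightarrow> (('v \<Rightarrow> 'v) \<times> ('a \<Rightarrow> 'a)) set \<Rightarrow> bool" where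
  "geometrically_dense S rv H \<longleftrightarrow>
     (\<forall>S'. invariant_subtree S rv H S' \<longrightarrow> S' = S) \<and> fixed_ends S H = {}"


section \<open>Local action diagrams and universal groups\<close>

definition perm_topology :: "'x set \<Rightarrow> ('x \<Rightarrow> 'x) topology" where
  "perm_topology S = topology_generated_by
     {\<sigma> <#\<^bsub>BijGroup S\<^esub> {\<tau> \<in> Bij S. \<forall>x\<in>F. \<tau> x = x} | \<sigma> F. \<sigma> \<in> Bij S \<and> finite F \<and> F \<subseteq> S}"

definition colours_at :: "('v, 'a) pre_digraph \<Rightarrow> ('a \<Rightarrow> 'x set) \<Rightarrow> 'v \<Rightarrow> 'x set" where
  "colours_at \<Gamma> X v = (\<Union>a\<in>out_arcs \<Gamma> v. X a)"

locale local_action_diagram = rgraph \<Gamma> rv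
  for \<Gamma> :: "('v, 'a) pre_digraph" and rv :: "'a \<Rightarrow> 'a" +
  fixes X :: "'a \<Rightarrow> 'x set" and Gv :: "'v \<Rightarrow> ('x \<Rightarrow> 'x) set"
  assumes conn: "strongly_connected \<Gamma>"
    and X_nonempty: "a \<in> arcs \<Gamma> \<Longrightarrow> X a \<noteq> {}"
    and X_disjoint: "disjoint_family_on X (arcs \<Gamma>)"
    and Gv_subgroup: "v \<in> verts \<Gamma> \<Longrightarrow> subgroup (Gv v) (BijGroup (colours_at \<Gamma> X v))"
    and Gv_closed: "v \<in> verts \<Gamma> \<Longrightarrow> closedin (perm_topology (colours_at \<Gamma> X v)) (Gv v)"
    and Gv_orbits: "v \<in> verts \<Gamma> \<Longrightarrow>
      orbits (BijGroup (colours_at \<Gamma> X v)\<lparr>carrier := Gv v\<rparr>) (colours_at \<Gamma> X v) (\<lambda>\<sigma>. \<sigma>)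
        = X ` out_arcs \<Gamma> v"

text \<open>
  The projection is the pair of its vertex part \<open>piV\<close> and its arc part \<open>piA\<close>.
\<close>

locale delta_tree =
  fixes \<Gamma> :: "('v, 'a) pre_digraph" and rv :: "'a \<Rightarrow> 'a" and X :: "'a \<Rightarrow> 'x set"
    and T :: "('w, 'b) pre_digraph" and rvT :: "'b \<Rightarrow> 'b"
    and piV :: "'w \<Rightarrow> 'v" and piA :: "'b \<Rightarrow> 'a" and L :: "'b \<Rightarrow> 'x"
  assumes T_tree: "is_tree T rvT"
    and piV_surj: "piV ` verts T = verts \<Gamma>"
    and piA_surj: "piA ` arcs T = arcs \<Gamma>"
    and tail_piA: "b \<in> arcs T \<Longrightarrow> tail \<Gamma> (piA b) = piV (tail T b)"
    and head_piA: "b \<in> arcs T \<Longrightarrow> head \<Gamma> (piA b) = piV (head T b)"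
    and piA_rvT: "b \<in> arcs T \<Longrightarrow> piA (rvT b) = rv (piA b)"
    and L_bij_vertex: "x \<in> verts T \<Longrightarrow>
      bij_betw L (out_arcs T x) (colours_at \<Gamma> X (piV x))"
    and L_bij_arc: "\<lbrakk>x \<in> verts T; a \<in> out_arcs \<Gamma> (piV x)\<rbrakk> \<Longrightarrow>
      bij_betw L {b \<in> out_arcs T x. piA b = a} (X a)"

definition Aut_pi ::
    "('w, 'b) pre_digraph \<Rightarrow> ('b \<Rightarrow> 'b) \<Rightarrow> ('w \<Rightarrow> 'v) \<Rightarrow> ('b \<Rightarrow> 'a)
      \<Rightarrow> (('w \<Rightarrow> 'w) \<times> ('b \<Rightarrow> 'b)) set" where
  "Aut_pi T rvT piV piA = {g \<in> graph_Aut T rvT.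
     (\<forall>x\<in>verts T. piV (fst g x) = piV x) \<and> (\<forall>b\<in>arcs T. piA (snd g b) = piA b)}"

definition local_action ::
    "('v, 'a) pre_digraph \<Rightarrow> ('a \<Rightarrow> 'x set) \<Rightarrow> ('w, 'b) pre_digraph \<Rightarrow> ('w \<Rightarrow> 'v) \<Rightarrow> ('b \<Rightarrow> 'x)
      \<Rightarrow> 'w \<Rightarrow> ('w \<Rightarrow> 'w) \<times> ('b \<Rightarrow> 'b) \<Rightarrow> 'x \<Rightarrow> 'x" where
  "local_action \<Gamma> X T piV L x g =
     (\<lambda>c\<in>colours_at \<Gamma> X (piV x). L (snd g (inv_into (out_arcs T x) L c)))"

definition universal_group ::
    "('v, 'a) pre_digraph \<Rightarrow> ('a \<Rightarrow> 'x set) \<Rightarrow> ('v \<Rightarrow> ('x \<Rightarrow> 'x) set)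
      \<Rightarrow> ('w, 'b) pre_digraph \<Rightarrow> ('b \<Rightarrow> 'b) \<Rightarrow> ('w \<Rightarrow> 'v) \<Rightarrow> ('b \<Rightarrow> 'a) \<Rightarrow> ('b \<Rightarrow> 'x)
      \<Rightarrow> (('w \<Rightarrow> 'w) \<times> ('b \<Rightarrow> 'b)) set" where
  "universal_group \<Gamma> X Gv T rvT piV piA L =
     {g \<in> Aut_pi T rvT piV piA. \<forall>x\<in>verts T. local_action \<Gamma> X T piV L x g \<in> Gv (piV x)}"


section \<open>Cotrees and horocyclic ends\<close>

text \<open>
  Backtracking refers to repeated vertices \<open>v\<^sub>i = v\<^sub>i\<^sub>+\<^sub>2\<close>, not to an arc being followed by its
  reverse.
\<close>

definition backtracking :: "'v list \<Rightarrow> bool" where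
  "backtracking vs \<longleftrightarrow> (\<exists>i. i + 2 < length vs \<and> vs ! i = vs ! (i + 2))"

definition projecting_path ::
    "('v, 'a) pre_digraph \<Rightarrow> ('v, 'a) pre_digraph \<Rightarrow> 'v \<Rightarrow> 'a list \<Rightarrow> bool" where
  "projecting_path G C v p \<longleftrightarrow> (\<exists>w\<in>verts C. pre_digraph.awalk G v p w)
     \<and> \<not> backtracking (pre_digraph.awalk_verts G v p)
     \<and> set (butlast (pre_digraph.awalk_verts G v p)) \<inter> verts C = {}"

definition graph_cotree :: "('v, 'a) pre_digraph \<Rightarrow> ('v, 'a) pre_digraph \<Rightarrow> bool" where
  "graph_cotree G C \<longleftrightarrow> verts C \<noteq> {} \<and> induced_subgraph C G
     \<and> (\<forall>v\<in>verts G - verts C. \<exists>!p. projecting_path G C v p)"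

definition cotree ::
    "('v, 'a) pre_digraph \<Rightarrow> ('a \<Rightarrow> 'x set) \<Rightarrow> ('v, 'a) pre_digraph \<Rightarrow> bool" where
  "cotree \<Gamma> X C \<longleftrightarrow> graph_cotree \<Gamma> C \<and>
     (\<forall>v p. projecting_path \<Gamma> C v p \<longrightarrow> (\<forall>a\<in>set p. card (X a) = 1))"

definition smallest_cotree ::
    "('v, 'a) pre_digraph \<Rightarrow> ('a \<Rightarrow> 'x set) \<Rightarrow> ('v, 'a) pre_digraph \<Rightarrow> bool" where
  "smallest_cotree \<Gamma> X C \<longleftrightarrow> cotree \<Gamma> X C \<and> (\<forall>C'. cotree \<Gamma> X C' \<longrightarrow> subgraph C C')"

definition cyclic_orientation ::
    "('v, 'a) pre_digraph \<Rightarrow> ('a \<Rightarrow> 'a) \<Rightarrow> 'a set \<Rightarrow> bool" where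
  "cyclic_orientation C rv Or \<longleftrightarrow> arcs C = Or \<union> rv ` Or \<and> Or \<inter> rv ` Or = {}
     \<and> (\<forall>v\<in>verts C. \<exists>!a. a \<in> out_arcs C v \<inter> Or)"

definition single_vertex_cotree where
  "single_vertex_cotree \<Gamma> X C \<longleftrightarrow> cotree \<Gamma> X C \<and> (\<exists>v. verts C = {v})"

definition inversion_cotree where
  "inversion_cotree \<Gamma> rv X C \<longleftrightarrow> cotree \<Gamma> X C \<and>
     (\<exists>v a. verts C = {v} \<and> arcs C = {a} \<and> rv a = a \<and> card (X a) = 1)"

definition lineal_cotree where
  "lineal_cotree \<Gamma> rv X C \<longleftrightarrow> cotree \<Gamma> X C \<and> cyclic_graph C rv \<and> (\<forall>a\<in>arcs C. card (X a) = 1)"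

text \<open>\<open>|X\<^sub>a| \<ge> 2\<close> is not stated through \<^const>\<open>card\<close>, since \<open>X\<^sub>a\<close> may be infinite.\<close>

definition focal_cotree where
  "focal_cotree \<Gamma> rv X C Or \<longleftrightarrow> cotree \<Gamma> X C \<and> cyclic_graph C rv \<and> cyclic_orientation C rv Or
     \<and> (\<forall>a\<in>Or. card (X a) = 1) \<and> (\<exists>a\<in>arcs C - Or. \<exists>x\<in>X a. \<exists>y\<in>X a. x \<noteq> y)"

text \<open>
  A unique horocyclic end does not by itself rule out a single vertex cotree: if \<open>\<Gamma>\<close> is a ray and all
  \<open>X\<^sub>a\<close> are singletons, both exist and the universal group is trivial, hence of fixed vertex type.
  A characterisation of the horocyclic type has to exclude single vertex cotrees separately.
\<close>

definition horocyclic_ends ::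
    "('v, 'a) pre_digraph \<Rightarrow> ('a \<Rightarrow> 'a) \<Rightarrow> ('a \<Rightarrow> 'x set) \<Rightarrow> (nat \<Rightarrow> 'a) set set" where
  "horocyclic_ends \<Gamma> rv X =
     {\<xi> \<in> ends \<Gamma>. is_tree \<Gamma> rv \<and> (\<forall>a\<in>arcs_towards \<Gamma> \<xi>. card (X a) = 1)}"


section \<open>Correspondence\<close>

text \<open>
  The scopos attached to a subgraph \<open>C\<close> (a cotree of \<open>\<Gamma>\<close> or a subtree of \<open>T\<close>), to a cyclic cotree
  with a cyclic orientation and to an end are \<open>cotree_scopo G C\<close>, \<open>cotree_scopo G C \<union> Or\<close> and
  \<open>arcs_towards G \<xi>\<close>, respectively.
\<close>

definition cotree_scopo :: "('v, 'a) pre_digraph \<Rightarrow> ('v, 'a) pre_digraph \<Rightarrow> 'a set" where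
  "cotree_scopo G C = {a \<in> arcs G. tail G a \<notin> verts C \<and>
     (\<exists>p. projecting_path G C (tail G a) p \<and> a \<in> set p)}"

definition corresponds ::
    "('w, 'b) pre_digraph \<Rightarrow> ('b \<Rightarrow> 'a) \<Rightarrow> 'b set \<Rightarrow> 'a set \<Rightarrow> bool" where
  "corresponds T piA OT Or \<longleftrightarrow> OT = {b \<in> arcs T. piA b \<in> Or}"

definition one_to_one :: "'c set \<Rightarrow> 'd set \<Rightarrow> ('c \<Rightarrow> 'd \<Rightarrow> bool) \<Rightarrow> bool" where
  "one_to_one A B R \<longleftrightarrow>
     (\<forall>x\<in>A. \<exists>!y. y \<in> B \<and> R x y) \<and> (\<forall>y\<in>B. \<exists>!x. x \<in> A \<and> R x y)"

end

theory Submission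
  imports Defs
begin

text \<open>
  A vertex, an edge, a subtree or an end of a tree is determined by the orientation of the edges
  pointing towards it. All these orientations are \<^emph>\<open>core scopos\<close>: outside a set \<open>V\<close> of vertices, the
  core, exactly one oriented arc leaves each vertex, and every edge not inside \<open>V\<close> is oriented in
  exactly one direction. In any graph, the core scopos whose walks all end in the core are the
  scopos of cotrees (\<open>cotree_scopo_eq\<close>, \<open>graph_cotree_core_scopo\<close>). In a tree, their cores are the
  subtrees (\<open>subtree_induce\<close>, \<open>subtree_core_scopo\<close>), while the core scopos with empty core are the
  ends (\<open>ends_iff\<close>).

  A local permutation extends from a vertex to an element of the universal group, so the group is
  transitive on the arcs of \<open>T\<close> above an arc of \<open>\<Gamma>\<close> (\<open>universal_group_transitive\<close>). Hence the invariant
  core scopos of \<open>T\<close> are the preimages of the core scopos of \<open>\<Gamma>\<close> with \<open>|X\<^sub>a| = 1\<close> on all oriented arcs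
  (\<open>lift_core_scopo\<close>, \<open>descend_core_scopo\<close>). This translates fixed vertices, inverted edges and
  invariant subtrees into cotrees, and fixed ends into orientations of \<open>\<Gamma>\<close> with empty core. Such an
  orientation maps each vertex to a successor. Either the map has a periodic flow; then the flow is
  a cyclic cotree whose lift is the axis of a translation (\<open>periodic_flow_cyclic_cotree\<close>,
  \<open>delta_end_translation\<close>). Or it has none; then \<open>\<Gamma>\<close> is a tree and the orientation points to a
  horocyclic end (\<open>delta_end_is_tree\<close>, \<open>horocyclic_ends_eq\<close>). Since a translation fixes at most the two
  ends of its axis (\<open>axis_ends\<close>), the lineal and the focal type differ in whether the opposite
  cyclic orientation consists of arcs with \<open>|X\<^sub>a| = 1\<close> as well.

  That the list of types is complete rests on a criterion for translations: two distinct arcs with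
  the same image in \<open>\<Gamma>\<close> yield a translation if some walk without backtracking traverses both of them
  forwards (\<open>translation_exists\<close>). If there is no translation, arcs with the same image point
  towards each other or away from each other, and the arcs of the first kind form an invariant
  orientation, which leads to a fixed vertex, an inverted edge or a fixed end
  (\<open>no_translation_cases\<close>). If there is one, the same criterion shows that the union of all axes is
  convex; it is the smallest invariant subtree (\<open>axis_arcs_convex\<close>, \<open>axis_verts_minimal\<close>).
\<close>

section \<open>Walks, turns and orientations with a core\<close>

text \<open>
  The steps of walks without backtracking. Backtracking is tested on arcs here; this is what
  survives in \<open>T\<close> when a walk is lifted from \<open>\<Gamma>\<close>, and in a simple graph it amounts to the
  same as the test on vertices.
\<close>

definition turn :: "('v, 'a) pre_digraph \<Rightarrow> ('a \<Rightarrow> 'a) \<Rightarrow> 'a \<Rightarrow> 'a \<Rightarrow> bool" where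
  "turn G rv b c \<longleftrightarrow> b \<in> arcs G \<and> c \<in> arcs G \<and> head G b = tail G c \<and> c \<noteq> rv b"

abbreviation leads :: "('v, 'a) pre_digraph \<Rightarrow> ('a \<Rightarrow> 'a) \<Rightarrow> 'a \<Rightarrow> 'a \<Rightarrow> bool" where
  "leads G rv \<equiv> (turn G rv)\<^sup>+\<^sup>+"

text \<open>
  A strongly confluent partial orientation that orients every edge except those inside \<open>V\<close>. The
  core \<open>V\<close> can be read off as the set of vertices without an outgoing arc. With \<open>V = {v}\<close> this is
  the orientation towards a vertex of a tree, with \<open>V = {}\<close> the orientation towards an end.
\<close>

definition core_scopo ::
    "('v, 'a) pre_digraph \<Rightarrow> ('a \<Rightarrow> 'a) \<Rightarrow> 'v set \<Rightarrow> 'a set \<Rightarrow> bool" where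
  "core_scopo G rv V Or \<longleftrightarrow> V \<subseteq> verts G \<and> Or \<subseteq> arcs G
     \<and> (\<forall>v\<in>verts G - V. \<exists>!a. a \<in> Or \<and> tail G a = v)
     \<and> (\<forall>a\<in>Or. tail G a \<notin> V)
     \<and> (\<forall>a\<in>arcs G. tail G a \<notin> V \<or> head G a \<notin> V \<longrightarrow> (a \<in> Or \<longleftrightarrow> rv a \<notin> Or))"

definition follows :: "('v, 'a) pre_digraph \<Rightarrow> 'a set \<Rightarrow> 'a \<Rightarrow> 'a \<Rightarrow> bool" where
  "follows G Or b c \<longleftrightarrow> c \<in> Or \<and> head G b = tail G c"

text \<open>
  Separates the orientation towards \<open>V\<close> from orientations some of whose walks escape to infinity
  or run around a cycle.
\<close>

definition funnels :: "('v, 'a) pre_digraph \<Rightarrow> 'v set \<Rightarrow> 'a set \<Rightarrow> bool" where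
  "funnels G V Or \<longleftrightarrow> (\<forall>a\<in>Or. \<exists>c. (follows G Or)\<^sup>*\<^sup>* a c \<and> head G c \<in> V)"

lemma induced_subgraph_eq: "induced_subgraph C G \<Longrightarrow> C = G \<restriction> verts C"
  by (cases C) (auto simp: induced_subgraph_def subgraph_def compatible_def induce_subgraph_def)

lemma induce_subgraph_mono:
  "wf_digraph G \<Longrightarrow> V \<subseteq> V' \<Longrightarrow> subgraph (G \<restriction> V) (G \<restriction> V')"
  unfolding subgraph_def compatible_def
  by (auto simp: wf_digraph.wellformed_induce_subgraph)

lemma backtracking_Cons:
  "backtracking (x # vs) \<longleftrightarrow> (2 \<le> length vs \<and> vs ! 1 = x) \<or> backtracking vs"
proof
  assume "backtracking (x # vs)"
  then obtain i where i: "i + 2 < length (x # vs)" "(x # vs) ! i = (x # vs) ! (i + 2)"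
    unfolding backtracking_def by blast
  show "(2 \<le> length vs \<and> vs ! 1 = x) \<or> backtracking vs"
  proof (cases i)
    case 0
    then show ?thesis using i by auto
  next
    case (Suc j)
    then have "j + 2 < length vs \<and> vs ! j = vs ! (j + 2)" using i by simp
    then show ?thesis unfolding backtracking_def by blast
  qed
next
  assume "(2 \<le> length vs \<and> vs ! 1 = x) \<or> backtracking vs"
  then show "backtracking (x # vs)"
  proof
    assume "2 \<le> length vs \<and> vs ! 1 = x"
    then show ?thesis unfolding backtracking_def by (intro exI[of _ 0]) auto
  next
    assume "backtracking vs"
    then obtain i where "i + 2 < length vs" "vs ! i = vs ! (i + 2)"
      unfolding backtracking_def by blast
    then show ?thesis unfolding backtracking_def by (intro exI[of _ "Suc i"]) auto
  qed
qed

context rgraph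
begin

lemma head_rv: "a \<in> arcs G \<Longrightarrow> head G (rv a) = tail G a"
  using tail_rv[of "rv a"] rv_in_arcs rv_rv by simp

lemma turn_rv: "turn G rv b c \<Longrightarrow> turn G rv (rv c) (rv b)"
  unfolding turn_def by (metis head_rv tail_rv rv_in_arcs rv_rv)

lemma leads_rv: "leads G rv b c \<Longrightarrow> leads G rv (rv c) (rv b)"
proof (induction rule: tranclp_induct)
  case (base c)
  then show ?case using turn_rv by blast
next
  case (step c d)
  then show ?case using turn_rv[of c d] by (metis tranclp_into_tranclp2)
qed

lemma leads_arcs: "leads G rv b c \<Longrightarrow> b \<in> arcs G \<and> c \<in> arcs G"
  by (induction rule: tranclp_induct) (auto simp: turn_def)

lemma connected_induct:
  assumes "strongly_connected G" "u \<in> verts G" "P u"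
    and "\<And>a. a \<in> arcs G \<Longrightarrow> P (tail G a) \<Longrightarrow> P (head G a)" and "v \<in> verts G"
  shows "P v"
proof -
  have "u \<rightarrow>\<^sup>*\<^bsub>G\<^esub> v" using assms unfolding strongly_connected_def by blast
  then show ?thesis
    by (induction rule: reachable_induct) (use assms in auto)
qed

lemma out_arc_exists:
  assumes "strongly_connected G" "u \<in> verts G" "v \<in> verts G" "u \<noteq> v"
  shows "\<exists>a\<in>arcs G. tail G a = u"
proof (rule ccontr)
  assume *: "\<not> ?thesis"
  have "v = u"
    by (rule connected_induct[OF assms(1,2), where P = "\<lambda>x. x = u"]) (use * assms in auto)
  with assms show False by simp
qed

lemma projecting_path_Nil:
  "verts C \<subseteq> verts G \<Longrightarrow> projecting_path G C v [] \<longleftrightarrow> v \<in> verts C"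
  by (auto simp: projecting_path_def awalk_Nil_iff backtracking_def)

text \<open>
  The conditions on indices are unfolded along the list, so that projecting paths can be
  treated by induction.
\<close>

lemma projecting_path_Cons:
  assumes "verts C \<subseteq> verts G"
  shows "projecting_path G C v (a # p) \<longleftrightarrow> a \<in> arcs G \<and> tail G a = v \<and> v \<notin> verts C
     \<and> projecting_path G C (head G a) p \<and> (p = [] \<or> head G (hd p) \<noteq> v)"
proof -
  have "2 \<le> length (awalk_verts (head G a) p) \<and> awalk_verts (head G a) p ! 1 = tail G a
      \<longleftrightarrow> p \<noteq> [] \<and> head G (hd p) = tail G a"
    if "awalk (head G a) p w" for w
  proof (cases p)
    case (Cons b q)
    have "awalk_verts (head G b) q ! 0 = head G b"
      using that Cons by (cases q) (auto simp: awalk_Cons_iff)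
    then show ?thesis using Cons by (simp add: length_awalk_verts)
  qed simp
  then show ?thesis
    unfolding projecting_path_def backtracking_Cons awalk_verts.simps
    by (auto simp: awalk_Cons_iff)
qed

end

locale core_scopo_graph = rgraph +
  fixes V :: "'a set" and Or :: "'b set"
  assumes core_scopo: "core_scopo G rv V Or"
begin

lemma scopo_arcs: "a \<in> Or \<Longrightarrow> a \<in> arcs G"
  using core_scopo unfolding core_scopo_def by blast

lemma core_verts: "V \<subseteq> verts G"
  using core_scopo unfolding core_scopo_def by blast

lemma scopo_tail: "a \<in> Or \<Longrightarrow> tail G a \<notin> V"
  using core_scopo unfolding core_scopo_def by blast

lemma scopo_unique: "a \<in> Or \<Longrightarrow> b \<in> Or \<Longrightarrow> tail G a = tail G b \<Longrightarrow> a = b"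
  using core_scopo scopo_tail[of a] scopo_arcs[of a] unfolding core_scopo_def
  by (metis DiffI tail_in_verts)

lemma scopo_out: "v \<in> verts G \<Longrightarrow> v \<notin> V \<Longrightarrow> \<exists>a\<in>Or. tail G a = v"
  using core_scopo unfolding core_scopo_def by blast

lemma scopo_rv_iff:
  "a \<in> arcs G \<Longrightarrow> tail G a \<notin> V \<or> head G a \<notin> V \<Longrightarrow> rv a \<in> Or \<longleftrightarrow> a \<notin> Or"
  using core_scopo unfolding core_scopo_def by blast

lemma scopo_rv_notin: "a \<in> Or \<Longrightarrow> rv a \<notin> Or"
  using scopo_rv_iff scopo_arcs scopo_tail by blast

text \<open>
  Orientations propagate backwards along walks: at the vertex between \<open>b\<close> and \<open>c\<close> the only oriented
  arc that leaves is \<open>c\<close>, which is not the reverse of \<open>b\<close>, so that the edge of \<open>b\<close> is oriented as \<open>b\<close>.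
  Most arguments below rest on this.
\<close>

lemma scopo_back: "turn G rv b c \<Longrightarrow> c \<in> Or \<Longrightarrow> b \<in> Or"
  using scopo_rv_iff[of b] scopo_tail[of c] scopo_unique[of c "rv b"] tail_rv
  unfolding turn_def by metis

lemma scopo_back_leads: "leads G rv b c \<Longrightarrow> c \<in> Or \<Longrightarrow> b \<in> Or"
  by (induction rule: tranclp_induct) (auto dest: scopo_back)

lemma scopo_into_core: "a \<in> arcs G \<Longrightarrow> head G a \<in> V \<Longrightarrow> tail G a \<notin> V \<Longrightarrow> a \<in> Or"
  using scopo_rv_iff scopo_tail tail_rv by metis

lemma follows_turn: "b \<in> Or \<Longrightarrow> follows G Or b c \<Longrightarrow> turn G rv b c"
  unfolding follows_def turn_def using scopo_arcs scopo_rv_notin by blast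

lemma follows_star:
  "(follows G Or)\<^sup>*\<^sup>* b c \<Longrightarrow> b \<in> Or \<Longrightarrow> c \<in> Or \<and> (turn G rv)\<^sup>*\<^sup>* b c"
proof (induction rule: rtranclp_induct)
  case (step y z)
  then show ?case using follows_turn[of y z] unfolding follows_def
    by (auto intro: rtranclp.rtrancl_into_rtrancl)
qed auto

lemma funnel_path:
  assumes "funnels G V Or" "a \<in> Or"
  shows "\<exists>c\<in>Or. (turn G rv)\<^sup>*\<^sup>* a c \<and> head G c \<in> V"
  using assms follows_star unfolding funnels_def by blast

text \<open>
  The last arc of a projecting path enters the core, hence is oriented, and the orientation
  propagates back to the first arc.
\<close>

lemma projecting_path_in_scopo:
  "verts C = V \<Longrightarrow> projecting_path G C v p \<Longrightarrow> set p \<subseteq> Or"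
proof (induction p arbitrary: v)
  case (Cons a p)
  have VC: "verts C \<subseteq> verts G" using Cons.prems core_verts by simp
  note * = Cons.prems(2)[unfolded projecting_path_Cons[OF VC]]
  have sub: "set p \<subseteq> Or" using Cons.IH Cons.prems(1) * by blast
  have "a \<in> Or"
  proof (cases p)
    case Nil
    then show ?thesis using * VC Cons.prems(1) scopo_into_core
      by (auto simp: projecting_path_Nil)
  next
    case (Cons b q)
    then have "turn G rv a b"
      using * VC head_rv unfolding turn_def by (auto simp: projecting_path_Cons)
    then show ?thesis using scopo_back sub Cons by auto
  qed
  then show ?case using sub by simp
qed simp

lemma projecting_path_unique:
  "verts C = V \<Longrightarrow> projecting_path G C v p \<Longrightarrow> projecting_path G C v q \<Longrightarrow> p = q"
proof (induction p arbitrary: v q)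
  case Nil
  then show ?case using core_verts
    by (cases q) (auto simp: projecting_path_Nil projecting_path_Cons)
next
  case (Cons a p)
  have VC: "verts C \<subseteq> verts G" using Cons.prems core_verts by simp
  note * = Cons.prems(2)[unfolded projecting_path_Cons[OF VC]]
  obtain b q' where q: "q = b # q'"
    using Cons.prems * VC by (cases q) (auto simp: projecting_path_Nil)
  note ** = Cons.prems(3)[unfolded q projecting_path_Cons[OF VC]]
  have "a = b"
    using projecting_path_in_scopo[OF Cons.prems(1,2)] projecting_path_in_scopo[OF Cons.prems(1,3)]
      * ** q scopo_unique by auto
  then show ?case using Cons.IH Cons.prems(1) * ** q by blast
qed

text \<open>
  Following \<open>Or\<close> gives a projecting path. It cannot return to a vertex two steps earlier: otherwise
  that vertex would start two projecting paths, one a proper part of the other.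
\<close>

lemma projecting_path_exists:
  assumes "verts C = V" "funnels G V Or" "v \<in> verts G"
  shows "\<exists>p. projecting_path G C v p"
proof (cases "v \<in> V")
  case True
  then show ?thesis using assms core_verts projecting_path_Nil by metis
next
  case False
  have VC: "verts C \<subseteq> verts G" using assms core_verts by simp
  obtain a where a: "a \<in> Or" "tail G a = v" using scopo_out False assms by blast
  obtain c where c: "(follows G Or)\<^sup>*\<^sup>* a c" "head G c \<in> V"
    using assms a unfolding funnels_def by blast
  from c(1) a(1) have "\<exists>p. projecting_path G C (tail G a) (a # p)"
  proof (induction rule: converse_rtranclp_induct)
    case base
    then show ?case using c(2) VC assms scopo_tail scopo_arcs
      by (intro exI[of _ "[]"]) (auto simp: projecting_path_Cons projecting_path_Nil)
  next
    case (step a b)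
    then have ab: "a \<in> Or" "b \<in> Or" "head G a = tail G b" unfolding follows_def by auto
    obtain p where p: "projecting_path G C (tail G b) (b # p)" using step ab by blast
    have "head G b \<noteq> tail G a"
    proof
      assume eq: "head G b = tail G a"
      have p': "projecting_path G C (tail G a) p"
        using p eq VC by (simp add: projecting_path_Cons)
      then obtain d p'' where d: "p = d # p''"
        using VC assms scopo_tail[OF ab(1)] by (cases p) (auto simp: projecting_path_Nil)
      have "d = a" using projecting_path_in_scopo[OF assms(1) p'] d p' VC ab scopo_unique
        by (auto simp: projecting_path_Cons)
      then have "projecting_path G C (tail G b) p''"
        using p' d VC ab by (auto simp: projecting_path_Cons)
      then have "p'' = b # p" using projecting_path_unique[OF assms(1)] p by blast
      then show False using d by auto
    qed
    then have "projecting_path G C (tail G a) (a # b # p)"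
      using p VC ab scopo_arcs scopo_tail assms(1) by (auto simp: projecting_path_Cons)
    then show ?case by blast
  qed
  then show ?thesis using a by blast
qed

lemma cotree_scopo_eq:
  assumes "verts C = V" "funnels G V Or"
  shows "cotree_scopo G C = Or"
proof
  show "cotree_scopo G C \<subseteq> Or"
    unfolding cotree_scopo_def using projecting_path_in_scopo[OF assms(1)] by blast
  show "Or \<subseteq> cotree_scopo G C"
  proof
    fix a assume a: "a \<in> Or"
    have VC: "verts C \<subseteq> verts G" using assms core_verts by simp
    obtain p where p: "projecting_path G C (tail G a) p"
      using projecting_path_exists[OF assms, of "tail G a"] a scopo_arcs tail_in_verts by blast
    then obtain b q where q: "p = b # q"
      using VC assms scopo_tail[OF a] by (cases p) (auto simp: projecting_path_Nil)
    then have "b = a" using projecting_path_in_scopo[OF assms(1) p] p VC a scopo_unique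
      by (auto simp: projecting_path_Cons)
    then show "a \<in> cotree_scopo G C"
      unfolding cotree_scopo_def using a p q scopo_arcs scopo_tail assms by auto
  qed
qed

lemma graph_cotree_induce:
  assumes "V \<noteq> {}" "funnels G V Or"
  shows "graph_cotree G (G \<restriction> V)"
  unfolding graph_cotree_def
  using assms projecting_path_exists[of "G \<restriction> V"] projecting_path_unique[of "G \<restriction> V"] core_verts
    induced_induce
  by auto

end

context rgraph
begin

lemma core_scopo_graphI: "core_scopo G rv V Or \<Longrightarrow> core_scopo_graph G rv V Or"
  by unfold_locales

text \<open>
  The arcs of the scopo of a cotree are the first arcs of the projecting paths. Let \<open>a\<close> lead from a
  vertex \<open>u\<close> outside the cotree to \<open>w\<close>. Putting \<open>a\<close> in front of the projecting path of \<open>w\<close> gives the one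
  of \<open>u\<close>, unless the path of \<open>w\<close> starts by moving to \<open>u\<close>; in that case uniqueness forces its first
  arc to be the reverse of \<open>a\<close>. So every edge outside is oriented, and uniqueness of the paths
  excludes both directions at once.
\<close>

lemma graph_cotree_core_scopo:
  assumes C: "graph_cotree G C"
  shows "core_scopo G rv (verts C) (cotree_scopo G C) \<and> funnels G (verts C) (cotree_scopo G C)"
proof -
  have VC: "verts C \<subseteq> verts G"
    using C unfolding graph_cotree_def induced_subgraph_def subgraph_def by blast
  note pp = projecting_path_Nil[OF VC] projecting_path_Cons[OF VC]
  define P where "P v = (THE p. projecting_path G C v p)" for v
  have ex: "\<exists>!p. projecting_path G C v p" if "v \<in> verts G - verts C" for v
    using C that unfolding graph_cotree_def by blast
  have P: "projecting_path G C v (P v)" if "v \<in> verts G - verts C" for v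
    unfolding P_def using theI'[OF ex[OF that]] .
  have P_unique: "p = P v" if "v \<in> verts G - verts C" "projecting_path G C v p" for v p
    using ex that P by blast
  have P_Cons: "\<exists>a q. P v = a # q" if "v \<in> verts G - verts C" for v
    using P[OF that] that by (cases "P v") (auto simp: pp)
  have suffix: "projecting_path G C (tail G a) (a # r)"
    if "projecting_path G C v (q @ a # r)" for v q a r
    using that by (induction q arbitrary: v) (auto simp: pp)
  have sc: "a \<in> cotree_scopo G C \<longleftrightarrow> a \<in> arcs G \<and> tail G a \<notin> verts C \<and> (\<exists>r. P (tail G a) = a # r)" for a
  proof
    assume a: "a \<in> cotree_scopo G C"
    then obtain p where p: "projecting_path G C (tail G a) p" "a \<in> set p"
      unfolding cotree_scopo_def by blast
    obtain q r where "p = q @ a # r" using p(2) by (auto simp: in_set_conv_decomp)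
    then have "projecting_path G C (tail G a) (a # r)" using suffix p by blast
    then show "a \<in> arcs G \<and> tail G a \<notin> verts C \<and> (\<exists>r. P (tail G a) = a # r)"
      using a P_unique unfolding cotree_scopo_def by (auto intro!: exI[of _ r])
  next
    assume a: "a \<in> arcs G \<and> tail G a \<notin> verts C \<and> (\<exists>r. P (tail G a) = a # r)"
    then obtain r where r: "P (tail G a) = a # r" by blast
    then show "a \<in> cotree_scopo G C"
      unfolding cotree_scopo_def using a P[of "tail G a"] by fastforce
  qed
  have one: "a \<in> cotree_scopo G C \<or> rv a \<in> cotree_scopo G C"
    if a: "a \<in> arcs G" "tail G a \<notin> verts C" for a
  proof (cases "head G a \<in> verts C")
    case True
    then have "projecting_path G C (tail G a) [a]" using a by (auto simp: pp)
    then show ?thesis using P_unique sc a by fastforce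
  next
    case False
    obtain c r where c: "P (head G a) = c # r" using P_Cons[of "head G a"] False a by auto
    have pc: "projecting_path G C (head G a) (c # r)" using P[of "head G a"] c False a by simp
    show ?thesis
    proof (cases "head G c = tail G a")
      case False
      then have "projecting_path G C (tail G a) (a # c # r)" using a pc by (auto simp: pp)
      then show ?thesis using P_unique sc a by fastforce
    next
      case True
      then have "projecting_path G C (head G a) (rv a # r)"
        using pc a rv_in_arcs tail_rv head_rv by (auto simp: pp)
      then have "rv a # r = P (head G a)" using P_unique[of "head G a"] False a by simp
      then have "\<exists>r. P (tail G (rv a)) = rv a # r" using tail_rv[of a] a by (auto intro: sym)
      then show ?thesis
        using sc[of "rv a"] False a rv_in_arcs[of a] tail_rv[of a] by simp
    qed
  qed
  have "core_scopo G rv (verts C) (cotree_scopo G C)"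
    unfolding core_scopo_def
  proof (intro conjI ballI impI)
    show "verts C \<subseteq> verts G" by (rule VC)
    show "cotree_scopo G C \<subseteq> arcs G" unfolding cotree_scopo_def by blast
    show "\<exists>!a. a \<in> cotree_scopo G C \<and> tail G a = v" if v: "v \<in> verts G - verts C" for v
    proof -
      obtain a q where aq: "P v = a # q" using P_Cons v by blast
      then have "a \<in> arcs G" "tail G a = v" using P[OF v] by (auto simp: pp)
      then have "a \<in> cotree_scopo G C" using aq sc[of a] v by simp
      moreover have "b = a" if "b \<in> cotree_scopo G C" "tail G b = v" for b
        using that sc[of b] aq by simp
      ultimately show ?thesis using \<open>tail G a = v\<close> by blast
    qed
    show "tail G a \<notin> verts C" if "a \<in> cotree_scopo G C" for a
      using that sc[of a] by simp
    fix a assume a: "a \<in> arcs G" "tail G a \<notin> verts C \<or> head G a \<notin> verts C"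
    have "\<not> (a \<in> cotree_scopo G C \<and> rv a \<in> cotree_scopo G C)"
    proof
      assume *: "a \<in> cotree_scopo G C \<and> rv a \<in> cotree_scopo G C"
      then obtain r s where r: "P (tail G a) = a # r" and s: "P (head G a) = rv a # s"
        and t: "tail G a \<notin> verts C" "head G a \<notin> verts C"
        using sc[of a] sc[of "rv a"] a tail_rv[of a] by auto
      have pr: "projecting_path G C (tail G a) (a # r)" using P[of "tail G a"] r t a by simp
      then have "projecting_path G C (head G a) r" by (simp add: pp)
      then have "r = rv a # s" using P_unique[of "head G a" r] t a s by simp
      then show False using pr a head_rv by (auto simp: pp)
    qed
    moreover have "a \<in> cotree_scopo G C \<or> rv a \<in> cotree_scopo G C"
      using one[of a] one[of "rv a"] a rv_in_arcs[of a] rv_rv[of a] tail_rv[of a] by auto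
    ultimately show "a \<in> cotree_scopo G C \<longleftrightarrow> rv a \<notin> cotree_scopo G C" by blast
  qed
  moreover have "funnels G (verts C) (cotree_scopo G C)"
    unfolding funnels_def
  proof
    fix a assume a: "a \<in> cotree_scopo G C"
    then obtain r where r: "P (tail G a) = a # r" and t: "a \<in> arcs G" "tail G a \<notin> verts C"
      using sc by blast
    have "projecting_path G C (tail G a) (a # r)" using P[of "tail G a"] r t by simp
    with a t show "\<exists>c. (follows G (cotree_scopo G C))\<^sup>*\<^sup>* a c \<and> head G c \<in> verts C"
    proof (induction r arbitrary: a)
      case Nil
      then show ?case by (auto simp: pp)
    next
      case (Cons b r)
      have b: "projecting_path G C (tail G b) (b # r)" "head G a = tail G b"
        using Cons.prems by (auto simp: pp)
      have tb: "b \<in> arcs G" "tail G b \<notin> verts C" using b(1) by (auto simp: pp)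
      have "b \<in> cotree_scopo G C" unfolding cotree_scopo_def using b tb by auto
      then have "follows G (cotree_scopo G C) a b" unfolding follows_def using b by simp
      moreover obtain c where "(follows G (cotree_scopo G C))\<^sup>*\<^sup>* b c \<and> head G c \<in> verts C"
        using Cons.IH[OF \<open>b \<in> cotree_scopo G C\<close>] tb b by blast
      ultimately show ?case by (intro exI[of _ c]) (auto intro: converse_rtranclp_into_rtranclp)
    qed
  qed
  ultimately show ?thesis by blast
qed

lemma core_scopo_empty_subset_eq:
  assumes "core_scopo G rv {} Or" "core_scopo G rv {} Or'" "Or \<subseteq> Or'"
  shows "Or = Or'"
proof
  interpret A: core_scopo_graph G rv "{}" Or by (rule core_scopo_graphI[OF assms(1)])
  interpret B: core_scopo_graph G rv "{}" Or' by (rule core_scopo_graphI[OF assms(2)])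
  show "Or' \<subseteq> Or"
  proof
    fix a assume a: "a \<in> Or'"
    show "a \<in> Or"
      using B.scopo_rv_notin[OF a] B.scopo_arcs[OF a] A.scopo_rv_iff[of a] assms(3) by auto
  qed
qed (rule assms(3))

text \<open>
  The vertices of a cotree are those that are not the tail of an arc of its scopo, so that a
  correspondence of scopos determines the cotree.
\<close>

lemma cotree_eqI:
  assumes "graph_cotree G C" "graph_cotree G C'" "cotree_scopo G C = cotree_scopo G C'"
  shows "C = C'"
proof -
  have "verts C = verts C'"
  proof -
    interpret A: core_scopo_graph G rv "verts C" "cotree_scopo G C"
      by (rule core_scopo_graphI) (use graph_cotree_core_scopo assms in blast)
    interpret B: core_scopo_graph G rv "verts C'" "cotree_scopo G C'"
      by (rule core_scopo_graphI) (use graph_cotree_core_scopo assms in blast)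
    have "v \<in> verts C \<longleftrightarrow> v \<in> verts C'" if "v \<in> verts G" for v
      using A.scopo_out[OF that] B.scopo_out[OF that] A.scopo_tail B.scopo_tail assms(3) by metis
    then show ?thesis using A.core_verts B.core_verts by blast
  qed
  then show ?thesis
    using assms induced_subgraph_eq unfolding graph_cotree_def by metis
qed

end

section \<open>Reduced walks in trees\<close>

abbreviation reduced :: "('a \<Rightarrow> 'a) \<Rightarrow> 'a list \<Rightarrow> bool" where
  "reduced rv \<equiv> successively (\<lambda>a b. b \<noteq> rv a)"

abbreviation toward :: "('v, 'a) pre_digraph \<Rightarrow> 'v \<Rightarrow> 'a set" where
  "toward G v \<equiv> cotree_scopo G (G \<restriction> {v})"

lemma leads_last: "leads G rv b c \<Longrightarrow> \<exists>e. (turn G rv)\<^sup>*\<^sup>* b e \<and> turn G rv e c"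
  by (erule tranclp.cases) (auto intro: tranclp_into_rtranclp)

lemma turns_cases: "(turn G rv)\<^sup>*\<^sup>* b c \<Longrightarrow> b = c \<or> leads G rv b c"
  by (simp add: Nitpick.rtranclp_unfold)

context rgraph
begin

lemma reachable_sym: "u \<rightarrow>\<^sup>*\<^bsub>G\<^esub> v \<Longrightarrow> v \<rightarrow>\<^sup>*\<^bsub>G\<^esub> u"
proof (rule symmetric_reachable)
  show "symmetric G"
    unfolding symmetric_conv using rv_in_arcs tail_rv head_rv by metis
qed

lemma strongly_connectedI:
  assumes "w \<in> verts G" "\<And>x. x \<in> verts G \<Longrightarrow> x \<rightarrow>\<^sup>*\<^bsub>G\<^esub> w"
  shows "strongly_connected G"
  unfolding strongly_connected_def using assms reachable_sym reachable_trans by blast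

lemma rgraph_induce: "W \<subseteq> verts G \<Longrightarrow> rgraph (G \<restriction> W) rv"
  by unfold_locales (auto simp: rv_in_arcs rv_rv tail_rv head_rv)

lemma awalk_rev: "awalk u p v \<Longrightarrow> awalk v (rev (map rv p)) u"
proof (induction p arbitrary: u)
  case (Cons a p)
  then have "awalk v (rev (map rv p)) (head G a)" "a \<in> arcs G" "tail G a = u"
    by (auto simp: awalk_Cons_iff)
  then show ?case
    using rv_in_arcs[of a] tail_rv[of a] head_rv[of a]
    by (auto simp: awalk_append_iff awalk_Cons_iff awalk_Nil_iff intro!: exI)
qed (auto simp: awalk_Nil_iff)

lemma reduced_rev:
  assumes "set p \<subseteq> arcs G" "reduced rv p"
  shows "reduced rv (rev (map rv p))"
proof -
  have "successively (\<lambda>x y. rv x \<noteq> rv (rv y)) p"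
    using assms(2) by (rule successively_mono) (use assms(1) rv_rv in auto)
  then show ?thesis by (simp add: successively_rev successively_map)
qed

text \<open>
  A shortest closed reduced subwalk repeats no vertex. That it is a genuine cycle needs
  reducedness in length two and the absence of loops in length one.
\<close>

lemma reduced_closed_awalk_cycle:
  assumes "loopfree_digraph G" "awalk u p u" "p \<noteq> []" "reduced rv p"
  shows "\<exists>q. graph_cycle G rv q"
  using assms(2-4)
proof (induction "length p" arbitrary: p u rule: less_induct)
  case less
  interpret loopfree_digraph G by (rule assms(1))
  obtain a p' where p: "p = a # p'" using less by (cases p) auto
  have w: "awalk (head G a) p' u" "a \<in> arcs G" "tail G a = u"
    using less.prems p by (auto simp: awalk_Cons_iff)
  show ?case
  proof (cases "distinct (awalk_verts (head G a) p')")
    case True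
    have "cycle p" unfolding cycle_def using less.prems p True by auto
    moreover have "length p \<noteq> 1" using w no_loops[of a] by (auto simp: p awalk_Nil_iff)
    moreover have "p ! 1 \<noteq> rv (p ! 0)" if "length p = 2"
      using less.prems(3) that p by (cases p') auto
    ultimately show ?thesis unfolding graph_cycle_def by blast
  next
    case False
    from awalk_not_distinct_decomp[OF w(1) this]
    obtain q r s x where d: "p' = q @ r @ s" "0 < length r" "awalk x r x" by blast
    have "reduced rv r" using less.prems(3) d(2) unfolding p d(1)
      by (auto simp: successively_Cons successively_append_iff)
    then show ?thesis using less.hyps[of r x] d p by auto
  qed
qed

text \<open>
  Completes the orientation towards \<open>V\<close> by an orientation of \<open>V\<close> itself, for instance by a cyclic
  orientation of a cyclic cotree, or by an end of a subtree.
\<close>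

lemma core_scopo_Un:
  assumes V: "core_scopo G rv V Or" and E: "core_scopo (G \<restriction> V) rv {} Or'"
  shows "core_scopo G rv {} (Or \<union> Or')"
proof -
  interpret A: core_scopo_graph G rv V Or by (rule core_scopo_graphI[OF V])
  interpret R: rgraph "G \<restriction> V" rv by (rule rgraph_induce[OF A.core_verts])
  interpret B: core_scopo_graph "G \<restriction> V" rv "{}" Or' by (rule R.core_scopo_graphI[OF E])
  have Or': "a \<in> arcs G \<and> tail G a \<in> V \<and> head G a \<in> V" if "a \<in> Or'" for a
    using B.scopo_arcs[OF that] by simp
  show ?thesis unfolding core_scopo_def
  proof (intro conjI ballI impI)
    show "Or \<union> Or' \<subseteq> arcs G" using A.scopo_arcs Or' by blast
    show "\<exists>!a. a \<in> Or \<union> Or' \<and> tail G a = v" if v: "v \<in> verts G - {}" for v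
    proof (cases "v \<in> V")
      case True
      then obtain a where a: "a \<in> Or'" "tail G a = v" using B.scopo_out[of v] by auto
      moreover have "b = a" if "b \<in> Or \<union> Or'" "tail G b = v" for b
        using that a True A.scopo_tail[of b] B.scopo_unique[of b a] by auto
      ultimately show ?thesis by blast
    next
      case False
      then obtain a where a: "a \<in> Or" "tail G a = v" using A.scopo_out[of v] v by auto
      moreover have "b = a" if "b \<in> Or \<union> Or'" "tail G b = v" for b
        using that a False Or'[of b] A.scopo_unique[of b a] by auto
      ultimately show ?thesis by blast
    qed
    fix a assume a: "a \<in> arcs G" "tail G a \<notin> {} \<or> head G a \<notin> {}"
    show "a \<in> Or \<union> Or' \<longleftrightarrow> rv a \<notin> Or \<union> Or'"
    proof (cases "tail G a \<in> V \<and> head G a \<in> V")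
      case True
      then have "a \<notin> Or" "rv a \<notin> Or"
        using A.scopo_tail[of a] A.scopo_tail[of "rv a"] tail_rv a by auto
      then show ?thesis using B.scopo_rv_iff[of a] True a by auto
    next
      case False
      then have "a \<notin> Or'" "rv a \<notin> Or'"
        using Or'[of a] Or'[of "rv a"] tail_rv[of a] head_rv[of a] a by auto
      then show ?thesis using A.scopo_rv_iff[of a] False a by auto
    qed
  qed auto
qed

end

locale tree_graph = rgraph +
  assumes is_tree: "is_tree G rv"

lemma tree_graphI: "is_tree G rv \<Longrightarrow> tree_graph G rv"
  by (rule tree_graph.intro) (simp_all add: is_tree_def tree_graph_axioms_def)

context tree_graph
begin

sublocale loopfree_digraph G using is_tree unfolding is_tree_def by blast
sublocale nomulti_digraph G using is_tree unfolding is_tree_def by blast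

lemma connected: "strongly_connected G"
  using is_tree unfolding is_tree_def by blast

lemma reduced_closed_awalk_Nil: "awalk u p u \<Longrightarrow> reduced rv p \<Longrightarrow> p = []"
  using reduced_closed_awalk_cycle[OF loopfree_digraph_axioms] is_tree unfolding is_tree_def by blast

text \<open>
  Where two reduced walks with the same endpoints first differ, the reverse of one rest followed by
  the other rest would be reduced and closed.
\<close>

lemma reduced_awalk_unique:
  assumes "awalk u p v" "awalk u q v" "reduced rv p" "reduced rv q"
  shows "p = q"
  using assms
proof (induction p arbitrary: u q)
  case Nil
  then have "u = v" by (simp add: awalk_Nil_iff)
  then show ?case using reduced_closed_awalk_Nil[of v q] Nil by simp
next
  case (Cons a p)
  show ?case
  proof (cases q)
    case Nil
    then have "u = v" using Cons.prems by (simp add: awalk_Nil_iff)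
    then show ?thesis using reduced_closed_awalk_Nil[of v "a # p"] Cons.prems by simp
  next
    case (Cons b q')
    note q = this
    have p1: "a \<in> arcs G" "tail G a = u" "awalk (head G a) p v" "reduced rv p"
      using Cons.prems by (auto simp: awalk_Cons_iff successively_Cons)
    have q1: "b \<in> arcs G" "tail G b = u" "awalk (head G b) q' v" "reduced rv q'"
      using Cons.prems unfolding q by (auto simp: awalk_Cons_iff successively_Cons)
    show ?thesis
    proof (cases "a = b")
      case True
      then show ?thesis using Cons.IH[of "head G a" q'] p1 q1 q by simp
    next
      case False
      let ?r = "rev (map rv (a # p)) @ q"
      have "awalk v ?r v"
        using awalk_rev[OF Cons.prems(1)] Cons.prems(2) by (rule awalk_appendI)
      moreover have "reduced rv ?r"
        unfolding successively_append_iff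
      proof (intro conjI)
        show "reduced rv (rev (map rv (a # p)))"
          using reduced_rev[of "a # p"] Cons.prems by (auto simp: awalk_def)
        show "reduced rv q" by (rule Cons.prems(4))
        show "rev (map rv (a # p)) = [] \<or> q = [] \<or> hd q \<noteq> rv (last (rev (map rv (a # p))))"
          using False p1 q by (simp add: rv_rv)
      qed
      ultimately have "?r = []" by (rule reduced_closed_awalk_Nil)
      then show ?thesis by simp
    qed
  qed
qed

lemma projecting_path_reduced:
  assumes "verts C = {v}" "v \<in> verts G" "projecting_path G C u p"
  shows "awalk u p v \<and> reduced rv p"
  using assms(3)
proof (induction p arbitrary: u)
  case Nil
  then show ?case using assms by (auto simp: projecting_path_Nil awalk_Nil_iff)
next
  case (Cons a p)
  have VC: "verts C \<subseteq> verts G" using assms by simp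
  note pp = projecting_path_Cons[OF VC]
  have "awalk (head G a) p v \<and> reduced rv p" using Cons.IH[of "head G a"] Cons.prems by (simp add: pp)
  moreover have "p = [] \<or> hd p \<noteq> rv a"
    using Cons.prems head_rv[of a] by (cases p) (auto simp: pp)
  ultimately show ?case using Cons.prems
    by (auto simp: pp awalk_Cons_iff successively_Cons)
qed

lemma apath_projecting_path:
  assumes "verts C = {v}" "v \<in> verts G" "apath u p v"
  shows "projecting_path G C u p"
  using assms(3)
proof (induction p arbitrary: u)
  case Nil
  then show ?case using assms by (auto simp: projecting_path_Nil apath_Nil_iff)
next
  case (Cons a p)
  have VC: "verts C \<subseteq> verts G" using assms by simp
  have *: "a \<in> arcs G" "tail G a = u" "apath (head G a) p v" "u \<notin> set (awalk_verts (head G a) p)"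
    using Cons.prems by (auto simp: apath_Cons_iff)
  have "v \<in> set (awalk_verts (head G a) p)"
    using *(3) awlast_of_awalk[of "head G a" p v] last_in_set[of "awalk_verts (head G a) p"]
    unfolding apath_def by auto
  moreover have "p = [] \<or> head G (hd p) \<in> set (awalk_verts (head G a) p)"
    using *(3) by (cases p; cases "tl p") (auto simp: apath_Cons_iff)
  ultimately show ?case
    using * Cons.IH[of "head G a"] assms(1) by (auto simp: projecting_path_Cons[OF VC])
qed

lemma graph_cotree_vertex:
  assumes "v \<in> verts G" shows "graph_cotree G (G \<restriction> {v})"
  unfolding graph_cotree_def
proof (intro conjI ballI)
  show "induced_subgraph (G \<restriction> {v}) G" using assms by (intro induced_induce) simp
  fix u assume u: "u \<in> verts G - verts (G \<restriction> {v})"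
  then have "u \<rightarrow>\<^sup>*\<^bsub>G\<^esub> v" using connected assms unfolding strongly_connected_def by blast
  then obtain p where p: "apath u p v" using reachable_apath by blast
  show "\<exists>!p. projecting_path G (G \<restriction> {v}) u p"
  proof (rule ex1I)
    show "projecting_path G (G \<restriction> {v}) u p"
      using apath_projecting_path[of "G \<restriction> {v}"] p assms by simp
    fix q assume q: "projecting_path G (G \<restriction> {v}) u q"
    show "q = p"
      using reduced_awalk_unique[of u q v p] assms
        projecting_path_reduced[of "G \<restriction> {v}" v u q] q
        projecting_path_reduced[of "G \<restriction> {v}" v u p] apath_projecting_path[of "G \<restriction> {v}" v u p] p
      by simp
  qed
qed simp

lemma toward_core_scopo: "v \<in> verts G \<Longrightarrow> core_scopo G rv {v} (toward G v)"
  using graph_cotree_core_scopo[OF graph_cotree_vertex] by simp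

lemma toward_funnels: "v \<in> verts G \<Longrightarrow> funnels G {v} (toward G v)"
  using graph_cotree_core_scopo[OF graph_cotree_vertex] by simp

lemma toward_graph: "v \<in> verts G \<Longrightarrow> core_scopo_graph G rv {v} (toward G v)"
  using core_scopo_graphI toward_core_scopo by blast

lemma toward_path:
  "v \<in> verts G \<Longrightarrow> a \<in> toward G v \<Longrightarrow> \<exists>c\<in>toward G v. (turn G rv)\<^sup>*\<^sup>* a c \<and> head G c = v"
  using core_scopo_graph.funnel_path[OF toward_graph toward_funnels] by blast

lemma in_toward_head: "a \<in> arcs G \<Longrightarrow> a \<in> toward G (head G a)"
  using core_scopo_graph.scopo_into_core[OF toward_graph, of "head G a" a] no_loops by force

lemma leads_in_toward: "leads G rv b c \<Longrightarrow> b \<in> toward G (head G c)"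
proof -
  assume bc: "leads G rv b c"
  then have c: "c \<in> arcs G" using leads_arcs by blast
  show ?thesis
    by (rule core_scopo_graph.scopo_back_leads[OF toward_graph bc in_toward_head[OF c]])
      (use c in simp)
qed

lemma turns_in_toward: "(turn G rv)\<^sup>*\<^sup>* b c \<Longrightarrow> c \<in> arcs G \<Longrightarrow> b \<in> toward G (head G c)"
  using turns_cases[of G rv b c] leads_in_toward[of b c] in_toward_head[of c] by blast

lemma leads_tail_neq_head: "leads G rv b c \<Longrightarrow> tail G b \<noteq> head G c"
  using leads_in_toward[of b c] core_scopo_graph.scopo_tail[OF toward_graph, of "head G c" b]
    leads_arcs[of b c] by simp

lemma leads_tail_neq_tail: "leads G rv b c \<Longrightarrow> tail G b \<noteq> tail G c"
proof -
  assume bc: "leads G rv b c"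
  from leads_last[OF bc] obtain e where e: "(turn G rv)\<^sup>*\<^sup>* b e" "turn G rv e c" by blast
  then have "e \<in> arcs G" "head G e = tail G c" unfolding turn_def by auto
  then have "b \<in> toward G (tail G c)" "tail G c \<in> verts G"
    using turns_in_toward[OF e(1)] leads_arcs[OF bc] by auto
  then show ?thesis using core_scopo_graph.scopo_tail[OF toward_graph] by blast
qed

text \<open>
  Any two edges of a tree lie on a common reduced walk, which traverses each of them in one of its
  two directions. The property passes from an edge to all adjacent edges, and the tree is connected.
\<close>

lemma leads_tetrachotomy:
  assumes b: "b \<in> arcs G" and c: "c \<in> arcs G"
  shows "c = b \<or> c = rv b \<or> leads G rv b c \<or> leads G rv b (rv c)
    \<or> leads G rv (rv b) c \<or> leads G rv (rv b) (rv c)"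
proof -
  define Q where "Q c \<longleftrightarrow> c = b \<or> c = rv b \<or> leads G rv b c \<or> leads G rv b (rv c)
    \<or> leads G rv (rv b) c \<or> leads G rv (rv b) (rv c)" for c
  have Q_rv: "Q (rv c)" if "Q c" "c \<in> arcs G" for c
    using that b unfolding Q_def by (auto simp: rv_rv)
  have Q_turn: "Q d" if "Q c" "turn G rv c d" for c d
  proof -
    have cd: "c \<in> arcs G" "d \<in> arcs G" "head G c = tail G d" "d \<noteq> rv c"
      using that(2) unfolding turn_def by auto
    have fwd: "Q d" if "(turn G rv)\<^sup>*\<^sup>* b' c" "b' = b \<or> b' = rv b" for b'
    proof -
      have "leads G rv b' d" using that(1) \<open>turn G rv c d\<close> by (rule rtranclp_into_tranclp1)
      then show ?thesis using that(2) unfolding Q_def by auto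
    qed
    have bwd: "Q d" if b': "leads G rv b' (rv c)" "b' = b \<or> b' = rv b" for b'
    proof -
      obtain e where e: "(turn G rv)\<^sup>*\<^sup>* b' e" "turn G rv e (rv c)"
        using leads_last[OF b'(1)] by blast
      have e1: "e \<in> arcs G" "head G e = tail G d" using e(2) cd tail_rv unfolding turn_def by auto
      show ?thesis
      proof (cases "d = rv e")
        case True
        then have "rv d = e" using e1 rv_rv by simp
        show ?thesis
        proof (cases "e = b'")
          case True
          then show ?thesis using \<open>d = rv e\<close> b'(2) b rv_rv unfolding Q_def by auto
        next
          case False
          then have "leads G rv b' (rv d)" using turns_cases[OF e(1)] \<open>rv d = e\<close> by auto
          then show ?thesis using b'(2) unfolding Q_def by auto
        qed
      next
        case False
        then have "turn G rv e d" using e1 cd unfolding turn_def by auto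
        then have "leads G rv b' d" using e(1) by (rule rtranclp_into_tranclp1[rotated])
        then show ?thesis using b'(2) unfolding Q_def by auto
      qed
    qed
    show ?thesis using that(1)[unfolded Q_def]
    proof (elim disjE)
      assume "c = b" then show ?thesis using fwd[of b] by simp
    next
      assume "c = rv b" then show ?thesis using fwd[of "rv b"] by simp
    next
      assume "leads G rv b c" then show ?thesis using fwd[of b] by (simp add: tranclp_into_rtranclp)
    next
      assume "leads G rv (rv b) c"
      then show ?thesis using fwd[of "rv b"] by (simp add: tranclp_into_rtranclp)
    next
      assume "leads G rv b (rv c)" then show ?thesis using bwd[of b] by simp
    next
      assume "leads G rv (rv b) (rv c)" then show ?thesis using bwd[of "rv b"] by simp
    qed
  qed
  have step: "Q d" if "Q c" "c \<in> arcs G" "d \<in> arcs G" "head G c = tail G d" for c d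
    using Q_turn[of c d] Q_rv[of c] that unfolding turn_def by blast
  define R where "R v \<longleftrightarrow> (\<forall>d\<in>arcs G. tail G d = v \<longrightarrow> Q d)" for v
  have "R (head G b)" unfolding R_def using step[of b] b unfolding Q_def by auto
  then have "R (tail G c)"
  proof (rule connected_induct[OF connected head_in_verts[OF b]])
    fix a assume a: "a \<in> arcs G" "R (tail G a)"
    then have "Q a" unfolding R_def by blast
    then show "R (head G a)" unfolding R_def using step[of a] a by auto
  qed (use c in simp)
  then show ?thesis using c unfolding R_def Q_def by blast
qed

section \<open>Subtrees\<close>

text \<open>
  Only connectedness needs an argument. Fix \<open>w\<close> in the core. The path from a vertex of the core
  towards \<open>w\<close> does not leave the core: if it left along \<open>a\<close>, then \<open>Or\<close> would contain the reverse of \<open>a\<close>,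
  and by propagation the reverse of the last arc, which starts at \<open>w\<close>.
\<close>

lemma is_tree_induce:
  assumes V: "V \<noteq> {}" and sc: "core_scopo G rv V Or" "funnels G V Or"
  shows "is_tree (G \<restriction> V) rv"
proof -
  interpret A: core_scopo_graph G rv V Or by (rule core_scopo_graphI[OF sc(1)])
  interpret R: rgraph "G \<restriction> V" rv by (rule rgraph_induce[OF A.core_verts])
  have sub: "subgraph (G \<restriction> V) G" using A.core_verts by (rule subgraph_induce_subgraphI)
  obtain w where w: "w \<in> V" using V by blast
  then have wG: "w \<in> verts G" using A.core_verts by blast
  interpret W: core_scopo_graph G rv "{w}" "toward G w" by (rule toward_graph[OF wG])
  have stay: "head G a \<in> V" if a: "a \<in> toward G w" "tail G a \<in> V" for a
  proof (rule ccontr)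
    assume h: "head G a \<notin> V"
    have aG: "a \<in> arcs G" using W.scopo_arcs a by blast
    have "a \<notin> Or" using A.scopo_tail a by blast
    then have rva: "rv a \<in> Or" using A.scopo_rv_iff h aG by blast
    obtain c where c: "c \<in> toward G w" "head G c = w" and ac: "(turn G rv)\<^sup>*\<^sup>* a c"
      using toward_path[OF wG a(1)] by blast
    have cG: "c \<in> arcs G" using W.scopo_arcs[OF c(1)] .
    have "rv c \<in> Or"
    proof (cases "a = c")
      case False
      then have "leads G rv a c" using turns_cases[OF ac] by simp
      then show ?thesis using A.scopo_back_leads leads_rv rva by blast
    qed (use rva in simp)
    then show False using A.scopo_tail[of "rv c"] tail_rv cG c w by auto
  qed
  have conn: "x \<rightarrow>\<^sup>*\<^bsub>G \<restriction> V\<^esub> w" if x: "x \<in> V" for x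
  proof (cases "x = w")
    case False
    then obtain a where a: "a \<in> toward G w" "tail G a = x"
      using W.scopo_out x A.core_verts by blast
    obtain c where c: "(follows G (toward G w))\<^sup>*\<^sup>* a c" "head G c = w"
      using toward_funnels[OF wG] a unfolding funnels_def by blast
    have "a \<in> toward G w \<and> tail G a \<in> V \<longrightarrow> tail G a \<rightarrow>\<^sup>*\<^bsub>G \<restriction> V\<^esub> w"
      using c(1)
    proof (induction rule: converse_rtranclp_induct)
      case base
      show ?case
      proof
        assume *: "c \<in> toward G w \<and> tail G c \<in> V"
        have "(tail G c, head G c) \<in> arcs_ends (G \<restriction> V)"
          using * c(2) w W.scopo_arcs by (auto simp: arcs_ends_conv)
        then show "tail G c \<rightarrow>\<^sup>*\<^bsub>G \<restriction> V\<^esub> w" using c(2) by (intro R.reachable_adjI) simp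
      qed
    next
      case (step a b)
      show ?case
      proof
        assume *: "a \<in> toward G w \<and> tail G a \<in> V"
        then have hV: "head G a \<in> V" using stay by blast
        have ab: "b \<in> toward G w" "head G a = tail G b" using step unfolding follows_def by auto
        have "(tail G a, head G a) \<in> arcs_ends (G \<restriction> V)"
          using * hV W.scopo_arcs by (auto simp: arcs_ends_conv)
        moreover have "head G a \<rightarrow>\<^sup>*\<^bsub>G \<restriction> V\<^esub> w" using step.IH ab hV by simp
        ultimately show "tail G a \<rightarrow>\<^sup>*\<^bsub>G \<restriction> V\<^esub> w" by (rule R.adj_reachable_trans)
      qed
    qed
    then show ?thesis using a x by simp
  qed (use w in simp)
  show ?thesis unfolding is_tree_def
  proof (intro conjI)
    show "rgraph (G \<restriction> V) rv" by (rule R.rgraph_axioms)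
    show "loopfree_digraph (G \<restriction> V)" by unfold_locales (use no_loops in auto)
    show "nomulti_digraph (G \<restriction> V)"
      by unfold_locales (use no_multi_arcs in \<open>auto simp: arc_to_ends_def\<close>)
    show "strongly_connected (G \<restriction> V)"
      using R.strongly_connectedI[of w] conn w by simp
    show "\<nexists>p. graph_cycle (G \<restriction> V) rv p"
      using subgraph_cycle[OF sub] is_tree unfolding is_tree_def graph_cycle_def by blast
  qed
qed

lemma subtree_induce:
  assumes "V \<noteq> {}" "core_scopo G rv V Or" "funnels G V Or"
  shows "subtree (G \<restriction> V) G rv"
  unfolding subtree_def using is_tree_induce[OF assms] assms(2) subgraph_induce_subgraphI
  unfolding core_scopo_def by blast

text \<open>
  A set of vertices that contains \<open>w\<close> and every path from its vertices towards \<open>w\<close> spans a subtree,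
  and the orientation towards it is a part of the orientation towards \<open>w\<close>.
\<close>

lemma core_scopo_closed:
  assumes w: "w \<in> V" and VG: "V \<subseteq> verts G"
    and stay: "\<And>a. a \<in> toward G w \<Longrightarrow> tail G a \<in> V \<Longrightarrow> head G a \<in> V"
  shows "core_scopo G rv V {a \<in> toward G w. tail G a \<notin> V}
    \<and> funnels G V {a \<in> toward G w. tail G a \<notin> V}" (is "core_scopo G rv V ?O \<and> _")
proof
  have wG: "w \<in> verts G" using w VG by blast
  interpret W: core_scopo_graph G rv "{w}" "toward G w" by (rule toward_graph[OF wG])
  show "core_scopo G rv V ?O" unfolding core_scopo_def
  proof (intro conjI ballI impI)
    show "V \<subseteq> verts G" by (rule VG)
    show "?O \<subseteq> arcs G" using W.scopo_arcs by blast
    show "\<exists>!a. a \<in> ?O \<and> tail G a = v" if v: "v \<in> verts G - V" for v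
    proof -
      obtain a where a: "a \<in> toward G w" "tail G a = v" using W.scopo_out[of v] v w by auto
      moreover have "b = a" if "b \<in> ?O" "tail G b = v" for b
        using that a W.scopo_unique by auto
      ultimately show ?thesis using v by blast
    qed
    fix a assume a: "a \<in> arcs G" "tail G a \<notin> V \<or> head G a \<notin> V"
    have "tail G a \<noteq> w \<or> head G a \<noteq> w" using a w by auto
    then have iff: "rv a \<in> toward G w \<longleftrightarrow> a \<notin> toward G w" using W.scopo_rv_iff[of a] a by auto
    show "a \<in> ?O \<longleftrightarrow> rv a \<notin> ?O"
      using iff stay[of a] stay[of "rv a"] a tail_rv[of a] head_rv[of a] by auto
  qed auto
  show "funnels G V ?O" unfolding funnels_def
  proof
    fix a assume a: "a \<in> ?O"
    then obtain c where c: "(follows G (toward G w))\<^sup>*\<^sup>* a c" "head G c = w"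
      using toward_funnels[OF wG] unfolding funnels_def by blast
    from c(1) a show "\<exists>c. (follows G ?O)\<^sup>*\<^sup>* a c \<and> head G c \<in> V"
    proof (induction rule: converse_rtranclp_induct)
      case base
      then show ?case using c(2) w by blast
    next
      case (step a b)
      show ?case
      proof (cases "head G a \<in> V")
        case False
        then have "b \<in> ?O" "follows G ?O a b" using step(1) unfolding follows_def by auto
        then show ?thesis using step.IH by (meson converse_rtranclp_into_rtranclp)
      qed blast
    qed
  qed
qed

text \<open>
  The path to \<open>w\<close> inside the subtree is reduced in \<open>G\<close> as well, so it follows the orientation
  towards \<open>w\<close> in \<open>G\<close>.
\<close>

lemma subtree_toward:
  assumes S: "subtree S G rv" and w: "w \<in> verts S" and a: "a \<in> toward G w" "tail G a \<in> verts S"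
  shows "a \<in> arcs S"
proof -
  interpret S: tree_graph S rv
    using S tree_graphI unfolding subtree_def by blast
  have sub: "verts S \<subseteq> verts G" "arcs S \<subseteq> arcs G" and th: "tail S = tail G" "head S = head G"
    using S unfolding subtree_def subgraph_def compatible_def by auto
  have wG: "w \<in> verts G" using w sub by blast
  interpret W: core_scopo_graph G rv "{w}" "toward G w" by (rule toward_graph[OF wG])
  interpret SW: core_scopo_graph S rv "{w}" "toward S w" by (rule S.toward_graph[OF w])
  have "tail S a \<noteq> w" using W.scopo_tail[OF a(1)] th by simp
  then obtain a' where a': "a' \<in> toward S w" "tail G a' = tail G a"
    using SW.scopo_out[of "tail S a"] a th by auto
  obtain c where c: "c \<in> toward S w" "head S c = w" and ac: "(turn S rv)\<^sup>*\<^sup>* a' c"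
    using S.toward_path[OF w a'(1)] by blast
  have cS: "c \<in> arcs S" using SW.scopo_arcs[OF c(1)] .
  have "(turn G rv)\<^sup>*\<^sup>* a' c"
    using ac by (rule rtranclp_mono[THEN predicate2D, rotated]) (use sub th in \<open>auto simp: turn_def\<close>)
  then have "a' \<in> toward G w" using turns_in_toward[of a' c] cS c sub th by auto
  then have "a = a'" using W.scopo_unique a a' by metis
  then show ?thesis using SW.scopo_arcs a' by blast
qed

lemma subtree_core_scopo:
  assumes S: "subtree S G rv"
  shows "\<exists>Or. core_scopo G rv (verts S) Or \<and> funnels G (verts S) Or"
proof -
  obtain w where w: "w \<in> verts S"
    using S unfolding subtree_def is_tree_def strongly_connected_def by blast
  have "verts S \<subseteq> verts G" "wf_digraph S" "head S = head G"
    using S unfolding subtree_def subgraph_def compatible_def by auto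
  then show ?thesis using core_scopo_closed[OF w] subtree_toward[OF S w]
    by (metis wf_digraph.head_in_verts)
qed

lemma subtree_eq_induce:
  assumes S: "subtree S G rv" shows "S = G \<restriction> verts S"
proof -
  have sub: "verts S \<subseteq> verts G" "arcs S \<subseteq> arcs G" and th: "tail S = tail G" "head S = head G"
    and wf: "wf_digraph S"
    using S unfolding subtree_def subgraph_def compatible_def by auto
  have "arcs S = {a \<in> arcs G. tail G a \<in> verts S \<and> head G a \<in> verts S}"
    using sub th wf_digraph.head_in_verts[OF wf] wf_digraph.tail_in_verts[OF wf]
      subtree_toward[OF S] in_toward_head by auto
  then show ?thesis using th by (cases S) (auto simp: induce_subgraph_def)
qed

end

section \<open>Ends of trees\<close>

definition rays_in :: "('v, 'a) pre_digraph \<Rightarrow> 'a set \<Rightarrow> (nat \<Rightarrow> 'a) set" where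
  "rays_in G Or = {r. ray G r \<and> range r \<subseteq> Or}"

text \<open>
  The arcs that point towards the end of \<open>r\<close>, expressed without mentioning equivalence of rays.
\<close>

definition arcs_into :: "('v, 'a) pre_digraph \<Rightarrow> ('a \<Rightarrow> 'a) \<Rightarrow> (nat \<Rightarrow> 'a) \<Rightarrow> 'a set" where
  "arcs_into G rv r = {a \<in> arcs G. \<exists>j. (turn G rv)\<^sup>*\<^sup>* a (r j)}"

lemma turns_seq:
  assumes "\<And>i. turn G rv (r i) (r (Suc i))" "i \<le> j"
  shows "(turn G rv)\<^sup>*\<^sup>* (r i) (r j)"
  using assms(2)
proof (induction j rule: dec_induct)
  case (step j)
  then show ?case using assms(1)[of j] by (rule_tac rtranclp.rtrancl_into_rtrancl)
qed simp

lemma leads_seq: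
  assumes "\<And>i. turn G rv (r i) (r (Suc i))" "i < j"
  shows "leads G rv (r i) (r j)"
proof -
  have "(turn G rv)\<^sup>*\<^sup>* (r (Suc i)) (r j)"
    by (rule turns_seq) (use assms in auto)
  then show ?thesis using assms(1)[of i] by (rule_tac rtranclp_into_tranclp2)
qed

lemma flow_exists:
  assumes "core_scopo G rv {} Or" "wf_digraph G" "a \<in> Or"
  shows "\<exists>r. r 0 = a \<and> (\<forall>i. r i \<in> Or \<and> head G (r i) = tail G (r (Suc i)))"
proof -
  have "\<exists>r. \<forall>i. (r i \<in> Or \<and> (i = 0 \<longrightarrow> r i = a)) \<and> head G (r i) = tail G (r (Suc i))"
  proof (rule dependent_nat_choice)
    fix b :: 'b and i :: nat assume b: "b \<in> Or \<and> (i = 0 \<longrightarrow> b = a)"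
    then have "head G b \<in> verts G" using assms(1,2) unfolding core_scopo_def
      by (auto intro: wf_digraph.head_in_verts)
    then obtain c where "c \<in> Or" "tail G c = head G b"
      using assms(1) unfolding core_scopo_def by blast
    then show "\<exists>c. (c \<in> Or \<and> (Suc i = 0 \<longrightarrow> c = a)) \<and> head G b = tail G c" by auto
  qed (use assms(3) in blast)
  then show ?thesis by metis
qed

context core_scopo_graph
begin

lemma flow_turn:
  "(\<And>i. r i \<in> Or \<and> head G (r i) = tail G (r (Suc i))) \<Longrightarrow> turn G rv (r i) (r (Suc i))"
  using follows_turn[of "r i" "r (Suc i)"] unfolding follows_def by simp

lemma flow_unique:
  assumes "\<And>i. r i \<in> Or \<and> head G (r i) = tail G (r (Suc i))"
    and "\<And>i. s i \<in> Or \<and> head G (s i) = tail G (s (Suc i))" and "r j = s k"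
  shows "r (j + m) = s (k + m)"
proof (induction m)
  case (Suc m)
  have "tail G (r (Suc (j + m))) = tail G (s (Suc (k + m)))"
    using assms(1)[of "j + m"] assms(2)[of "k + m"] Suc by simp
  then show ?case using scopo_unique[of "r (Suc (j + m))" "s (Suc (k + m))"] assms(1,2) by simp
qed (use assms(3) in simp)

lemma flow_reaches:
  assumes r: "\<And>i. r i \<in> Or \<and> head G (r i) = tail G (r (Suc i))"
    and "(turn G rv)\<^sup>*\<^sup>* (r 0) c" "c \<in> Or"
  shows "\<exists>k. c = r k"
  using assms(2,3)
proof (induction rule: rtranclp_induct)
  case (step b c)
  then obtain k where k: "b = r k" using scopo_back[of b c] by blast
  have "tail G c = tail G (r (Suc k))"
    using r[of k] step.hyps(2) k unfolding turn_def by metis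
  then have "c = r (Suc k)" using scopo_unique step.prems r[of "Suc k"] by blast
  then show ?case by blast
qed blast

lemma funnels_no_flow:
  assumes r: "\<And>i. r i \<in> Or \<and> head G (r i) = tail G (r (Suc i))" and f: "funnels G V Or"
  shows False
proof -
  obtain c where c: "(follows G Or)\<^sup>*\<^sup>* (r 0) c" "head G c \<in> V"
    using f r[of 0] unfolding funnels_def by blast
  have "c \<in> Or" "(turn G rv)\<^sup>*\<^sup>* (r 0) c" using follows_star[OF c(1)] r[of 0] by auto
  then obtain k where "c = r k" using flow_reaches[of r, OF r] by blast
  then show False using c(2) r[of k] r[of "Suc k"] scopo_tail[of "r (Suc k)"] by simp
qed

end

context rgraph
begin

lemma ray_arcs: "ray G r \<Longrightarrow> r i \<in> arcs G"
  unfolding ray_def by blast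

lemma ray_turn:
  assumes "ray G r" shows "turn G rv (r i) (r (Suc i))"
proof -
  have *: "\<And>i. r i \<in> arcs G \<and> head G (r i) = tail G (r (Suc i))" "inj (\<lambda>i. tail G (r i))"
    using assms unfolding ray_def by auto
  have "r (Suc i) \<noteq> rv (r i)"
  proof
    assume "r (Suc i) = rv (r i)"
    then have "tail G (r (Suc (Suc i))) = tail G (r i)"
      using *(1)[of i] *(1)[of "Suc i"] head_rv[of "r i"] by simp
    then have "Suc (Suc i) = i" using injD[OF *(2)] by blast
    then show False by simp
  qed
  then show ?thesis using *(1)[of i] *(1)[of "Suc i"] unfolding turn_def by simp
qed

lemma line_turn:
  assumes "line G l" shows "turn G rv (l i) (l (i + 1))"
proof -
  have *: "\<And>i. l i \<in> arcs G \<and> head G (l i) = tail G (l (i + 1))" "inj (\<lambda>i. tail G (l i))"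
    using assms unfolding line_def by auto
  have "l (i + 1) \<noteq> rv (l i)"
  proof
    assume "l (i + 1) = rv (l i)"
    then have "tail G (l (i + 1 + 1)) = tail G (l i)"
      using *(1)[of i] *(1)[of "i + 1"] head_rv[of "l i"] by simp
    then have "i + 1 + 1 = i" using injD[OF *(2)] by blast
    then show False by simp
  qed
  then show ?thesis using *(1)[of i] *(1)[of "i + 1"] unfolding turn_def by simp
qed

lemma leads_int_seq:
  assumes "\<And>i::int. turn G rv (l i) (l (i + 1))" "i < j"
  shows "leads G rv (l i) (l j)"
proof -
  obtain n where n: "j = i + int (Suc n)" using assms(2) zless_iff_Suc_zadd by auto
  have "leads G rv (l (i + int 0)) (l (i + int (Suc n)))"
    by (rule leads_seq[where r = "\<lambda>k. l (i + int k)"])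
      (use assms(1)[of "i + int _"] in \<open>auto simp: algebra_simps\<close>)
  then show ?thesis using n by simp
qed

end

context tree_graph
begin

lemma turn_ray:
  assumes "\<And>i. turn G rv (r i) (r (Suc i))" shows "ray G r"
proof -
  have "tail G (r i) \<noteq> tail G (r j)" if "i < j" for i j
    using leads_tail_neq_tail leads_seq[of G rv r, OF assms that] by blast
  then have "inj (\<lambda>i. tail G (r i))" by (metis injI linorder_neqE_nat)
  then show ?thesis unfolding ray_def using assms unfolding turn_def by blast
qed

lemma turn_line:
  assumes "\<And>i. turn G rv (l i) (l (i + 1))" shows "line G l"
proof -
  have "tail G (l i) \<noteq> tail G (l j)" if "i < j" for i j
    using leads_tail_neq_tail leads_int_seq[of l, OF assms that] by blast
  then have "inj (\<lambda>i. tail G (l i))" by (metis injI linorder_neqE)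
  then show ?thesis unfolding line_def using assms unfolding turn_def by blast
qed

lemma flow_ray:
  assumes "core_scopo G rv V Or" "\<And>i. r i \<in> Or \<and> head G (r i) = tail G (r (Suc i))"
  shows "ray G r"
proof -
  interpret A: core_scopo_graph G rv V Or by (rule core_scopo_graphI[OF assms(1)])
  show ?thesis using turn_ray A.flow_turn[of r, OF assms(2)] by blast
qed

text \<open>
  Any two arcs that lead into \<open>r\<close> lead into a common arc of \<open>r\<close>, so they belong to the orientation
  towards the head of that arc; this gives uniqueness. Every edge lies on a reduced walk with the
  first edge of \<open>r\<close>. If that walk starts with \<open>r 0\<close>, then it runs along \<open>r\<close> for a while, and once it has
  branched off its arcs point away from \<open>r\<close>.
\<close>

lemma arcs_into_core_scopo:
  assumes r: "ray G r" shows "core_scopo G rv {} (arcs_into G rv r)" (is "core_scopo G rv {} ?O")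
proof -
  note rt = ray_turn[OF r]
  have O_back: "b \<in> ?O" if "turn G rv b c" "c \<in> ?O" for b c
    using that unfolding arcs_into_def turn_def
    by (auto intro: converse_rtranclp_into_rtranclp simp: turn_def)
  have toward: "a \<in> toward G (head G (r j))" if "(turn G rv)\<^sup>*\<^sup>* a (r j)" for a j
    using turns_in_toward that ray_arcs[OF r] by blast
  have common: "\<exists>j. (turn G rv)\<^sup>*\<^sup>* a (r j) \<and> (turn G rv)\<^sup>*\<^sup>* b (r j)"
    if ab: "a \<in> ?O" "b \<in> ?O" for a b
  proof -
    obtain i j where ij: "(turn G rv)\<^sup>*\<^sup>* a (r i)" "(turn G rv)\<^sup>*\<^sup>* b (r j)"
      using ab unfolding arcs_into_def by blast
    have "(turn G rv)\<^sup>*\<^sup>* (r i) (r (max i j))" "(turn G rv)\<^sup>*\<^sup>* (r j) (r (max i j))"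
      using turns_seq[of G rv r, OF rt] by auto
    then show ?thesis using ij by (meson rtranclp_trans)
  qed
  have unique: "a = b" if ab: "a \<in> ?O" "b \<in> ?O" "tail G a = tail G b" for a b
  proof -
    obtain j where "(turn G rv)\<^sup>*\<^sup>* a (r j)" "(turn G rv)\<^sup>*\<^sup>* b (r j)" using common ab by blast
    then show ?thesis
      using toward core_scopo_graph.scopo_unique[OF toward_graph, of "head G (r j)" a b]
        ray_arcs[OF r, of j] ab(3) by auto
  qed
  have not_both: "rv a \<notin> ?O" if a: "a \<in> ?O" for a
  proof
    assume "rv a \<in> ?O"
    then obtain j where "(turn G rv)\<^sup>*\<^sup>* a (r j)" "(turn G rv)\<^sup>*\<^sup>* (rv a) (r j)" using common a by blast
    then show False
      using toward core_scopo_graph.scopo_rv_notin[OF toward_graph, of "head G (r j)" a]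
        ray_arcs[OF r, of j] by auto
  qed
  have r_in: "r j \<in> ?O" for j using ray_arcs[OF r] unfolding arcs_into_def by blast
  \<comment> \<open>a walk that starts with \<open>r 0\<close> stays on \<open>r\<close> until it branches off; afterwards the reversed arcs turn back onto \<open>r\<close>\<close>
  have branch: "rv c \<in> ?O \<or> c \<in> range r" if "leads G rv (r 0) c" for c
    using that
  proof (induction rule: tranclp_induct)
    case (base c)
    show ?case
    proof (cases "c = r (Suc 0)")
      case False
      then have "turn G rv (rv c) (r (Suc 0))"
        using base rt[of 0] rv_in_arcs[of c] head_rv[of c] rv_rv[of c] unfolding turn_def by auto
      then show ?thesis using O_back r_in by blast
    qed blast
  next
    case (step c d)
    show ?case
    proof (cases "c \<in> range r")
      case True
      then obtain j where j: "c = r j" by blast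
      show ?thesis
      proof (cases "d = r (Suc j)")
        case False
        then have "turn G rv (rv d) (r (Suc j))"
          using step(2) rt[of j] j rv_in_arcs[of d] head_rv[of d] rv_rv[of d] unfolding turn_def by auto
        then show ?thesis using O_back r_in by blast
      qed blast
    next
      case False
      then show ?thesis using step.IH O_back turn_rv[OF step(2)] by blast
    qed
  qed
  have total: "a \<in> ?O \<or> rv a \<in> ?O" if a: "a \<in> arcs G" for a
  proof -
    have fwd: "rv c \<in> ?O \<or> c \<in> ?O" if "leads G rv (r 0) c" for c using branch[OF that] r_in by auto
    have bwd: "c \<in> ?O" if "leads G rv c (r 0)" for c
      using that leads_arcs[OF that] unfolding arcs_into_def by (auto intro: tranclp_into_rtranclp)
    have r0: "r 0 \<in> arcs G" using ray_arcs[OF r] .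
    from leads_tetrachotomy[OF r0 a] show ?thesis
    proof (elim disjE)
      assume "a = rv (r 0)" then show ?thesis using rv_rv[OF r0] r_in[of 0] by simp
    next
      assume "leads G rv (r 0) (rv a)" then show ?thesis using fwd[of "rv a"] rv_rv[OF a] by auto
    next
      assume "leads G rv (rv (r 0)) a"
      then show ?thesis using bwd leads_rv[of "rv (r 0)" a] rv_rv[OF r0] by auto
    next
      assume "leads G rv (rv (r 0)) (rv a)"
      then show ?thesis using bwd leads_rv[of "rv (r 0)" "rv a"] rv_rv[OF r0] rv_rv[OF a] by auto
    qed (use r_in[of 0] fwd in auto)
  qed
  have out: "\<exists>a\<in>?O. tail G a = x" if x: "x \<in> verts G" for x
  proof (cases "x = tail G (r 0)")
    case False
    then obtain a where a: "a \<in> arcs G" "tail G a = x"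
      using out_arc_exists[OF connected x, of "tail G (r 0)"] ray_arcs[OF r] by auto
    show ?thesis
    proof (cases "a \<in> ?O")
      case False
      then have "rv a \<in> ?O" using total a by blast
      then obtain j where j: "(turn G rv)\<^sup>*\<^sup>* (rv a) (r j)" unfolding arcs_into_def by blast
      have "leads G rv (rv a) (r (Suc j))"
        using j rt[of j] by (rule rtranclp_into_tranclp1)
      then obtain e where e: "turn G rv (rv a) e" "(turn G rv)\<^sup>*\<^sup>* e (r (Suc j))"
        by (meson tranclpD)
      then have "e \<in> ?O" "tail G e = x"
        using a head_rv[of a] unfolding turn_def arcs_into_def by auto
      then show ?thesis by blast
    qed (use a in blast)
  qed (use r_in in blast)
  show ?thesis unfolding core_scopo_def
  proof (intro conjI ballI impI)
    show "?O \<subseteq> arcs G" unfolding arcs_into_def by blast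
    show "\<exists>!a. a \<in> ?O \<and> tail G a = v" if "v \<in> verts G - {}" for v
      using out[of v] unique that by auto
    show "a \<in> ?O \<longleftrightarrow> rv a \<notin> ?O" if "a \<in> arcs G" for a using total[OF that] not_both by blast
  qed auto
qed

lemma range_arcs_into: "ray G r \<Longrightarrow> range r \<subseteq> arcs_into G rv r"
  unfolding arcs_into_def using ray_arcs by blast

lemma arcs_into_eq:
  assumes "core_scopo G rv {} Or" "ray G r" "range r \<subseteq> Or"
  shows "arcs_into G rv r = Or"
proof (rule core_scopo_empty_subset_eq[OF arcs_into_core_scopo[OF assms(2)] assms(1)])
  interpret A: core_scopo_graph G rv "{}" Or by (rule core_scopo_graphI[OF assms(1)])
  show "arcs_into G rv r \<subseteq> Or"
  proof
    fix a assume "a \<in> arcs_into G rv r"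
    then obtain j where "(turn G rv)\<^sup>*\<^sup>* a (r j)" unfolding arcs_into_def by blast
    moreover have "r j \<in> Or" using assms(3) by blast
    ultimately show "a \<in> Or" using turns_cases[of G rv a "r j"] A.scopo_back_leads[of a "r j"] by blast
  qed
qed

text \<open>
  Beyond any arc of \<open>r\<close> there are two common vertices that both rays pass in the same order.
  Between them both rays follow the orientation towards the second one, so they coincide there.
\<close>

lemma common_vertices_arcs_into:
  assumes q: "ray G q" and r: "ray G r"
    and inf: "infinite (range (\<lambda>i. tail G (q i)) \<inter> range (\<lambda>i. tail G (r i)))"
  shows "arcs_into G rv r = arcs_into G rv q"
proof (rule arcs_into_eq[OF arcs_into_core_scopo[OF q] r])
  interpret A: core_scopo_graph G rv "{}" "arcs_into G rv q"
    by (rule core_scopo_graphI[OF arcs_into_core_scopo[OF q]])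
  have inj_r: "inj (\<lambda>i. tail G (r i))" using r unfolding ray_def by blast
  define I where "I = (\<lambda>i. tail G (r i)) -` range (\<lambda>i. tail G (q i))"
  have "range (\<lambda>i. tail G (q i)) \<inter> range (\<lambda>i. tail G (r i)) = (\<lambda>i. tail G (r i)) ` I"
    unfolding I_def image_vimage_eq ..
  then have infI: "infinite I" using inf by (metis finite_imageI)
  show "range r \<subseteq> arcs_into G rv q"
  proof
    fix a assume "a \<in> range r"
    then obtain i where i: "a = r i" by blast
    have "\<exists>n>i. n \<in> I" using infI unfolding infinite_nat_iff_unbounded by (rule spec)
    then obtain i' where i': "i' > i" "i' \<in> I" by blast
    then obtain j' where j': "tail G (r i') = tail G (q j')" unfolding I_def by blast
    have "finite ((\<lambda>i. tail G (r i)) -` ((\<lambda>i. tail G (q i)) ` {..j'}))"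
      by (rule finite_vimageI[OF _ inj_r]) simp
    then have "infinite (I - (\<lambda>i. tail G (r i)) -` ((\<lambda>i. tail G (q i)) ` {..j'}))"
      using infI by (rule Diff_infinite_finite)
    then have "\<exists>n>i'. n \<in> I - (\<lambda>i. tail G (r i)) -` ((\<lambda>i. tail G (q i)) ` {..j'})"
      unfolding infinite_nat_iff_unbounded by (rule spec)
    then obtain i'' where i'': "i'' > i'" "i'' \<in> I"
      "i'' \<notin> (\<lambda>i. tail G (r i)) -` ((\<lambda>i. tail G (q i)) ` {..j'})"
      by blast
    then obtain j'' where j'': "tail G (r i'') = tail G (q j'')" unfolding I_def by blast
    then have "j'' > j'" using i''(3) by (cases "j'' \<le> j'") auto
    have heads: "r i' \<in> toward G (tail G (r i''))" "q j' \<in> toward G (tail G (r i''))"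
    proof -
      have "(turn G rv)\<^sup>*\<^sup>* (r i') (r (i'' - 1))" "head G (r (i'' - 1)) = tail G (r i'')"
        using turns_seq[of G rv r, OF ray_turn[OF r], of i' "i'' - 1"] i''(1)
          ray_turn[OF r, of "i'' - 1"] unfolding turn_def by auto
      then show "r i' \<in> toward G (tail G (r i''))"
        using turns_in_toward[of "r i'" "r (i'' - 1)"] ray_arcs[OF r, of "i'' - 1"] by simp
      have "(turn G rv)\<^sup>*\<^sup>* (q j') (q (j'' - 1))" "head G (q (j'' - 1)) = tail G (q j'')"
        using turns_seq[of G rv q, OF ray_turn[OF q], of j' "j'' - 1"] \<open>j'' > j'\<close>
          ray_turn[OF q, of "j'' - 1"] unfolding turn_def by auto
      then show "q j' \<in> toward G (tail G (r i''))"
        using turns_in_toward[of "q j'" "q (j'' - 1)"] ray_arcs[OF q, of "j'' - 1"] j'' by simp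
    qed
    have "r i' = q j'"
      using core_scopo_graph.scopo_unique[OF toward_graph heads j'] ray_arcs[OF r, of i''] by simp
    then have "r i' \<in> arcs_into G rv q" using range_arcs_into[OF q] by blast
    then show "a \<in> arcs_into G rv q"
      using A.scopo_back_leads leads_seq[of G rv r, OF ray_turn[OF r] i'(1)] i by blast
  qed
qed

lemma ray_equiv_iff:
  "(r, s) \<in> ray_equiv G \<longleftrightarrow> ray G r \<and> ray G s \<and> arcs_into G rv r = arcs_into G rv s"
proof
  assume "(r, s) \<in> ray_equiv G"
  then show "ray G r \<and> ray G s \<and> arcs_into G rv r = arcs_into G rv s"
    unfolding ray_equiv_def using common_vertices_arcs_into by auto
next
  assume *: "ray G r \<and> ray G s \<and> arcs_into G rv r = arcs_into G rv s"
  then have r: "ray G r" and s: "ray G s" by auto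
  interpret A: core_scopo_graph G rv "{}" "arcs_into G rv r"
    by (rule core_scopo_graphI[OF arcs_into_core_scopo[OF r]])
  have fr: "r i \<in> arcs_into G rv r \<and> head G (r i) = tail G (r (Suc i))" for i
    using range_arcs_into[OF r] r unfolding ray_def by blast
  have fs: "s i \<in> arcs_into G rv r \<and> head G (s i) = tail G (s (Suc i))" for i
    using range_arcs_into[OF s] s * unfolding ray_def by blast
  obtain j where "(turn G rv)\<^sup>*\<^sup>* (s 0) (r j)" using fs[of 0] unfolding arcs_into_def by blast
  then obtain k where "r j = s k" using A.flow_reaches[of s, OF fs] fr by blast
  then have eq: "r (j + m) = s (k + m)" for m using A.flow_unique[of r s, OF fr fs] by blast
  have inj_r: "inj (\<lambda>i. tail G (r i))" using r unfolding ray_def by blast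
  then have "inj (\<lambda>m. tail G (r (j + m)))" unfolding inj_def by (metis add_left_cancel)
  then have inf: "infinite (range (\<lambda>m. tail G (r (j + m))))" by (rule range_inj_infinite)
  have "infinite (range (\<lambda>i. tail G (r i)))" using inj_r by (rule range_inj_infinite)
  moreover have "infinite (range (\<lambda>i. tail G (r i)) \<inter> range (\<lambda>i. tail G (s i)))"
  proof (rule infinite_super[OF _ inf], rule subsetI)
    fix x assume "x \<in> range (\<lambda>m. tail G (r (j + m)))"
    then obtain m where "x = tail G (r (j + m))" by blast
    moreover from this have "x = tail G (s (k + m))" using eq by simp
    ultimately show "x \<in> range (\<lambda>i. tail G (r i)) \<inter> range (\<lambda>i. tail G (s i))" by blast
  qed
  ultimately show "(r, s) \<in> ray_equiv G"
    unfolding ray_equiv_def using r s by auto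
qed

lemma rays_in_arcs_into:
  assumes r: "ray G r" shows "ray_equiv G `` {r} = rays_in G (arcs_into G rv r)"
proof -
  have "s \<in> ray_equiv G `` {r} \<longleftrightarrow> s \<in> rays_in G (arcs_into G rv r)" for s
    using ray_equiv_iff[of r s] arcs_into_eq[OF arcs_into_core_scopo[OF r], of s]
      range_arcs_into[of s] r
    unfolding rays_in_def by auto
  then show ?thesis by blast
qed

lemma ray_in_scopo:
  assumes "core_scopo G rv {} Or" "a \<in> Or"
  shows "\<exists>r\<in>rays_in G Or. r 0 = a"
proof -
  obtain r where r: "r 0 = a \<and> (\<forall>i. r i \<in> Or \<and> head G (r i) = tail G (r (Suc i)))"
    using flow_exists[OF assms(1) wf_digraph_axioms assms(2)] by (rule exE)
  then have "ray G r" using flow_ray[OF assms(1), of r] by simp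
  then have "r \<in> rays_in G Or" using r unfolding rays_in_def by auto
  then show ?thesis using r by blast
qed

text \<open>
  Ends of a tree are the same as orientations with empty core. In contrast to a class of rays, such
  an orientation can be projected to \<open>\<Gamma>\<close> and lifted from it.
\<close>

lemma ends_iff: "\<xi> \<in> ends G \<longleftrightarrow> (\<exists>Or. core_scopo G rv {} Or \<and> \<xi> = rays_in G Or)"
proof
  assume "\<xi> \<in> ends G"
  then obtain r where r: "ray G r" "\<xi> = ray_equiv G `` {r}"
    unfolding ends_def by (auto elim: quotientE)
  show "\<exists>Or. core_scopo G rv {} Or \<and> \<xi> = rays_in G Or"
    using rays_in_arcs_into[OF r(1)] arcs_into_core_scopo[OF r(1)] r(2) by blast
next
  assume "\<exists>Or. core_scopo G rv {} Or \<and> \<xi> = rays_in G Or"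
  then obtain Or where Or: "core_scopo G rv {} Or" "\<xi> = rays_in G Or" by blast
  obtain v where "v \<in> verts G" using connected unfolding strongly_connected_def by blast
  then obtain a where "a \<in> Or" using Or(1) unfolding core_scopo_def by blast
  then obtain r where r: "r \<in> rays_in G Or" using ray_in_scopo Or by blast
  then have "ray G r" "arcs_into G rv r = Or"
    using arcs_into_eq[OF Or(1), of r] unfolding rays_in_def by auto
  then have "\<xi> = ray_equiv G `` {r}" using rays_in_arcs_into[of r] Or by simp
  then show "\<xi> \<in> ends G"
    unfolding ends_def using \<open>ray G r\<close> by (simp add: quotientI)
qed

lemma Union_rays_in: "core_scopo G rv {} Or \<Longrightarrow> (\<Union>r\<in>rays_in G Or. range r) = Or"
proof
  assume *: "core_scopo G rv {} Or"
  show "Or \<subseteq> (\<Union>r\<in>rays_in G Or. range r)"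
  proof
    fix a assume "a \<in> Or"
    then obtain r where "r \<in> rays_in G Or" "r 0 = a" using ray_in_scopo[OF *] by blast
    then show "a \<in> (\<Union>r\<in>rays_in G Or. range r)" by blast
  qed
qed (auto simp: rays_in_def)

lemma arcs_towards_rays_in: "core_scopo G rv {} Or \<Longrightarrow> arcs_towards G (rays_in G Or) = Or"
proof -
  assume *: "core_scopo G rv {} Or"
  then have "Or \<subseteq> arcs G" unfolding core_scopo_def by blast
  then show ?thesis using Union_rays_in[OF *] unfolding arcs_towards_def by blast
qed

lemma end_core_scopo:
  assumes "\<xi> \<in> ends G"
  shows "core_scopo G rv {} (arcs_towards G \<xi>)" "rays_in G (arcs_towards G \<xi>) = \<xi>"
proof -
  obtain Or where "core_scopo G rv {} Or" "\<xi> = rays_in G Or" using assms unfolding ends_iff by blast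
  then show "core_scopo G rv {} (arcs_towards G \<xi>)" "rays_in G (arcs_towards G \<xi>) = \<xi>"
    using arcs_towards_rays_in[of Or] by simp_all
qed

text \<open>
  The map \<open>f\<close> is arbitrary because the lemma is also applied to the arc map of an automorphism of a
  larger tree.
\<close>

lemma invariant_end_scopo:
  assumes "core_scopo G rv {} Or" "(\<lambda>r. f \<circ> r) ` rays_in G Or = rays_in G Or"
  shows "f ` Or = Or"
proof -
  have "f ` (\<Union>r\<in>rays_in G Or. range r) = (\<Union>r\<in>(\<lambda>r. f \<circ> r) ` rays_in G Or. range r)"
    by auto
  then have "f ` Or = (\<Union>r\<in>(\<lambda>r. f \<circ> r) ` rays_in G Or. range r)"
    using Union_rays_in[OF assms(1)] by simp
  also have "\<dots> = Or" using assms(2) Union_rays_in[OF assms(1)] by simp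
  finally show ?thesis .
qed

end

section \<open>Automorphisms and translations\<close>

lemma bij_betw_invariant_image:
  assumes "bij_betw f S S" "A \<subseteq> S" "\<And>x. x \<in> S \<Longrightarrow> f x \<in> A \<longleftrightarrow> x \<in> A"
  shows "f ` A = A"
proof (intro equalityI subsetI)
  fix y assume y: "y \<in> A"
  then have "y \<in> f ` S" using assms(1,2) unfolding bij_betw_def by auto
  then show "y \<in> f ` A" using assms(3) y by auto
qed (use assms(2,3) in auto)

locale graph_automorphism = rgraph +
  fixes g
  assumes aut: "g \<in> graph_Aut G rv"
begin

lemma bij_verts: "bij_betw (fst g) (verts G) (verts G)"
  using aut unfolding graph_Aut_def Bij_def by blast

lemma bij_arcs: "bij_betw (snd g) (arcs G) (arcs G)"
  using aut unfolding graph_Aut_def Bij_def by blast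

lemma arc_image: "a \<in> arcs G \<Longrightarrow> snd g a \<in> arcs G"
  using bij_arcs bij_betw_apply by metis

lemma tail_image: "a \<in> arcs G \<Longrightarrow> tail G (snd g a) = fst g (tail G a)"
  using aut unfolding graph_Aut_def by blast

lemma head_image: "a \<in> arcs G \<Longrightarrow> head G (snd g a) = fst g (head G a)"
  using aut unfolding graph_Aut_def by blast

lemma rv_image: "a \<in> arcs G \<Longrightarrow> snd g (rv a) = rv (snd g a)"
  using aut unfolding graph_Aut_def by blast

lemma arc_inj: "a \<in> arcs G \<Longrightarrow> b \<in> arcs G \<Longrightarrow> snd g a = snd g b \<longleftrightarrow> a = b"
  using bij_arcs unfolding bij_betw_def by (meson inj_on_eq_iff)

lemma vert_inj: "u \<in> verts G \<Longrightarrow> v \<in> verts G \<Longrightarrow> fst g u = fst g v \<longleftrightarrow> u = v"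
  using bij_verts unfolding bij_betw_def by (meson inj_on_eq_iff)

lemma tails_image:
  assumes "A \<subseteq> arcs G" shows "fst g ` (tail G ` A) = tail G ` (snd g ` A)"
proof -
  have "fst g (tail G a) = tail G (snd g a)" if "a \<in> A" for a using tail_image assms that by auto
  then show ?thesis by (simp add: image_image cong: image_cong)
qed

lemma turn_image_iff:
  assumes "b \<in> arcs G" "c \<in> arcs G"
  shows "turn G rv (snd g b) (snd g c) \<longleftrightarrow> turn G rv b c"
  unfolding turn_def
  using assms arc_image tail_image[of c] head_image[of b] rv_image[of b] rv_in_arcs[of b]
    arc_inj[of c "rv b"] vert_inj[of "head G b" "tail G c"] by auto

lemma turn_image: "turn G rv b c \<Longrightarrow> turn G rv (snd g b) (snd g c)"
  using turn_image_iff[of b c] unfolding turn_def by blast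

lemma leads_image: "leads G rv b c \<Longrightarrow> leads G rv (snd g b) (snd g c)"
proof (induction rule: tranclp_induct)
  case (base c)
  then show ?case using turn_image[of b c] by (rule_tac tranclp.r_into_trancl)
next
  case (step c d)
  then show ?case using turn_image[of c d] by (rule_tac tranclp.trancl_into_trancl)
qed

text \<open>
  An automorphism that preserves the core maps arcs that enter the core to such arcs, and the rest
  of the orientation is determined by propagation.
\<close>

lemma core_scopo_image_iff:
  assumes "core_scopo G rv V Or" "funnels G V Or" "fst g ` V = V" "b \<in> arcs G"
  shows "snd g b \<in> Or \<longleftrightarrow> b \<in> Or"
proof -
  interpret A: core_scopo_graph G rv V Or by (rule core_scopo_graphI[OF assms(1)])
  have V_iff: "fst g v \<in> V \<longleftrightarrow> v \<in> V" if v: "v \<in> verts G" for v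
  proof
    assume "fst g v \<in> V"
    then obtain u where "u \<in> V" "fst g u = fst g v" using assms(3) by (metis imageE)
    then show "v \<in> V" using vert_inj[of u v] v A.core_verts by auto
  qed (use assms(3) in blast)
  have fwd: "snd g a \<in> Or" if a: "a \<in> Or" for a
  proof -
    obtain c where c: "head G c \<in> V" and cO: "c \<in> Or" "(turn G rv)\<^sup>*\<^sup>* a c"
      using A.funnel_path[OF assms(2) a] by blast
    then have cG: "c \<in> arcs G" "tail G c \<notin> V" using A.scopo_arcs A.scopo_tail by auto
    have "snd g c \<in> Or"
      using A.scopo_into_core[OF arc_image[OF cG(1)]] head_image[OF cG(1)] tail_image[OF cG(1)]
        V_iff cG c by simp
    then show ?thesis
      using turns_cases[OF cO(2)] leads_image A.scopo_back_leads by blast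
  qed
  show ?thesis
  proof
    assume gb: "snd g b \<in> Or"
    have "tail G b \<notin> V"
      using A.scopo_tail[OF gb] tail_image[OF assms(4)] V_iff[of "tail G b"] assms(4) by simp
    moreover have "rv b \<notin> Or" using fwd A.scopo_rv_notin[OF gb] rv_image[OF assms(4)] by metis
    ultimately show "b \<in> Or" using A.scopo_rv_iff assms(4) by blast
  qed (rule fwd)
qed

end

locale tree_automorphism = tree_graph + graph_automorphism
begin

lemma fixed_end_iff:
  assumes "core_scopo G rv {} Or"
  shows "(\<lambda>r. snd g \<circ> r) ` rays_in G Or = rays_in G Or \<longleftrightarrow> (\<forall>b\<in>arcs G. snd g b \<in> Or \<longleftrightarrow> b \<in> Or)"
proof
  have sub: "Or \<subseteq> arcs G" using assms unfolding core_scopo_def by blast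
  assume "(\<lambda>r. snd g \<circ> r) ` rays_in G Or = rays_in G Or"
  then have im: "snd g ` Or = Or" by (rule invariant_end_scopo[OF assms])
  show "\<forall>b\<in>arcs G. snd g b \<in> Or \<longleftrightarrow> b \<in> Or"
  proof (intro ballI iffI)
    fix b assume b: "b \<in> arcs G" "snd g b \<in> Or"
    then obtain c where "c \<in> Or" "snd g c = snd g b" using im by (metis imageE)
    then show "b \<in> Or" using arc_inj[of c b] b sub by auto
  qed (use im in blast)
next
  assume inv: "\<forall>b\<in>arcs G. snd g b \<in> Or \<longleftrightarrow> b \<in> Or"
  show "(\<lambda>r. snd g \<circ> r) ` rays_in G Or = rays_in G Or"
  proof (intro equalityI subsetI)
    fix s assume "s \<in> (\<lambda>r. snd g \<circ> r) ` rays_in G Or"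
    then obtain r where r: "ray G r" "range r \<subseteq> Or" "s = snd g \<circ> r"
      unfolding rays_in_def by blast
    have "ray G s" by (rule turn_ray) (use r(3) turn_image[OF ray_turn[OF r(1)]] in simp)
    moreover have "range s \<subseteq> Or" using r inv ray_arcs[OF r(1)] by auto
    ultimately show "s \<in> rays_in G Or" unfolding rays_in_def by blast
  next
    fix s assume "s \<in> rays_in G Or"
    then have s: "ray G s" "range s \<subseteq> Or" unfolding rays_in_def by auto
    have "\<exists>a. a \<in> arcs G \<and> snd g a = s i" for i
      using bij_arcs ray_arcs[OF s(1), of i] unfolding bij_betw_def by (metis imageE)
    then obtain r where r: "\<And>i. r i \<in> arcs G" "\<And>i. snd g (r i) = s i" by metis
    have "ray G r"
    proof (rule turn_ray)
      fix i show "turn G rv (r i) (r (Suc i))"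
        using turn_image_iff[OF r(1) r(1), of i "Suc i"] ray_turn[OF s(1), of i] r(2) by simp
    qed
    moreover have "range r \<subseteq> Or" using inv r s(2) by (metis image_subset_iff)
    moreover have "s = snd g \<circ> r" using r(2) by auto
    ultimately show "s \<in> (\<lambda>r. snd g \<circ> r) ` rays_in G Or" unfolding rays_in_def by blast
  qed
qed

lemma translates_leads:
  assumes "translates G g l" shows "leads G rv (l i) (snd g (l i))"
proof -
  obtain n where n: "n > 0" "\<And>i. snd g (l i) = l (i + n)"
    using assms unfolding translates_def by blast
  have "line G l" using assms unfolding translates_def by blast
  then have "leads G rv (l i) (l (i + n))" using leads_int_seq[of l i "i + n"] line_turn n(1) by simp
  then show ?thesis using n(2) by simp
qed

text \<open>
  If one arc of the line belongs to an invariant orientation, then so do its translates, and by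
  propagation all arcs of the line.
\<close>

lemma translation_scopo_cases:
  assumes l: "translates G g l" and sc: "core_scopo G rv V Or"
    and inv: "\<And>b. b \<in> arcs G \<Longrightarrow> snd g b \<in> Or \<longleftrightarrow> b \<in> Or"
  shows "(\<forall>i. l i \<in> Or) \<or> (\<forall>i. rv (l i) \<in> Or) \<or> (\<forall>i. tail G (l i) \<in> V)"
proof -
  interpret A: core_scopo_graph G rv V Or by (rule core_scopo_graphI[OF sc])
  have line: "line G l" using l unfolding translates_def by blast
  obtain n where n: "n > 0" "\<And>i. snd g (l i) = l (i + n)"
    using l unfolding translates_def by blast
  have lG: "l i \<in> arcs G" for i using line unfolding line_def by blast
  note leads_l = leads_int_seq[of l, OF line_turn[OF line]]
  have shift: "l (i + n) \<in> Or \<longleftrightarrow> l i \<in> Or" "rv (l (i + n)) \<in> Or \<longleftrightarrow> rv (l i) \<in> Or" for i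
    using inv[OF lG, of i] inv[OF rv_in_arcs[OF lG], of i] rv_image[OF lG, of i] n(2)[of i] by auto
  have shifts: "(l (i + int k * n) \<in> Or \<longleftrightarrow> l i \<in> Or) \<and> (rv (l (i - int k * n)) \<in> Or \<longleftrightarrow> rv (l i) \<in> Or)" for i k
  proof (induction k)
    case (Suc k)
    have "l (i + int (Suc k) * n) \<in> Or \<longleftrightarrow> l (i + int k * n) \<in> Or"
      using shift(1)[of "i + int k * n"] by (simp add: algebra_simps)
    moreover have "rv (l (i - int (Suc k) * n)) \<in> Or \<longleftrightarrow> rv (l (i - int k * n)) \<in> Or"
      using shift(2)[of "i - int (Suc k) * n"] by (simp add: algebra_simps)
    ultimately show ?case using Suc by simp
  qed simp
  have far: "\<exists>k. d < int k * n" for d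
  proof (intro exI[of _ "nat d + 1"])
    have "d < int (nat d + 1) * 1" by simp
    also have "\<dots> \<le> int (nat d + 1) * n" using n(1) by (intro mult_left_mono) auto
    finally show "d < int (nat d + 1) * n" .
  qed
  have fwd: "l j \<in> Or" if "l i \<in> Or" for i j
  proof -
    obtain k where "j - i < int k * n" using far by blast
    then have "leads G rv (l j) (l (i + int k * n))" using leads_l by simp
    then show ?thesis using A.scopo_back_leads shifts that by blast
  qed
  have bwd: "rv (l j) \<in> Or" if "rv (l i) \<in> Or" for i j
  proof -
    obtain k where "i - j < int k * n" using far by blast
    then have "leads G rv (l (i - int k * n)) (l j)" using leads_l by simp
    then show ?thesis using A.scopo_back_leads leads_rv shifts that by blast
  qed
  show ?thesis using fwd bwd A.scopo_rv_iff[OF lG] by blast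
qed

text \<open>
  The axis of a translation lies in every invariant subtree. Otherwise the axis, in one of its two
  directions, would follow the orientation towards the subtree forever without reaching it.
\<close>

lemma translation_in_core:
  assumes l: "translates G g l" and sc: "core_scopo G rv V Or" "funnels G V Or" and V: "fst g ` V = V"
  shows "tail G (l i) \<in> V"
proof -
  interpret A: core_scopo_graph G rv V Or by (rule core_scopo_graphI[OF sc(1)])
  have line: "line G l" using l unfolding translates_def by blast
  have lG: "l i \<in> arcs G" "head G (l i) = tail G (l (i + 1))" for i using line unfolding line_def by auto
  have "\<not> (\<forall>i. l i \<in> Or)"
  proof
    assume *: "\<forall>i. l i \<in> Or"
    have "l (int i) \<in> Or \<and> head G (l (int i)) = tail G (l (int (Suc i)))" for i
      using * lG(2)[of "int i"] by (simp add: add.commute)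
    then show False by (rule A.funnels_no_flow[OF _ sc(2)])
  qed
  moreover have "\<not> (\<forall>i. rv (l i) \<in> Or)"
  proof
    assume *: "\<forall>i. rv (l i) \<in> Or"
    have "rv (l (- int i)) \<in> Or \<and> head G (rv (l (- int i))) = tail G (rv (l (- int (Suc i))))" for i
      using * lG(2)[of "- int (Suc i)"] head_rv[OF lG(1)] tail_rv[OF lG(1)] by simp
    then show False by (rule A.funnels_no_flow[OF _ sc(2)])
  qed
  ultimately show ?thesis
    using translation_scopo_cases[OF l sc(1)] core_scopo_image_iff[OF sc V] by blast
qed

text \<open>
  The images of the reduced walk from \<open>b\<close> to its image under the powers of \<open>g\<close> fit together to a line.
\<close>

lemma leads_translates:
  assumes "leads G rv b (snd g b)"
  shows "\<exists>l. translates G g l \<and> l 0 = b"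
proof -
  let ?A = "arcs G" and ?B = "BijGroup (arcs G)"
  interpret B: group ?B by (rule group_BijGroup)
  have carrier: "carrier ?B = Bij ?A" by (simp add: BijGroup_def)
  have gB: "snd g \<in> carrier ?B" using aut unfolding graph_Aut_def carrier by blast
  \<comment> \<open>integer powers of the arc map, taken in the group of bijections of the arcs\<close>
  define P where "P k = snd g [^]\<^bsub>?B\<^esub> (k::int)" for k
  have PB: "P k \<in> Bij ?A" for k using B.int_pow_closed[OF gB] unfolding P_def carrier .
  have mult: "(x \<otimes>\<^bsub>?B\<^esub> y) a = x (y a)" if "x \<in> Bij ?A" "y \<in> Bij ?A" "a \<in> ?A" for x y a
    using that by (simp add: BijGroup_def compose_def)
  have P1: "P 1 = snd g" unfolding P_def using B.int_pow_1 gB by blast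
  have P0: "P 0 a = a" if "a \<in> ?A" for a
    unfolding P_def using that by (simp add: BijGroup_def)
  have P_add: "P (j + k) a = P j (P k a)" if "a \<in> ?A" for j k a
    using B.int_pow_mult[OF gB, of j k] mult[OF PB PB that] unfolding P_def by simp
  have PA: "P k a \<in> ?A" if "a \<in> ?A" for k a using funcset_mem[OF Bij_imp_funcset[OF PB] that] .
  have P_Suc: "P (k + 1) a = snd g (P k a)" if "a \<in> ?A" for k a
    using P_add[OF that, of 1 k] P1 by (simp add: add.commute)
  have P_Suc': "P (k + 1) a = P k (snd g a)" if "a \<in> ?A" for k a
    using P_add[OF that, of k 1] P1 by simp
  have turn_Suc: "turn G rv (P (k + 1) a) (P (k + 1) c) \<longleftrightarrow> turn G rv (P k a) (P k c)"
    if "a \<in> ?A" "c \<in> ?A" for k a c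
    using turn_image_iff[OF PA PA] P_Suc that by simp
  have turn_P: "turn G rv (P k a) (P k c)" if t: "turn G rv a c" for k a c
  proof -
    have ac: "a \<in> ?A" "c \<in> ?A" using t unfolding turn_def by auto
    show ?thesis
    proof (induction k rule: int_induct[where k = 0])
      case base
      then show ?case using t P0 ac by simp
    next
      case (step1 i)
      then show ?case using turn_Suc[OF ac] by simp
    next
      case (step2 i)
      then show ?case using turn_Suc[OF ac, of "i - 1"] by simp
    qed
  qed
  obtain n where n: "n > 0" "(turn G rv ^^ n) b (snd g b)" using assms by (auto simp: tranclp_power)
  then obtain c where c: "c 0 = b" "c n = snd g b" "\<forall>i<n. turn G rv (c i) (c (Suc i))"
    unfolding relpowp_fun_conv by blast
  have cA: "c i \<in> ?A" if "i < n" for i using c(3) that unfolding turn_def by blast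
  \<comment> \<open>block \<open>q\<close> of length \<open>n\<close> is the image of the walk under the power \<open>q\<close>; the last arc of the walk starts the next block\<close>
  define l where "l i = P (i div int n) (c (nat (i mod int n)))" for i
  have m: "nat (i mod int n) < n" for i using n(1) by (simp add: nat_less_iff)
  have next_l: "l (i + 1) = P (i div int n) (c (Suc (nat (i mod int n))))" for i
  proof -
    have i: "i = int n * (i div int n) + i mod int n" by simp
    have mb: "0 \<le> i mod int n" "i mod int n < int n" using n(1) by auto
    show ?thesis
    proof (cases "i mod int n + 1 < int n")
      case True
      have "(i + 1) div int n = i div int n \<and> (i + 1) mod int n = i mod int n + 1"
      proof -
        have "i + 1 = int n * (i div int n) + (i mod int n + 1)" using i by linarith
        then show ?thesis
          using int_div_pos_eq[of "i + 1" "int n" "i div int n" "i mod int n + 1"]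
            int_mod_pos_eq[of "i + 1" "int n" "i div int n" "i mod int n + 1"] True mb by simp
      qed
      then show ?thesis unfolding l_def using mb by (simp add: nat_add_distrib)
    next
      case False
      then have last: "i mod int n = int n - 1" using mb by linarith
      then have "i + 1 = int n * (i div int n) + int n" using i by linarith
      then have "i + 1 = int n * (i div int n + 1)" by (simp add: distrib_left)
      then have "(i + 1) div int n = i div int n + 1" "(i + 1) mod int n = 0" using n(1) by auto
      moreover have "Suc (nat (i mod int n)) = n" using last n(1) by (simp add: nat_diff_distrib)
      ultimately show ?thesis unfolding l_def using c P_Suc' cA[OF n(1)] by simp
    qed
  qed
  have "turn G rv (l i) (l (i + 1))" for i
    unfolding next_l using turn_P c(3) m unfolding l_def by blast
  then have "line G l" by (rule turn_line)
  moreover have "\<exists>k>0. \<forall>i. snd g (l i) = l (i + k)"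
  proof (intro exI[of _ "int n"] conjI allI)
    fix i show "snd g (l i) = l (i + int n)"
      using P_Suc[OF cA[OF m]] n(1) unfolding l_def by simp
  qed (use n(1) in simp)
  moreover have "l 0 = b" unfolding l_def using c(1) P0 cA[OF n(1)] by simp
  ultimately show ?thesis unfolding translates_def by blast
qed

end

section \<open>Transitivity of the universal group\<close>

locale delta_action = local_action_diagram \<Gamma> rv X Gv + delta_tree \<Gamma> rv X T rvT piV piA L
  for \<Gamma> :: "('v, 'a) pre_digraph" and rv :: "'a \<Rightarrow> 'a"
    and X :: "'a \<Rightarrow> 'x set" and Gv :: "'v \<Rightarrow> ('x \<Rightarrow> 'x) set"
    and T :: "('w, 'b) pre_digraph" and rvT :: "'b \<Rightarrow> 'b"
    and piV :: "'w \<Rightarrow> 'v" and piA :: "'b \<Rightarrow> 'a" and L :: "'b \<Rightarrow> 'x"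
begin

abbreviation U where "U \<equiv> universal_group \<Gamma> X Gv T rvT piV piA L"

sublocale T: tree_graph T rvT
  by (rule tree_graphI[OF T_tree])

lemma piA_arcs: "b \<in> arcs T \<Longrightarrow> piA b \<in> arcs \<Gamma>"
  using piA_surj by blast

lemma piV_verts: "x \<in> verts T \<Longrightarrow> piV x \<in> verts \<Gamma>"
  using piV_surj by blast

lemma colour_in: "b \<in> arcs T \<Longrightarrow> L b \<in> X (piA b)"
  using L_bij_arc[of "tail T b" "piA b"] tail_piA[of b] piA_arcs[of b]
  by (auto simp: bij_betw_def)

lemma colour_inj:
  assumes "b \<in> arcs T" "c \<in> arcs T" "tail T b = tail T c" "L b = L c" shows "b = c"
  using L_bij_vertex[of "tail T c"] assms by (auto simp: bij_betw_def dest: inj_onD)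

lemma colour_exists:
  assumes "x \<in> verts T" "a \<in> arcs \<Gamma>" "tail \<Gamma> a = piV x" "c \<in> X a"
  shows "\<exists>b\<in>arcs T. tail T b = x \<and> piA b = a \<and> L b = c"
proof -
  have "c \<in> L ` {b \<in> out_arcs T x. piA b = a}"
    using L_bij_arc[of x a] assms by (simp add: bij_betw_def)
  then show ?thesis by auto
qed

lemma lift_arc:
  assumes "x \<in> verts T" "a \<in> arcs \<Gamma>" "tail \<Gamma> a = piV x"
  shows "\<exists>b\<in>arcs T. tail T b = x \<and> piA b = a"
  using colour_exists[OF assms] X_nonempty[OF assms(2)] by blast

lemma X_unique: "a \<in> arcs \<Gamma> \<Longrightarrow> a' \<in> arcs \<Gamma> \<Longrightarrow> c \<in> X a \<Longrightarrow> c \<in> X a' \<Longrightarrow> a = a'"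
  using X_disjoint unfolding disjoint_family_on_def by blast

lemma Gv_Bij: "v \<in> verts \<Gamma> \<Longrightarrow> \<sigma> \<in> Gv v \<Longrightarrow> \<sigma> \<in> Bij (colours_at \<Gamma> X v)"
  using subgroup.subset[OF Gv_subgroup] by (auto simp: BijGroup_def)

lemma Gv_orbit:
  assumes "a \<in> arcs \<Gamma>" "c \<in> X a"
  shows "{\<sigma> c | \<sigma>. \<sigma> \<in> Gv (tail \<Gamma> a)} = X a"
proof -
  let ?v = "tail \<Gamma> a"
  have v: "?v \<in> verts \<Gamma>" using assms by simp
  have cc: "c \<in> colours_at \<Gamma> X ?v" using assms unfolding colours_at_def by auto
  let ?orb = "{\<sigma> c | \<sigma>. \<sigma> \<in> Gv ?v}"
  have "?orb \<in> orbits (BijGroup (colours_at \<Gamma> X ?v)\<lparr>carrier := Gv ?v\<rparr>) (colours_at \<Gamma> X ?v) (\<lambda>\<sigma>. \<sigma>)"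
    unfolding orbits_def orbit_def using cc by auto
  then have "?orb \<in> X ` out_arcs \<Gamma> ?v" unfolding Gv_orbits[OF v] .
  then obtain a' where a': "a' \<in> arcs \<Gamma>" "?orb = X a'" by auto
  have "(\<lambda>x\<in>colours_at \<Gamma> X ?v. x) \<in> Gv ?v"
    using subgroup.one_closed[OF Gv_subgroup[OF v]] by (simp add: BijGroup_def)
  then have "c \<in> ?orb" using cc by (auto intro!: exI[of _ "\<lambda>x\<in>colours_at \<Gamma> X ?v. x"])
  then have "c \<in> X a'" using a'(2) by simp
  then have "a' = a" using X_unique a'(1) assms by blast
  then show ?thesis using a'(2) by simp
qed

lemma Gv_transitive:
  assumes "a \<in> arcs \<Gamma>" "c \<in> X a" "d \<in> X a"
  shows "\<exists>\<sigma>\<in>Gv (tail \<Gamma> a). \<sigma> c = d"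
proof -
  have "d \<in> {\<sigma> c | \<sigma>. \<sigma> \<in> Gv (tail \<Gamma> a)}" unfolding Gv_orbit[OF assms(1,2)] by (rule assms(3))
  then show ?thesis by blast
qed

lemma Gv_preserves:
  assumes "a \<in> arcs \<Gamma>" "c \<in> X a" "\<sigma> \<in> Gv (tail \<Gamma> a)" shows "\<sigma> c \<in> X a"
  using Gv_orbit[OF assms(1,2)] assms(3) by blast

lemma universal_groupD:
  assumes "g \<in> U"
  shows "g \<in> graph_Aut T rvT" "\<And>x. x \<in> verts T \<Longrightarrow> piV (fst g x) = piV x"
    "\<And>b. b \<in> arcs T \<Longrightarrow> piA (snd g b) = piA b"
  using assms unfolding universal_group_def Aut_pi_def by auto

text \<open>
  A map that respects incidence and is bijective around every vertex is a covering of the tree by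
  itself. It maps reduced walks to reduced walks, which have distinct endpoints, and so is injective;
  it is surjective because the tree is connected.
\<close>

lemma local_extension:
  assumes f: "\<And>x. x \<in> verts T \<Longrightarrow> f x \<in> verts T \<and> piV (f x) = piV x \<and> \<sigma> x \<in> Gv (piV x)"
    and A: "\<And>b. b \<in> arcs T \<Longrightarrow> A b \<in> arcs T \<and> tail T (A b) = f (tail T b) \<and> L (A b) = \<sigma> (tail T b) (L b)"
    and A_rv: "\<And>b. b \<in> arcs T \<Longrightarrow> A (rvT b) = rvT (A b)"
  shows "(restrict f (verts T), restrict A (arcs T)) \<in> U"
proof -
  have A_head: "head T (A b) = f (head T b)" if b: "b \<in> arcs T" for b
    using A[OF T.rv_in_arcs[OF b]] A_rv[OF b] T.tail_rv[of b] T.tail_rv[of "A b"] A[OF b] b by simp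
  have piA_A: "piA (A b) = piA b" if b: "b \<in> arcs T" for b
  proof -
    have "piV (tail T b) = tail \<Gamma> (piA b)" using tail_piA[OF b] by simp
    then have "L (A b) \<in> X (piA b)"
      using Gv_preserves[OF piA_arcs[OF b] colour_in[OF b], of "\<sigma> (tail T b)"] f[of "tail T b"] A[OF b] b
      by simp
    then show ?thesis 
      using X_unique[of "piA (A b)" "piA b" "L (A b)"] piA_arcs colour_in[of "A b"] A[OF b] b by simp
  qed
  have A_inj: "b = c" if "b \<in> arcs T" "c \<in> arcs T" "tail T b = tail T c" "A b = A c" for b c
  proof -
    have "\<sigma> (tail T b) \<in> Bij (colours_at \<Gamma> X (piV (tail T b)))"
      using Gv_Bij f[of "tail T b"] piV_verts that(1) by simp
    moreover have "L b \<in> colours_at \<Gamma> X (piV (tail T b))" "L c \<in> colours_at \<Gamma> X (piV (tail T b))"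
      using L_bij_vertex[of "tail T b"] that by (auto simp: bij_betw_def)
    moreover have "\<sigma> (tail T b) (L b) = \<sigma> (tail T b) (L c)"
      using A[OF that(1)] A[OF that(2)] that(3,4) by simp
    ultimately have "L b = L c" unfolding Bij_def bij_betw_def by (auto dest: inj_onD)
    then show ?thesis using colour_inj that by blast
  qed
  have A_surj: "\<exists>b\<in>arcs T. tail T b = x \<and> A b = a" if x: "x \<in> verts T" "a \<in> arcs T" "tail T a = f x" for x a
  proof -
    have "L a \<in> colours_at \<Gamma> X (piV x)"
      using L_bij_vertex[of "f x"] f[OF x(1)] x by (auto simp: bij_betw_def)
    moreover have "\<sigma> x \<in> Bij (colours_at \<Gamma> X (piV x))"
      using Gv_Bij f[OF x(1)] piV_verts x(1) by simp
    ultimately have "L a \<in> \<sigma> x ` colours_at \<Gamma> X (piV x)" unfolding Bij_def bij_betw_def by simp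
    then obtain c where c: "c \<in> colours_at \<Gamma> X (piV x)" "\<sigma> x c = L a" by auto
    have "c \<in> L ` out_arcs T x" using L_bij_vertex[OF x(1)] c(1) by (simp add: bij_betw_def)
    then obtain b where b: "b \<in> arcs T" "tail T b = x" "L b = c" by auto
    then have "A b = a" using colour_inj[of "A b" a] A[OF b(1)] x c(2) by simp
    then show ?thesis using b by blast
  qed
  have turn_A: "turn T rvT (A b) (A c)" if t: "turn T rvT b c" for b c
  proof -
    have bc: "b \<in> arcs T" "c \<in> arcs T" "head T b = tail T c" "c \<noteq> rvT b" using t unfolding turn_def by auto
    have "A c \<noteq> A (rvT b)" using A_inj[of c "rvT b"] bc T.rv_in_arcs[of b] T.tail_rv[of b] by auto
    then show ?thesis unfolding turn_def using A[of b] A[of c] A_head[of b] A_rv[of b] bc by simp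
  qed
  have turns_A: "(turn T rvT)\<^sup>*\<^sup>* (A b) (A c)" if "(turn T rvT)\<^sup>*\<^sup>* b c" for b c
    using that
  proof (induction rule: rtranclp_induct)
    case (step c d)
    then show ?case using turn_A[of c d] by (rule_tac rtranclp.rtrancl_into_rtrancl)
  qed simp
  have f_inj: "u = v" if uv: "u \<in> verts T" "v \<in> verts T" "f u = f v" for u v
  proof (rule ccontr)
    assume "u \<noteq> v"
    interpret W: core_scopo_graph T rvT "{v}" "toward T v" by (rule T.toward_graph[OF uv(2)])
    obtain b where b: "b \<in> toward T v" "tail T b = u" using W.scopo_out[of u] uv \<open>u \<noteq> v\<close> by auto
    obtain c where c: "c \<in> toward T v" "head T c = v" and bc: "(turn T rvT)\<^sup>*\<^sup>* b c"
      using T.toward_path[OF uv(2) b(1)] by blast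
    have cT: "c \<in> arcs T" "b \<in> arcs T" using W.scopo_arcs c(1) b(1) by auto
    have "tail T (A b) \<noteq> head T (A c)"
      using turns_cases[OF turns_A[OF bc]]
    proof
      assume "A b = A c"
      then show ?thesis using T.no_loops[of "A c"] A[OF cT(1)] by simp
    qed (rule T.leads_tail_neq_head)
    then show False using A[OF cT(2)] A_head[OF cT(1)] b(2) c(2) uv(3) by simp
  qed
  obtain x0 where x0: "x0 \<in> verts T" using T.connected unfolding strongly_connected_def by blast
  have f_surj: "y \<in> f ` verts T" if y: "y \<in> verts T" for y
  proof (rule T.connected_induct[OF T.connected, where u = "f x0"])
    fix a assume a: "a \<in> arcs T" "tail T a \<in> f ` verts T"
    then obtain x where x: "x \<in> verts T" "tail T a = f x" by blast
    obtain b where b: "b \<in> arcs T" "tail T b = x" "A b = a" using A_surj[OF x(1) a(1) x(2)] by blast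
    then show "head T a \<in> f ` verts T" using A_head[OF b(1)] by simp
  qed (use x0 f y in auto)
  have fB: "restrict f (verts T) \<in> Bij (verts T)"
    unfolding Bij_def bij_betw_def inj_on_def using f f_inj f_surj by auto
  have "restrict A (arcs T) ` arcs T = arcs T"
  proof (intro equalityI subsetI)
    fix a assume a: "a \<in> arcs T"
    then obtain x where x: "x \<in> verts T" "tail T a = f x" using f_surj[of "tail T a"] by auto
    then show "a \<in> restrict A (arcs T) ` arcs T" using A_surj[OF x(1) a x(2)] by auto
  qed (use A in auto)
  moreover have "inj_on (restrict A (arcs T)) (arcs T)"
  proof (rule inj_onI)
    fix b c assume bc: "b \<in> arcs T" "c \<in> arcs T" "restrict A (arcs T) b = restrict A (arcs T) c"
    then have "A b = A c" by simp
    then have "f (tail T b) = f (tail T c)" using A[OF bc(1)] A[OF bc(2)] by simp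
    then show "b = c" using f_inj A_inj \<open>A b = A c\<close> bc by simp
  qed
  ultimately have AB: "restrict A (arcs T) \<in> Bij (arcs T)" unfolding Bij_def bij_betw_def by simp
  have "(restrict f (verts T), restrict A (arcs T)) \<in> graph_Aut T rvT"
    unfolding graph_Aut_def using fB AB A A_head A_rv T.rv_in_arcs by simp
  moreover have "local_action \<Gamma> X T piV L x (restrict f (verts T), restrict A (arcs T)) = \<sigma> x"
    if x: "x \<in> verts T" for x
  proof (rule extensionalityI)
    show "local_action \<Gamma> X T piV L x (restrict f (verts T), restrict A (arcs T)) \<in> extensional (colours_at \<Gamma> X (piV x))"
      unfolding local_action_def by simp
    show "\<sigma> x \<in> extensional (colours_at \<Gamma> X (piV x))"
      using Gv_Bij[OF piV_verts[OF x]] f[OF x] unfolding Bij_def by blast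
    fix c assume c: "c \<in> colours_at \<Gamma> X (piV x)"
    define b where "b = inv_into (out_arcs T x) L c"
    have im: "c \<in> L ` out_arcs T x" using L_bij_vertex[OF x] c by (simp add: bij_betw_def)
    have "b \<in> out_arcs T x" "L b = c"
      unfolding b_def using inv_into_into[OF im] f_inv_into_f[OF im] by auto
    then show "local_action \<Gamma> X T piV L x (restrict f (verts T), restrict A (arcs T)) c = \<sigma> x c"
      unfolding local_action_def using c A[of b] by (simp add: b_def[symmetric])
  qed
  ultimately show ?thesis
    unfolding universal_group_def Aut_pi_def using f piA_A by simp
qed

text \<open>
  A local permutation at \<open>x0\<close> extends outwards. Once the image of a vertex and the permutation there
  are chosen, the images of its neighbours are forced, and the permutation at a neighbour only has to
  map the colour of the arc leading back to the colour of the image of that arc. Both colours belong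
  to the same set \<open>X\<^sub>a\<close>, on which the local group is transitive.
\<close>

lemma universal_group_extension:
  assumes x0: "x0 \<in> verts T" and y0: "y0 \<in> verts T" and pi: "piV x0 = piV y0"
    and \<sigma>0: "\<sigma>0 \<in> Gv (piV x0)"
  shows "\<exists>g\<in>U. fst g x0 = y0 \<and> (\<forall>b\<in>arcs T. tail T b = x0 \<longrightarrow> L (snd g b) = \<sigma>0 (L b))"
proof -
  interpret W: core_scopo_graph T rvT "{x0}" "toward T x0" by (rule T.toward_graph[OF x0])
  let ?C = "T \<restriction> {x0}"
  have VC: "verts ?C \<subseteq> verts T" using x0 by simp
  define P where "P z = (THE p. projecting_path T ?C z p)" for z
  have P: "projecting_path T ?C z (P z)" if z: "z \<in> verts T" for z
  proof -
    have "\<exists>p. projecting_path T ?C z p"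
      using W.projecting_path_exists[of ?C z] T.toward_funnels[OF x0] z by simp
    then have "\<exists>!p. projecting_path T ?C z p" using W.projecting_path_unique[of ?C z] by auto
    then show ?thesis unfolding P_def by (rule theI')
  qed
  have P_eq: "P z = p" if "z \<in> verts T" "projecting_path T ?C z p" for z p
    using W.projecting_path_unique[of ?C z] P[OF that(1)] that(2) by simp
  have P_root: "P x0 = []" using P_eq[OF x0] T.projecting_path_Nil[OF VC] by simp
  have P_parent: "P (tail T p) = p # P (head T p)" if p: "p \<in> toward T x0" for p
  proof -
    have pT: "p \<in> arcs T" "tail T p \<noteq> x0" using W.scopo_arcs[OF p] W.scopo_tail[OF p] by auto
    obtain a q where aq: "P (tail T p) = a # q"
      using P[of "tail T p"] pT T.projecting_path_Nil[OF VC] by (cases "P (tail T p)") auto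
    have pr: "projecting_path T ?C (tail T p) (a # q)" using P[of "tail T p"] aq pT by simp
    then have "a \<in> toward T x0" "tail T a = tail T p"
      using W.projecting_path_in_scopo[of ?C "tail T p" "a # q"] T.projecting_path_Cons[OF VC] by auto
    then have "a = p" using W.scopo_unique p by blast
    then have "projecting_path T ?C (head T p) q" using pr T.projecting_path_Cons[OF VC] by simp
    then show ?thesis using P_eq[of "head T p" q] aq \<open>a = p\<close> pT by simp
  qed
  define out where "out y c = inv_into (out_arcs T y) L c" for y c
  \<comment> \<open>a vertex carries its image and its local permutation; \<open>d\<close> is the image of the arc from the parent\<close>
  define step where "step p h = (let d = out (fst h) (snd h (L (rvT p))) in
    (head T d, SOME \<tau>. \<tau> \<in> Gv (piV (tail T p)) \<and> \<tau> (L p) = L (rvT d)))" for p and h :: "'w \<times> ('x \<Rightarrow> 'x)"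
  define h where "h z = foldr step (P z) (y0, \<sigma>0)" for z
  define f where "f z = fst (h z)" for z
  define \<sigma> where "\<sigma> z = snd (h z)" for z
  define A where "A b = out (f (tail T b)) (\<sigma> (tail T b) (L b))" for b
  define I where "I z \<longleftrightarrow> f z \<in> verts T \<and> piV (f z) = piV z \<and> \<sigma> z \<in> Gv (piV z)" for z
  have A: "A b \<in> arcs T \<and> tail T (A b) = f (tail T b) \<and> L (A b) = \<sigma> (tail T b) (L b) \<and> piA (A b) = piA b"
    if b: "b \<in> arcs T" and I: "I (tail T b)" for b
  proof -
    have "\<sigma> (tail T b) (L b) \<in> X (piA b)"
      using Gv_preserves[OF piA_arcs[OF b] colour_in[OF b]] I tail_piA[OF b] unfolding I_def by simp
    moreover have "tail \<Gamma> (piA b) = piV (f (tail T b))" using tail_piA[OF b] I unfolding I_def by simp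
    ultimately obtain c where c: "c \<in> arcs T" "tail T c = f (tail T b)" "piA c = piA b"
      "L c = \<sigma> (tail T b) (L b)"
      using colour_exists[of "f (tail T b)" "piA b"] piA_arcs[OF b] I unfolding I_def by blast
    have "inj_on L (out_arcs T (f (tail T b)))"
      using L_bij_vertex I unfolding I_def bij_betw_def by blast
    then have "A b = c" unfolding A_def out_def using c by (metis in_out_arcs_conv inv_into_f_eq)
    then show ?thesis using c by simp
  qed
  have h_parent: "f (tail T p) = head T (A (rvT p))"
    "\<sigma> (tail T p) = (SOME \<tau>. \<tau> \<in> Gv (piV (tail T p)) \<and> \<tau> (L p) = L (rvT (A (rvT p))))"
    if p: "p \<in> toward T x0" for p
  proof -
    have "h (tail T p) = step p (h (head T p))" unfolding h_def P_parent[OF p] by simp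
    moreover have "out (fst (h (head T p))) (snd (h (head T p)) (L (rvT p))) = A (rvT p)"
      unfolding A_def f_def \<sigma>_def using T.tail_rv W.scopo_arcs[OF p] by simp
    ultimately show "f (tail T p) = head T (A (rvT p))"
      "\<sigma> (tail T p) = (SOME \<tau>. \<tau> \<in> Gv (piV (tail T p)) \<and> \<tau> (L p) = L (rvT (A (rvT p))))"
      unfolding f_def \<sigma>_def step_def Let_def by simp_all
  qed
  have parent: "I (tail T p) \<and> \<sigma> (tail T p) (L p) = L (rvT (A (rvT p)))"
    if p: "p \<in> toward T x0" and Ip: "I (head T p)" for p
  proof -
    have pT: "p \<in> arcs T" "rvT p \<in> arcs T" "tail T (rvT p) = head T p"
      using W.scopo_arcs[OF p] T.rv_in_arcs T.tail_rv by auto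
    have d: "A (rvT p) \<in> arcs T" "piA (A (rvT p)) = piA (rvT p)"
      using A[OF pT(2)] Ip pT(3) by auto
    have "piA (rvT (A (rvT p))) = piA p"
      using piA_rvT[OF d(1)] d(2) piA_rvT[OF pT(1)] rv_rv[OF piA_arcs[OF pT(1)]] by simp
    then have "L (rvT (A (rvT p))) \<in> X (piA p)" using colour_in[OF T.rv_in_arcs[OF d(1)]] by simp
    then have ex: "\<exists>\<tau>. \<tau> \<in> Gv (piV (tail T p)) \<and> \<tau> (L p) = L (rvT (A (rvT p)))"
      using Gv_transitive[OF piA_arcs[OF pT(1)] colour_in[OF pT(1)]] tail_piA[OF pT(1)] by auto
    have "\<sigma> (tail T p) \<in> Gv (piV (tail T p)) \<and> \<sigma> (tail T p) (L p) = L (rvT (A (rvT p)))"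
      unfolding h_parent(2)[OF p] by (rule someI_ex[OF ex])
    moreover have "piV (f (tail T p)) = piV (tail T p)"
      using h_parent(1)[OF p] head_piA[OF d(1)] d(2) piA_rvT[OF pT(1)] head_rv[OF piA_arcs[OF pT(1)]]
        tail_piA[OF pT(1)] by simp
    moreover have "f (tail T p) \<in> verts T" using h_parent(1)[OF p] d(1) by simp
    ultimately show ?thesis unfolding I_def by blast
  qed
  have I: "I z" if "z \<in> verts T" for z
  proof -
    have "\<forall>z\<in>verts T. P z = p \<longrightarrow> I z" for p
    proof (induction p)
      case Nil
      have "z = x0" if "z \<in> verts T" "P z = []" for z
        using P[OF that(1)] that(2) T.projecting_path_Nil[OF VC] by simp
      moreover have "I x0" unfolding I_def f_def \<sigma>_def h_def P_root using y0 pi \<sigma>0 by simp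
      ultimately show ?case by blast
    next
      case (Cons a p)
      show ?case
      proof (intro ballI impI)
        fix z assume z: "z \<in> verts T" "P z = a # p"
        have pr: "projecting_path T ?C z (a # p)" using P[OF z(1)] z(2) by simp
        have a: "a \<in> toward T x0" "tail T a = z" "a \<in> arcs T"
          using W.projecting_path_in_scopo[OF _ pr] pr T.projecting_path_Cons[OF VC] by auto
        then have "P (head T a) = p" using P_parent[OF a(1)] z(2) by simp
        then have "I (head T a)" using Cons.IH a(3) by simp
        then show "I z" using parent[OF a(1)] a(2) by simp
      qed
    qed
    then show ?thesis using that by blast
  qed
  have A': "A b \<in> arcs T \<and> tail T (A b) = f (tail T b) \<and> L (A b) = \<sigma> (tail T b) (L b)"
    if "b \<in> arcs T" for b using A[OF that] I that by simp
  have A_parent: "A p = rvT (A (rvT p))" if p: "p \<in> toward T x0" for p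
  proof -
    have pT: "p \<in> arcs T" using W.scopo_arcs[OF p] .
    have "rvT p \<in> arcs T" using T.rv_in_arcs[OF pT] .
    then have d: "A (rvT p) \<in> arcs T" using A' by blast
    show ?thesis
    proof (rule colour_inj)
      show "A p \<in> arcs T" using A'[OF pT] by blast
      show "rvT (A (rvT p)) \<in> arcs T" using T.rv_in_arcs[OF d] .
      show "tail T (A p) = tail T (rvT (A (rvT p)))"
        using A'[OF pT] h_parent(1)[OF p] T.tail_rv[OF d] by simp
      show "L (A p) = L (rvT (A (rvT p)))"
        using A'[OF pT] parent[OF p] I[of "head T p"] pT by simp
    qed
  qed
  have A_rv: "A (rvT b) = rvT (A b)" if b: "b \<in> arcs T" for b
  proof (cases "b \<in> toward T x0")
    case True
    then show ?thesis
      using A_parent[OF True] T.rv_rv[of "A (rvT b)"] A'[OF T.rv_in_arcs[OF b]] by simp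
  next
    case False
    then have "rvT b \<in> toward T x0" using W.scopo_rv_iff[OF b] T.no_loops[OF b] by auto
    then show ?thesis using A_parent[of "rvT b"] T.rv_rv[OF b] by simp
  qed
  have "(restrict f (verts T), restrict A (arcs T)) \<in> U"
    by (rule local_extension[of f \<sigma> A]) (use I A' A_rv in \<open>auto simp: I_def\<close>)
  moreover have "f x0 = y0" "\<sigma> x0 = \<sigma>0" unfolding f_def \<sigma>_def h_def P_root by simp_all
  ultimately show ?thesis
    by (intro bexI[of _ "(restrict f (verts T), restrict A (arcs T))"]) (use x0 A' in auto)
qed

text \<open>
  Invariant sets of arcs are therefore unions of fibres of the projection, which is what lets them
  descend to the diagram. The element comes from extending a local permutation that moves the one
  colour to the other.
\<close>

lemma universal_group_transitive:
  assumes b: "b \<in> arcs T" and c: "c \<in> arcs T" and pi: "piA b = piA c"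
  shows "\<exists>g\<in>U. snd g b = c"
proof -
  have piV: "piV (tail T b) = piV (tail T c)" using tail_piA[OF b] tail_piA[OF c] pi by simp
  obtain \<sigma> where \<sigma>: "\<sigma> \<in> Gv (piV (tail T b))" "\<sigma> (L b) = L c"
    using Gv_transitive[OF piA_arcs[OF b] colour_in[OF b]] colour_in[OF c] pi tail_piA[OF b] by auto
  obtain g where g: "g \<in> U" "fst g (tail T b) = tail T c" "L (snd g b) = L c"
    using universal_group_extension[of "tail T b" "tail T c" \<sigma>] b c piV \<sigma> by auto
  interpret g: graph_automorphism T rvT g
    by unfold_locales (rule universal_groupD(1)[OF g(1)])
  have "snd g b = c"
    using colour_inj[OF g.arc_image[OF b] c] g.tail_image[OF b] g(2,3) by simp
  then show ?thesis using g(1) by blast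
qed

end

section \<open>Invariant orientations and their images in the diagram\<close>

context local_action_diagram
begin

text \<open>
  What a fixed end of \<open>T\<close> leaves in the diagram. Since \<open>\<Gamma>\<close> need not be a tree this is an orientation
  and not an end: besides horocyclic ends it covers a cyclic cotree with a cyclic orientation.
\<close>

definition delta_end :: "'a set \<Rightarrow> bool" where
  "delta_end Or \<longleftrightarrow> core_scopo \<Gamma> rv {} Or \<and> (\<forall>a\<in>Or. card (X a) = 1)"

text \<open>
  For the first arcs of the projecting paths the condition on cardinalities is the condition on all
  their arcs, since every part of a projecting path up to its end is projecting again.
\<close>

lemma cotree_core_scopo:
  assumes "cotree \<Gamma> X C"
  shows "core_scopo \<Gamma> rv (verts C) (cotree_scopo \<Gamma> C)" "funnels \<Gamma> (verts C) (cotree_scopo \<Gamma> C)"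
    "\<forall>a\<in>cotree_scopo \<Gamma> C. card (X a) = 1" "C = \<Gamma> \<restriction> verts C" "verts C \<noteq> {}" "verts C \<subseteq> verts \<Gamma>"
proof -
  have gc: "graph_cotree \<Gamma> C" using assms unfolding cotree_def by blast
  show sc: "core_scopo \<Gamma> rv (verts C) (cotree_scopo \<Gamma> C)"
    and "funnels \<Gamma> (verts C) (cotree_scopo \<Gamma> C)"
    using graph_cotree_core_scopo[OF gc] by auto
  show "verts C \<subseteq> verts \<Gamma>" using sc unfolding core_scopo_def by blast
  show "\<forall>a\<in>cotree_scopo \<Gamma> C. card (X a) = 1"
    using assms unfolding cotree_def cotree_scopo_def by blast
  show "C = \<Gamma> \<restriction> verts C" "verts C \<noteq> {}"
    using gc induced_subgraph_eq[of C \<Gamma>] unfolding graph_cotree_def by auto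
qed

lemma cotreeI:
  assumes "V \<noteq> {}" and sc: "core_scopo \<Gamma> rv V Or" "funnels \<Gamma> V Or" and card: "\<forall>a\<in>Or. card (X a) = 1"
  shows "cotree \<Gamma> X (\<Gamma> \<restriction> V)" "cotree_scopo \<Gamma> (\<Gamma> \<restriction> V) = Or"
proof -
  interpret A: core_scopo_graph \<Gamma> rv V Or by (rule core_scopo_graphI[OF sc(1)])
  show "cotree_scopo \<Gamma> (\<Gamma> \<restriction> V) = Or" using A.cotree_scopo_eq[of "\<Gamma> \<restriction> V"] sc(2) by simp
  show "cotree \<Gamma> X (\<Gamma> \<restriction> V)" unfolding cotree_def
  proof (intro conjI allI impI ballI)
    show "graph_cotree \<Gamma> (\<Gamma> \<restriction> V)" by (rule A.graph_cotree_induce[OF assms(1) sc(2)])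
    fix v p a assume "projecting_path \<Gamma> (\<Gamma> \<restriction> V) v p" "a \<in> set p"
    then show "card (X a) = 1"
      using A.projecting_path_in_scopo[of "\<Gamma> \<restriction> V" v p] card by auto
  qed
qed

end

context delta_action
begin

abbreviation lift :: "'a set \<Rightarrow> 'b set" where "lift Or \<equiv> {b \<in> arcs T. piA b \<in> Or}"
abbreviation liftV :: "'v set \<Rightarrow> 'w set" where "liftV V \<equiv> {x \<in> verts T. piV x \<in> V}"

lemma automorphism: "g \<in> U \<Longrightarrow> tree_automorphism T rvT g"
  by (intro tree_automorphism.intro graph_automorphism.intro graph_automorphism_axioms.intro
      T.tree_graph_axioms T.rgraph_axioms universal_groupD(1))

lemma piA_lift: "Or \<subseteq> arcs \<Gamma> \<Longrightarrow> piA ` lift Or = Or"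
proof (intro equalityI subsetI)
  fix a assume "Or \<subseteq> arcs \<Gamma>" "a \<in> Or"
  then have "a \<in> piA ` arcs T" using piA_surj by auto
  then show "a \<in> piA ` lift Or" using \<open>a \<in> Or\<close> by auto
qed auto

lemma lift_inj: "Or \<subseteq> arcs \<Gamma> \<Longrightarrow> Or' \<subseteq> arcs \<Gamma> \<Longrightarrow> lift Or = lift Or' \<Longrightarrow> Or = Or'"
  using piA_lift by metis

text \<open>
  The condition \<open>|X\<^sub>a| = 1\<close> says that an oriented arc has only one lift to a given vertex.
\<close>

lemma lift_core_scopo:
  assumes sc: "core_scopo \<Gamma> rv V Or" and card: "\<forall>a\<in>Or. card (X a) = 1"
  shows "core_scopo T rvT (liftV V) (lift Or)"
proof -
  interpret A: core_scopo_graph \<Gamma> rv V Or by (rule core_scopo_graphI[OF sc])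
  show ?thesis unfolding core_scopo_def
  proof (intro conjI ballI impI)
    show "\<exists>!b. b \<in> lift Or \<and> tail T b = x" if x: "x \<in> verts T - liftV V" for x
    proof -
      have "piV x \<in> verts \<Gamma>" "piV x \<notin> V" using x piV_verts by auto
      then obtain a where a: "a \<in> Or" "tail \<Gamma> a = piV x" using A.scopo_out by blast
      obtain b where b: "b \<in> arcs T" "tail T b = x" "piA b = a"
        using lift_arc[of x a] A.scopo_arcs[OF a(1)] a(2) x by auto
      have "d = b" if d: "d \<in> lift Or" "tail T d = x" for d
      proof -
        have da: "piA d = a" using A.scopo_unique[of "piA d" a] a d tail_piA[of d] by simp
        obtain c where "X a = {c}" using card a(1) by (meson card_1_singletonE)
        then have "L d = L b" using colour_in[of d] colour_in[OF b(1)] d(1) b(3) da by simp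
        then show ?thesis using colour_inj[of d b] b d by simp
      qed
      then show ?thesis using b a by blast
    qed
    show "tail T b \<notin> liftV V" if "b \<in> lift Or" for b
      using that A.scopo_tail[of "piA b"] tail_piA[of b] by auto
    fix b assume b: "b \<in> arcs T" "tail T b \<notin> liftV V \<or> head T b \<notin> liftV V"
    then show "b \<in> lift Or \<longleftrightarrow> rvT b \<notin> lift Or"
      using A.scopo_rv_iff[OF piA_arcs[OF b(1)]] tail_piA[OF b(1)] head_piA[OF b(1)] piA_rvT[OF b(1)]
        T.rv_in_arcs[OF b(1)] by auto
  qed auto
qed

lemma lift_funnels:
  assumes sc: "core_scopo \<Gamma> rv V Or" and f: "funnels \<Gamma> V Or"
  shows "funnels T (liftV V) (lift Or)"
  unfolding funnels_def
proof
  interpret A: core_scopo_graph \<Gamma> rv V Or by (rule core_scopo_graphI[OF sc])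
  fix b assume b: "b \<in> lift Or"
  then obtain c where c: "(follows \<Gamma> Or)\<^sup>*\<^sup>* (piA b) c" "head \<Gamma> c \<in> V"
    using f unfolding funnels_def by blast
  have "\<forall>b\<in>arcs T. piA b = a \<longrightarrow> (\<exists>d. (follows T (lift Or))\<^sup>*\<^sup>* b d \<and> head T d \<in> liftV V)"
    if "(follows \<Gamma> Or)\<^sup>*\<^sup>* a c" for a
    using that
  proof (induction rule: converse_rtranclp_induct)
    case base
    then show ?case using c(2) head_piA by auto
  next
    case (step a a')
    have a': "a' \<in> Or" "head \<Gamma> a = tail \<Gamma> a'" using step(1) unfolding follows_def by auto
    show ?case
    proof (intro ballI impI)
      fix b assume b: "b \<in> arcs T" "piA b = a"
      obtain b' where b': "b' \<in> arcs T" "tail T b' = head T b" "piA b' = a'"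
        using lift_arc[of "head T b" a'] A.scopo_arcs[OF a'(1)] a'(2) head_piA[OF b(1)] b by auto
      obtain d where d: "(follows T (lift Or))\<^sup>*\<^sup>* b' d" "head T d \<in> liftV V"
        using step.IH b' by blast
      have "follows T (lift Or) b b'" unfolding follows_def using b' a' by simp
      then show "\<exists>d. (follows T (lift Or))\<^sup>*\<^sup>* b d \<and> head T d \<in> liftV V"
        using d by (meson converse_rtranclp_into_rtranclp)
    qed
  qed
  then show "\<exists>d. (follows T (lift Or))\<^sup>*\<^sup>* b d \<and> head T d \<in> liftV V" using c(1) b by blast
qed

lemma lift_invariant: "g \<in> U \<Longrightarrow> b \<in> arcs T \<Longrightarrow> snd g b \<in> lift Or \<longleftrightarrow> b \<in> lift Or"
  using universal_groupD(3)[of g b] graph_automorphism.arc_image[of T rvT g b]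
    tree_automorphism.axioms(2)[OF automorphism] by auto

text \<open>
  By transitivity on fibres, an invariant orientation is a union of fibres. All arcs of a fibre that
  start at the same vertex are then oriented, so there is only one of them.
\<close>

lemma descend_core_scopo:
  assumes sc: "core_scopo T rvT W OT"
    and inv: "\<And>g b. g \<in> U \<Longrightarrow> b \<in> arcs T \<Longrightarrow> snd g b \<in> OT \<longleftrightarrow> b \<in> OT"
  shows "core_scopo \<Gamma> rv (piV ` W) (piA ` OT)" "\<forall>a\<in>piA ` OT. card (X a) = 1"
    "W = liftV (piV ` W)" "OT = lift (piA ` OT)"
proof -
  interpret A: core_scopo_graph T rvT W OT by (rule T.core_scopo_graphI[OF sc])
  have sat: "c \<in> OT" if "b \<in> OT" "c \<in> arcs T" "piA c = piA b" for b c
    using universal_group_transitive[of b c] A.scopo_arcs[OF that(1)] inv that by force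
  show OT: "OT = lift (piA ` OT)" using sat A.scopo_arcs by auto
  have satW: "y \<in> W" if x: "x \<in> W" and y: "y \<in> verts T" "piV y = piV x" for x y
  proof (rule ccontr)
    assume "y \<notin> W"
    then obtain c where c: "c \<in> OT" "tail T c = y" using A.scopo_out y by blast
    have "x \<in> verts T" using A.core_verts x by blast
    then obtain b where "b \<in> arcs T" "tail T b = x" "piA b = piA c"
      using lift_arc[of x "piA c"] piA_arcs tail_piA[of c] A.scopo_arcs[OF c(1)] c(2) y(2) by auto
    then show False using sat[OF c(1)] A.scopo_tail x by blast
  qed
  show W: "W = liftV (piV ` W)" using satW A.core_verts by auto
  have in_iff: "piA b \<in> piA ` OT \<longleftrightarrow> b \<in> OT" if "b \<in> arcs T" for b using OT that by blast
  have inW_iff: "piV x \<in> piV ` W \<longleftrightarrow> x \<in> W" if "x \<in> verts T" for x using W that by blast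
  show "\<forall>a\<in>piA ` OT. card (X a) = 1"
  proof
    fix a assume "a \<in> piA ` OT"
    then obtain b where b: "b \<in> OT" "a = piA b" by blast
    have bT: "b \<in> arcs T" using A.scopo_arcs b by blast
    have "c = L b" if c: "c \<in> X a" for c
    proof -
      obtain d where d: "d \<in> arcs T" "tail T d = tail T b" "piA d = a" "L d = c"
        using colour_exists[of "tail T b" a c] bT b piA_arcs tail_piA c by auto
      then have "d \<in> OT" using sat b by blast
      then have "d = b" using A.scopo_unique b d by blast
      then show ?thesis using d by simp
    qed
    then have "X a = {L b}" using colour_in[OF bT] b by blast
    then show "card (X a) = 1" by simp
  qed
  show "core_scopo \<Gamma> rv (piV ` W) (piA ` OT)" unfolding core_scopo_def
  proof (intro conjI ballI impI)
    show "piV ` W \<subseteq> verts \<Gamma>" using A.core_verts piV_verts by blast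
    show "piA ` OT \<subseteq> arcs \<Gamma>" using A.scopo_arcs piA_arcs by blast
    show "\<exists>!a. a \<in> piA ` OT \<and> tail \<Gamma> a = v" if v: "v \<in> verts \<Gamma> - piV ` W" for v
    proof -
      obtain x where x: "x \<in> verts T" "v = piV x" using v piV_surj by blast
      then have "x \<notin> W" using v by blast
      then obtain b where b: "b \<in> OT" "tail T b = x" using A.scopo_out x by blast
      have "a = piA b" if a: "a \<in> piA ` OT" "tail \<Gamma> a = v" for a
      proof -
        have "a \<in> arcs \<Gamma>" using a A.scopo_arcs piA_arcs by blast
        then obtain d where d: "d \<in> arcs T" "tail T d = x" "piA d = a"
          using lift_arc[of x a] x a by blast
        then have "d \<in> OT" using in_iff a by blast
        then show ?thesis using A.scopo_unique b d by blast
      qed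
      moreover have "tail \<Gamma> (piA b) = v" using tail_piA[OF A.scopo_arcs[OF b(1)]] b x by simp
      ultimately show ?thesis using b(1) by (intro ex1I[of _ "piA b"]) auto
    qed
    show "tail \<Gamma> a \<notin> piV ` W" if a: "a \<in> piA ` OT" for a
    proof -
      obtain b where b: "b \<in> OT" "a = piA b" using a by blast
      then show ?thesis
        using A.scopo_tail[of b] inW_iff[of "tail T b"] tail_piA[of b] A.scopo_arcs[of b] by simp
    qed
    fix a assume a: "a \<in> arcs \<Gamma>" "tail \<Gamma> a \<notin> piV ` W \<or> head \<Gamma> a \<notin> piV ` W"
    then obtain b where b: "b \<in> arcs T" "a = piA b" using piA_surj by blast
    have "tail T b \<notin> W \<or> head T b \<notin> W"
      using a(2) b tail_piA[of b] head_piA[of b] by auto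
    then have "rvT b \<in> OT \<longleftrightarrow> b \<notin> OT" using A.scopo_rv_iff b by blast
    then show "a \<in> piA ` OT \<longleftrightarrow> rv a \<notin> piA ` OT"
      using in_iff[OF b(1)] in_iff[OF T.rv_in_arcs[OF b(1)]] piA_rvT[OF b(1)] b(2) by simp
  qed
qed

lemma descend_funnels:
  assumes "OT \<subseteq> arcs T" "funnels T W OT" shows "funnels \<Gamma> (piV ` W) (piA ` OT)"
  unfolding funnels_def
proof
  fix a assume "a \<in> piA ` OT"
  then obtain b where b: "b \<in> OT" "a = piA b" by blast
  obtain d where d: "(follows T OT)\<^sup>*\<^sup>* b d" "head T d \<in> W" using assms(2) b unfolding funnels_def by blast
  have "(follows \<Gamma> (piA ` OT))\<^sup>*\<^sup>* (piA b) (piA d) \<and> d \<in> OT" using d(1)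
  proof (induction rule: rtranclp_induct)
    case (step c d)
    then have cd: "c \<in> OT" "d \<in> OT" "head T c = tail T d" unfolding follows_def by auto
    then have "follows \<Gamma> (piA ` OT) (piA c) (piA d)"
      unfolding follows_def using head_piA[of c] tail_piA[of d] cd subsetD[OF assms(1)] by auto
    then show ?case using step.IH cd rtranclp.rtrancl_into_rtrancl by metis
  qed (use b in simp)
  moreover have "head \<Gamma> (piA d) \<in> piV ` W"
    using calculation head_piA[of d] subsetD[OF assms(1), of d] d(2) by auto
  ultimately show "\<exists>c. (follows \<Gamma> (piA ` OT))\<^sup>*\<^sup>* a c \<and> head \<Gamma> c \<in> piV ` W" using b by blast
qed

lemma fixed_end_delta_end:
  assumes "\<xi> \<in> fixed_ends T U"
  shows "delta_end (piA ` arcs_towards T \<xi>)" "arcs_towards T \<xi> = lift (piA ` arcs_towards T \<xi>)"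
    "\<xi> = rays_in T (arcs_towards T \<xi>)"
proof -
  have \<xi>: "\<xi> \<in> ends T" "\<And>g. g \<in> U \<Longrightarrow> (\<lambda>r. snd g \<circ> r) ` \<xi> = \<xi>"
    using assms unfolding fixed_ends_def by auto
  note e = T.end_core_scopo[OF \<xi>(1)]
  show "\<xi> = rays_in T (arcs_towards T \<xi>)" using e(2) by simp
  have inv: "snd g b \<in> arcs_towards T \<xi> \<longleftrightarrow> b \<in> arcs_towards T \<xi>" if "g \<in> U" "b \<in> arcs T" for g b
    using tree_automorphism.fixed_end_iff[OF automorphism[OF that(1)] e(1)] \<xi>(2)[OF that(1)] e(2) that(2)
    by simp
  note d = descend_core_scopo[OF e(1) inv]
  show "delta_end (piA ` arcs_towards T \<xi>)" unfolding delta_end_def using d(1,2) by simp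
  show "arcs_towards T \<xi> = lift (piA ` arcs_towards T \<xi>)" using d(4) by simp
qed

lemma lift_delta_end: "delta_end Or \<Longrightarrow> core_scopo T rvT {} (lift Or)"
  using lift_core_scopo[of "{}" Or] unfolding delta_end_def by simp

lemma delta_end_arcs: "delta_end Or \<Longrightarrow> Or \<subseteq> arcs \<Gamma>"
  unfolding delta_end_def core_scopo_def by blast

lemma delta_end_fixed_end:
  assumes "delta_end Or"
  shows "rays_in T (lift Or) \<in> fixed_ends T U" "arcs_towards T (rays_in T (lift Or)) = lift Or"
proof -
  note sc = lift_delta_end[OF assms]
  show "arcs_towards T (rays_in T (lift Or)) = lift Or" by (rule T.arcs_towards_rays_in[OF sc])
  have "rays_in T (lift Or) \<in> ends T" using sc T.ends_iff by blast
  moreover have "(\<lambda>r. snd g \<circ> r) ` rays_in T (lift Or) = rays_in T (lift Or)" if g: "g \<in> U" for g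
    using tree_automorphism.fixed_end_iff[OF automorphism[OF g] sc] lift_invariant[OF g] by blast
  ultimately show "rays_in T (lift Or) \<in> fixed_ends T U" unfolding fixed_ends_def by blast
qed

text \<open>
  Together with injectivity of the map this is the correspondence between fixed ends and structures
  in the diagram, uniformly for the lineal, focal and horocyclic types.
\<close>

lemma fixed_ends_eq: "fixed_ends T U = (\<lambda>Or. rays_in T (lift Or)) ` Collect delta_end"
proof (intro equalityI subsetI)
  fix \<xi> assume "\<xi> \<in> fixed_ends T U"
  note e = fixed_end_delta_end[OF this]
  have "\<xi> = rays_in T (lift (piA ` arcs_towards T \<xi>))" using e(2,3) by simp
  then show "\<xi> \<in> (\<lambda>Or. rays_in T (lift Or)) ` Collect delta_end" using e(1) by blast
qed (use delta_end_fixed_end(1) in auto)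

lemma rays_in_lift_inj:
  assumes "delta_end Or" "delta_end Or'" "rays_in T (lift Or) = rays_in T (lift Or')" shows "Or = Or'"
proof (rule lift_inj[OF delta_end_arcs[OF assms(1)] delta_end_arcs[OF assms(2)]])
  show "lift Or = lift Or'"
    using delta_end_fixed_end(2)[OF assms(1)] delta_end_fixed_end(2)[OF assms(2)]
    unfolding assms(3) by (rule trans[OF sym])
qed

lemma lift_cotree:
  assumes C: "cotree \<Gamma> X C"
  shows "invariant_subtree T rvT U (T \<restriction> liftV (verts C))"
    "corresponds T piA (cotree_scopo T (T \<restriction> liftV (verts C))) (cotree_scopo \<Gamma> C)"
proof -
  note c = cotree_core_scopo[OF C]
  note sc = lift_core_scopo[OF c(1,3)] and f = lift_funnels[OF c(1,2)]
  obtain v where v: "v \<in> verts C" using c(5) by blast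
  then have "v \<in> piV ` verts T" using c(6) piV_surj by auto
  then have ne: "liftV (verts C) \<noteq> {}" using v by auto
  interpret A: core_scopo_graph T rvT "liftV (verts C)" "lift (cotree_scopo \<Gamma> C)"
    by (rule T.core_scopo_graphI[OF sc])
  show "corresponds T piA (cotree_scopo T (T \<restriction> liftV (verts C))) (cotree_scopo \<Gamma> C)"
    unfolding corresponds_def using A.cotree_scopo_eq[of "T \<restriction> liftV (verts C)"] f by simp
  have "subtree (T \<restriction> liftV (verts C)) T rvT" by (rule T.subtree_induce[OF ne sc f])
  moreover have "fst g ` liftV (verts C) = liftV (verts C) \<and>
      snd g ` arcs (T \<restriction> liftV (verts C)) = arcs (T \<restriction> liftV (verts C))" if g: "g \<in> U" for g
  proof -
    interpret g: tree_automorphism T rvT g by (rule automorphism[OF g])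
    have v: "fst g x \<in> liftV (verts C) \<longleftrightarrow> x \<in> liftV (verts C)" if "x \<in> verts T" for x
      using universal_groupD(2)[OF g that] bij_betw_apply[OF g.bij_verts that] that by simp
    have a: "snd g b \<in> arcs (T \<restriction> liftV (verts C)) \<longleftrightarrow> b \<in> arcs (T \<restriction> liftV (verts C))" if "b \<in> arcs T" for b
      using g.arc_image[OF that] g.tail_image[OF that] g.head_image[OF that]
        v[of "tail T b"] v[of "head T b"] that
        bij_betw_apply[OF g.bij_verts, of "tail T b"] bij_betw_apply[OF g.bij_verts, of "head T b"] by simp
    have "fst g ` liftV (verts C) = liftV (verts C)"
      by (rule bij_betw_invariant_image[OF g.bij_verts _ v]) auto
    moreover have "snd g ` arcs (T \<restriction> liftV (verts C)) = arcs (T \<restriction> liftV (verts C))"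
      by (rule bij_betw_invariant_image[OF g.bij_arcs _ a]) auto
    ultimately show ?thesis by blast
  qed
  ultimately show "invariant_subtree T rvT U (T \<restriction> liftV (verts C))"
    unfolding invariant_subtree_def by simp
qed

text \<open>
  Invariant subtrees descend to cotrees; with \<open>lift_cotree\<close> this gives a correspondence of the two.
\<close>

lemma invariant_core_scopo_cotree:
  assumes ne: "W \<noteq> {}" and sc: "core_scopo T rvT W OT" "funnels T W OT"
    and inv: "\<forall>g\<in>U. fst g ` W = W"
  shows "cotree \<Gamma> X (\<Gamma> \<restriction> piV ` W)" "W = liftV (piV ` W)" "OT = lift (piA ` OT)"
    "cotree_scopo \<Gamma> (\<Gamma> \<restriction> piV ` W) = piA ` OT"
proof -
  have "snd g b \<in> OT \<longleftrightarrow> b \<in> OT" if "g \<in> U" "b \<in> arcs T" for g b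
    using graph_automorphism.core_scopo_image_iff[OF _ sc bspec[OF inv that(1)] that(2)]
      tree_automorphism.axioms(2)[OF automorphism[OF that(1)]] by blast
  note d = descend_core_scopo[OF sc(1) this]
  have OT: "OT \<subseteq> arcs T" using sc(1) unfolding core_scopo_def by blast
  show "W = liftV (piV ` W)" "OT = lift (piA ` OT)" using d(3) d(4) by simp_all
  show "cotree \<Gamma> X (\<Gamma> \<restriction> piV ` W)" "cotree_scopo \<Gamma> (\<Gamma> \<restriction> piV ` W) = piA ` OT"
    using cotreeI[OF _ d(1) descend_funnels[OF OT sc(2)] d(2)] ne by auto
qed

lemma vertices_transitive:
  assumes "x \<in> verts T" "y \<in> verts T" "piV x = piV y" "x \<noteq> y"
  shows "\<exists>g\<in>U. fst g x = y"
proof -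
  obtain b where b: "b \<in> arcs T" "tail T b = x"
    using T.out_arc_exists[OF T.connected assms(1,2,4)] by blast
  obtain c where c: "c \<in> arcs T" "tail T c = y" "piA c = piA b"
    using lift_arc[of y "piA b"] piA_arcs[OF b(1)] tail_piA[OF b(1)] b assms by auto
  obtain g where g: "g \<in> U" "snd g b = c" using universal_group_transitive[of b c] b c by auto
  interpret g: tree_automorphism T rvT g by (rule automorphism[OF g(1)])
  show ?thesis using g g.tail_image[OF b(1)] b c by auto
qed

lemma fixed_vertex_iff: "x \<in> fixed_vertices T U \<longleftrightarrow> x \<in> verts T \<and> liftV {piV x} = {x}"
proof
  assume x: "x \<in> fixed_vertices T U"
  then have "x \<in> verts T" "\<And>g. g \<in> U \<Longrightarrow> fst g x = x" unfolding fixed_vertices_def by auto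
  moreover from this have "y = x" if "y \<in> verts T" "piV y = piV x" for y
    using vertices_transitive[of x y] that by metis
  ultimately show "x \<in> verts T \<and> liftV {piV x} = {x}" by auto
next
  assume x: "x \<in> verts T \<and> liftV {piV x} = {x}"
  have "fst g x = x" if g: "g \<in> U" for g
  proof -
    interpret g: tree_automorphism T rvT g by (rule automorphism[OF g])
    have "fst g x \<in> verts T" using g.bij_verts x by (auto simp: bij_betw_def)
    then have "fst g x \<in> liftV {piV x}" using universal_groupD(2)[OF g conjunct1[OF x]] by simp
    then show ?thesis using x by blast
  qed
  then show "x \<in> fixed_vertices T U" using x unfolding fixed_vertices_def by blast
qed

end

section \<open>Cycles\<close>

lemma periodic_shift:
  fixes c :: "nat \<Rightarrow> 'a"
  assumes "\<And>i. c (i + n) = c i" shows "c (i + k * n) = c i" "c (i mod n) = c i"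
proof -
  show *: "c (i + k * n) = c i" for i k
    by (induction k) (simp, metis add.assoc add.commute assms mult_Suc)
  show "c (i mod n) = c i" using *[of "i mod n" "i div n"] by (simp add: mult.commute)
qed

text \<open>
  A cycle as a periodic sequence without end, so that propagation of orientations can run around it.
\<close>

definition cyclic_seq :: "('v, 'a) pre_digraph \<Rightarrow> ('a \<Rightarrow> 'a) \<Rightarrow> nat \<Rightarrow> (nat \<Rightarrow> 'a) \<Rightarrow> bool" where
  "cyclic_seq G rv n c \<longleftrightarrow> n > 0 \<and> (\<forall>i. turn G rv (c i) (c (Suc i))) \<and> (\<forall>i. c (i + n) = c i)
     \<and> inj_on (\<lambda>i. tail G (c i)) {..<n}"

context rgraph
begin

lemma cyclic_seq_range:
  assumes "cyclic_seq G rv n c" shows "range c = c ` {..<n}"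
proof (intro equalityI subsetI)
  fix a assume "a \<in> range c"
  then obtain i where "a = c i" by blast
  then have "a = c (i mod n)" using periodic_shift(2)[of c n i] assms unfolding cyclic_seq_def by simp
  then show "a \<in> c ` {..<n}" using assms unfolding cyclic_seq_def by simp
qed blast

lemma awalk_nth:
  assumes "awalk u p v" "i < length p"
  shows "p ! i \<in> arcs G \<and> tail G (p ! i) = awalk_verts u p ! i \<and> head G (p ! i) = awalk_verts u p ! Suc i"
  using assms
proof (induction p arbitrary: u i)
  case (Cons a p)
  have w: "a \<in> arcs G" "awalk (head G a) p v" using Cons.prems by (auto simp: awalk_Cons_iff)
  have z: "awalk_verts (head G a) p ! 0 = head G a" using w(2)
    by (cases p) (auto simp: awalk_Cons_iff)
  show ?case
  proof (cases i)
    case 0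
    then show ?thesis using w z by simp
  next
    case (Suc j)
    then show ?thesis using Cons.IH[OF w(2), of j] Cons.prems by simp
  qed
qed simp

text \<open>
  In length at least three, turning back would repeat a vertex after two steps; lengths one and two
  are covered by the extra conditions on cycles.
\<close>

lemma graph_cycle_seq:
  assumes "graph_cycle G rv p"
  shows "\<exists>n c. cyclic_seq G rv n c \<and> range c = set p"
proof -
  define n where "n = length p"
  obtain u where u: "awalk u p u" "distinct (tl (awalk_verts u p))" "p \<noteq> []"
    using assms unfolding graph_cycle_def cycle_def by blast
  let ?vs = "awalk_verts u p"
  have n: "n > 0" using u(3) n_def by simp
  have len: "length ?vs = Suc n" using length_awalk_verts n_def by simp
  have dist: "i = j" if "?vs ! i = ?vs ! j" "0 < i" "i \<le> n" "0 < j" "j \<le> n" for i j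
  proof -
    have "tl ?vs ! (i - 1) = tl ?vs ! (j - 1)"
      using that len by (simp add: nth_tl)
    then have "i - 1 = j - 1"
      using u(2) that len by (subst (asm) nth_eq_iff_index_eq) auto
    then show ?thesis using that by simp
  qed
  have ends: "?vs ! 0 = u" "?vs ! n = u"
    using awhd_of_awalk[OF u(1)] awlast_of_awalk[OF u(1)] len
    by (auto simp: hd_conv_nth last_conv_nth)
  note nth = awalk_nth[OF u(1), folded n_def]
  define c where "c i = p ! (i mod n)" for i
  have cG: "c i \<in> arcs G" "tail G (c i) = ?vs ! (i mod n)" "head G (c i) = ?vs ! Suc (i mod n)" for i
    using nth[of "i mod n"] n unfolding c_def by auto
  have step: "Suc i mod n = (if Suc (i mod n) = n then 0 else Suc (i mod n))" for i
    by (simp add: mod_Suc)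
  have ht: "head G (c i) = tail G (c (Suc i))" for i
    using cG(3)[of i] cG(2)[of "Suc i"] step[of i] ends by auto
  have red: "c (Suc i) \<noteq> rv (c i)" for i
  proof
    assume eq: "c (Suc i) = rv (c i)"
    consider "n = 1" | "n = 2" | "n \<ge> 3" using n by linarith
    then show False
    proof cases
      case 1
      then have "rv (p ! 0) \<noteq> p ! 0" using assms unfolding graph_cycle_def n_def by blast
      then show False using eq 1 unfolding c_def by simp
    next
      case 2
      then have "p ! 1 \<noteq> rv (p ! 0)" using assms unfolding graph_cycle_def n_def by blast
      moreover have "p ! 0 \<noteq> rv (p ! 1)" using calculation rv_rv[of "p ! 1"] nth[of 1] 2 by auto
      moreover have "(i mod n = 0 \<and> Suc i mod n = 1) \<or> (i mod n = 1 \<and> Suc i mod n = 0)"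
        using 2 by presburger
      ultimately show False using eq unfolding c_def by auto
    next
      case 3
      have "head G (c (Suc i)) = tail G (c i)" using eq head_rv[OF cG(1)] by simp
      then have h: "?vs ! Suc (Suc i mod n) = ?vs ! (i mod n)"
        using cG(3)[of "Suc i"] cG(2)[of i] by simp
      have im: "i mod n < n" using n by simp
      show False
      proof (cases "Suc (i mod n) = n")
        case True
        then have "?vs ! 1 = ?vs ! (i mod n)" using h step[of i] by simp
        then have "1 = i mod n" by (rule dist) (use True 3 in auto)
        then show False using True 3 by simp
      next
        case False
        then have h2: "?vs ! Suc (Suc (i mod n)) = ?vs ! (i mod n)" using h step[of i] by simp
        show False
        proof (cases "i mod n = 0")
          case True
          then have "?vs ! 2 = ?vs ! n" using h2 ends by (simp add: numeral_2_eq_2)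
          then have "2 = n" by (rule dist) (use 3 in auto)
          then show False using 3 by simp
        next
          case nz: False
          have "Suc (Suc (i mod n)) = i mod n" using h2 by (rule dist) (use nz False im in auto)
          then show False by simp
        qed
      qed
    qed
  qed
  have "inj_on (\<lambda>i. tail G (c i)) {..<n}"
  proof (rule inj_onI)
    fix i j assume ij: "i \<in> {..<n}" "j \<in> {..<n}" "tail G (c i) = tail G (c j)"
    then have eq: "?vs ! i = ?vs ! j" using cG(2)[of i] cG(2)[of j] by simp
    show "i = j"
    proof (cases "i = 0 \<or> j = 0")
      case False
      then show ?thesis using dist[OF eq] ij by auto
    next
      case True
      have "k = 0" if "?vs ! n = ?vs ! k" "k < n" for k
        using dist[OF that(1)] that(2) by (cases "k = 0") auto
      then show ?thesis using True eq ends ij by auto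
    qed
  qed
  then have "cyclic_seq G rv n c"
    unfolding cyclic_seq_def turn_def using n cG(1) ht red by (simp add: c_def)
  moreover have "range c = set p"
    unfolding cyclic_seq_range[OF calculation] by (auto simp: c_def set_conv_nth n_def)
  ultimately show ?thesis by blast
qed

lemma seq_awalk:
  assumes "\<And>i. turn G rv (c i) (c (Suc i))"
  shows "awalk (tail G (c 0)) (map c [0..<n]) (tail G (c n))"
    "awalk_verts (tail G (c 0)) (map c [0..<n]) = map (\<lambda>i. tail G (c i)) [0..<Suc n]"
proof -
  have cG: "c i \<in> arcs G" "head G (c i) = tail G (c (Suc i))" for i
    using assms[of i] unfolding turn_def by auto
  show w: "awalk (tail G (c 0)) (map c [0..<n]) (tail G (c n))"
  proof (induction n)
    case 0
    then show ?case using cG by (simp add: awalk_Nil_iff)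
  next
    case (Suc n)
    have "awalk (tail G (c n)) [c n] (tail G (c (Suc n)))"
      using cG[of n] by (simp add: awalk_Cons_iff awalk_Nil_iff head_in_verts[OF cG(1), of n, unfolded cG(2)])
    then show ?case using Suc.IH by (auto intro: awalk_appendI)
  qed
  show "awalk_verts (tail G (c 0)) (map c [0..<n]) = map (\<lambda>i. tail G (c i)) [0..<Suc n]"
    unfolding awalk_verts_conv by (cases n) (auto simp: cG(2))
qed

lemma cyclic_seq_graph_cycle:
  assumes c: "cyclic_seq G rv n c"
  shows "graph_cycle G rv (map c [0..<n])"
proof -
  have n: "n > 0" and t: "\<And>i. turn G rv (c i) (c (Suc i))" and per: "\<And>i. c (i + n) = c i"
    and inj: "inj_on (\<lambda>i. tail G (c i)) {..<n}"
    using c unfolding cyclic_seq_def by auto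
  have cn: "c n = c 0" using per[of 0] by simp
  have "distinct (tl (map (\<lambda>i. tail G (c i)) [0..<Suc n]))"
  proof -
    have "tl [0..<Suc n] = [1..<Suc n]" by (simp add: upt_conv_Cons del: upt_Suc)
    then have "tl (map (\<lambda>i. tail G (c i)) [0..<Suc n]) = map (\<lambda>i. tail G (c i)) [1..<Suc n]"
      by (metis map_tl)
    moreover have "inj_on (\<lambda>i. tail G (c i)) (set [1..<Suc n])"
    proof (rule inj_onI)
      fix i j assume ij: "i \<in> set [1..<Suc n]" "j \<in> set [1..<Suc n]" "tail G (c i) = tail G (c j)"
      have m: "tail G (c (i mod n)) = tail G (c (j mod n))"
        using ij(3) periodic_shift(2)[of c n, OF per] by simp
      then have "i mod n = j mod n" using inj_onD[OF inj m] n by simp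
      then show "i = j" using ij by (cases "i = n"; cases "j = n") auto
    qed
    ultimately show ?thesis by (simp add: distinct_map del: upt_Suc)
  qed
  then have "cycle (map c [0..<n])"
    unfolding cycle_def using seq_awalk[of c n, OF t] n cn by (intro exI[of _ "tail G (c 0)"]) simp
  moreover have "rv (c 0) \<noteq> c 0" if "n = 1" using t[of 0] per[of 0] that unfolding turn_def by auto
  moreover have "c 1 \<noteq> rv (c 0)" using t[of 0] unfolding turn_def by auto
  ultimately show ?thesis unfolding graph_cycle_def using n by (auto simp: nth_map)
qed

lemma cyclic_seq_oriented:
  assumes c: "cyclic_seq G rv n c" and sc: "core_scopo G rv V Or" and "c i \<in> Or" shows "range c \<subseteq> Or"
proof -
  interpret A: core_scopo_graph G rv V Or by (rule core_scopo_graphI[OF sc])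
  have n: "n > 0" and t: "\<And>i. turn G rv (c i) (c (Suc i))" and per: "\<And>i. c (i + n) = c i"
    using c unfolding cyclic_seq_def by auto
  have "c j \<in> Or" for j
  proof -
    have "j \<le> i + j * n" using n by (metis Suc_leI le_add2 mult.right_neutral mult_le_mono2 order_trans One_nat_def)
    then have "(turn G rv)\<^sup>*\<^sup>* (c j) (c (i + j * n))" by (rule turns_seq[of G rv c, OF t])
    moreover have "c (i + j * n) = c i" by (rule periodic_shift(1)[of c n, OF per])
    ultimately show ?thesis using assms(3) turns_cases A.scopo_back_leads by metis
  qed
  then show ?thesis by blast
qed

text \<open>
  Runs through a periodic sequence backwards with natural numbers as indices: multiplication by
  \<open>n - 1\<close> is negation modulo \<open>n\<close>.
\<close>

lemma reversed_flow:
  assumes c: "cyclic_seq G rv n c"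
  defines "r \<equiv> \<lambda>i. rv (c (i * (n - 1)))"
  shows "head G (r i) = tail G (r (Suc i))" "r n = r 0" "range r = rv ` range c"
proof -
  have n: "n > 0" and t: "\<And>i. turn G rv (c i) (c (Suc i))" and per: "\<And>i. c (i + n) = c i"
    using c unfolding cyclic_seq_def by auto
  have cG: "c i \<in> arcs G" "head G (c i) = tail G (c (Suc i))" for i
    using t[of i] unfolding turn_def by auto
  have "c (Suc (Suc i * (n - 1))) = c (i * (n - 1) + n)"
    using n by (cases n) (simp_all add: algebra_simps)
  also have "\<dots> = c (i * (n - 1))" by (rule per)
  finally show "head G (r i) = tail G (r (Suc i))"
    unfolding r_def using head_rv[OF cG(1)] tail_rv[OF cG(1)] cG(2) by simp
  have "c (n * (n - 1)) = c (0 + (n - 1) * n)" by (simp add: mult.commute)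
  also have "\<dots> = c 0" by (rule periodic_shift(1)[of c n, OF per])
  finally show "r n = r 0" unfolding r_def by simp
  show "range r = rv ` range c"
  proof (intro equalityI subsetI)
    fix a assume "a \<in> rv ` range c"
    then obtain j where j: "a = rv (c j)" by blast
    have "c ((j * (n - 1)) * (n - 1)) = c j"
    proof (cases n)
      case (Suc m)
      show ?thesis
      proof (cases m)
        case 0
        have "c j = c (0 + j * n)" using Suc 0 by simp
        then show ?thesis using periodic_shift(1)[of c n 0 j, OF per] Suc 0 by simp
      next
        case (Suc k)
        have "(j * (n - 1)) * (n - 1) = j + (j * k) * n"
          using \<open>n = Suc m\<close> Suc by (simp add: algebra_simps)
        then show ?thesis using periodic_shift(1)[of c n j "j * k", OF per] by simp
      qed
    qed (use n in simp)
    then show "a \<in> range r" unfolding r_def using j by (metis rangeI)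
  qed (auto simp: r_def)
qed

text \<open>
  By propagation an orientation follows a cycle consistently in one of its two directions, and loops
  and double edges would be closed walks along the orientation as well.
\<close>

lemma is_treeI_orientation:
  assumes conn: "strongly_connected G"
    and total: "\<And>a. a \<in> arcs G \<Longrightarrow> a \<in> Or \<longleftrightarrow> rv a \<notin> Or" and OrG: "Or \<subseteq> arcs G"
    and sc: "core_scopo G rv V Or"
    and acyclic: "\<And>r n. n > 0 \<Longrightarrow> (\<And>i. r i \<in> Or \<and> head G (r i) = tail G (r (Suc i))) \<Longrightarrow> r n \<noteq> r 0"
  shows "is_tree G rv"
proof -
  interpret A: core_scopo_graph G rv V Or by (rule core_scopo_graphI[OF sc])
  have loopfree: "tail G a \<noteq> head G a" if a: "a \<in> arcs G" for a
  proof
    assume l: "tail G a = head G a"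
    have "b \<notin> Or" if "tail G b = head G b" for b
      using acyclic[of 1 "\<lambda>_. b"] that by auto
    then show False using total[OF a] l head_rv[OF a] tail_rv[OF a] by metis
  qed
  have multi: "a = b" if ab: "a \<in> arcs G" "b \<in> arcs G" "tail G a = tail G b" "head G a = head G b" for a b
  proof -
    have *: "False" if "c \<in> Or" "d \<in> Or" "tail G d = head G c" "head G d = tail G c" for c d
    proof -
      have fl: "(if even i then c else d) \<in> Or
          \<and> head G (if even i then c else d) = tail G (if even (Suc i) then c else d)" for i :: nat
        using that by simp
      show False using acyclic[of 2 "\<lambda>i. if even i then c else d", OF _ fl] by simp
    qed
    have **: "rv b \<notin> Or" if "a \<in> Or" "tail G a = tail G b" "head G a = head G b" "b \<in> arcs G" for a b
      using *[of a "rv b"] that head_rv[of b] tail_rv[of b] by auto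
    show ?thesis
    proof (cases "a \<in> Or")
      case True
      then have "b \<in> Or" using **[of a b] total[of b] ab by blast
      then show ?thesis using A.scopo_unique True ab by blast
    next
      case False
      then have ra: "rv a \<in> Or" using total[of a] ab by blast
      have "b \<notin> Or" using **[of b a] ra ab by auto
      then have "rv b \<in> Or" using total[of b] ab by blast
      then have "rv a = rv b" using A.scopo_unique[OF ra] tail_rv ab by simp
      then show ?thesis using rv_rv ab by metis
    qed
  qed
  have "\<not> graph_cycle G rv p" for p
  proof
    assume "graph_cycle G rv p"
    then obtain n c where c: "cyclic_seq G rv n c" using graph_cycle_seq by blast
    have n: "n > 0" and t: "\<And>i. turn G rv (c i) (c (Suc i))" and per: "\<And>i. c (i + n) = c i"
      using c unfolding cyclic_seq_def by auto
    have cG: "c i \<in> arcs G" "head G (c i) = tail G (c (Suc i))" for i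
      using t[of i] unfolding turn_def by auto
    show False
    proof (cases "\<exists>i. c i \<in> Or")
      case True
      then have "range c \<subseteq> Or" using cyclic_seq_oriented[OF c sc] by blast
      then have "c n \<noteq> c 0" using acyclic[of n c, OF n] cG(2) by blast
      then show False using per[of 0] by simp
    next
      case False
      then have "rv ` range c \<subseteq> Or" using total cG(1) by blast
      then have "rv (c (i * (n - 1))) \<in> Or" for i by blast
      then show False
        using acyclic[of n "\<lambda>i. rv (c (i * (n - 1)))", OF n] reversed_flow(1,2)[OF c] by simp
    qed
  qed
  moreover have "loopfree_digraph G" by unfold_locales (rule loopfree)
  moreover have "nomulti_digraph G" by unfold_locales (auto simp: arc_to_ends_def intro: multi)
  ultimately show ?thesis unfolding is_tree_def using conn rgraph_axioms by blast
qed

end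

section \<open>Fixed vertices and inversions\<close>

lemma (in tree_graph) edge_core_scopo:
  assumes c: "c \<in> arcs G"
  shows "\<exists>Or. core_scopo G rv {tail G c, head G c} Or \<and> funnels G {tail G c, head G c} Or"
proof -
  have stay: "head G a \<in> {tail G c, head G c}"
    if a: "a \<in> toward G (tail G c)" "tail G a \<in> {tail G c, head G c}" for a
  proof -
    interpret W: core_scopo_graph G rv "{tail G c}" "toward G (tail G c)"
      by (rule toward_graph) (use c in simp)
    have "tail G a = head G c" using W.scopo_tail[OF a(1)] a(2) by simp
    moreover have "rv c \<in> toward G (tail G c)"
      using in_toward_head[OF rv_in_arcs[OF c]] head_rv[OF c] by simp
    ultimately have "a = rv c" using W.scopo_unique a(1) tail_rv[OF c] by simp
    then show ?thesis using head_rv[OF c] by simp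
  qed
  have "{tail G c, head G c} \<subseteq> verts G" using c by simp
  from core_scopo_closed[OF insertI1 this stay] show ?thesis by blast
qed

context delta_action
begin

text \<open>
  Two arcs of the same fibre on a reduced walk that traverses both in their own direction produce a
  translation. Conversely a translation moves the arcs of its axis in this way.
\<close>

lemma translation_exists:
  assumes "leads T rvT b b'" "piA b = piA b'"
  shows "\<exists>g\<in>U. \<exists>l. translates T g l \<and> l 0 = b"
proof -
  have bb: "b \<in> arcs T" "b' \<in> arcs T" using T.leads_arcs[OF assms(1)] by auto
  obtain g where g: "g \<in> U" "snd g b = b'" using universal_group_transitive[OF bb assms(2)] by blast
  have "leads T rvT b (snd g b)" using assms(1) g(2) by simp
  then obtain l where "translates T g l" "l 0 = b"
    using tree_automorphism.leads_translates[OF automorphism[OF g(1)]] by blast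
  then show ?thesis using g(1) by blast
qed

lemma translation_leads:
  assumes "g \<in> U" "translates T g l"
  shows "leads T rvT (l i) (snd g (l i))" "piA (snd g (l i)) = piA (l i)"
proof -
  show "leads T rvT (l i) (snd g (l i))"
    using tree_automorphism.translates_leads[OF automorphism[OF assms(1)] assms(2)] by blast
  have "l i \<in> arcs T" using assms(2) unfolding translates_def line_def by blast
  then show "piA (snd g (l i)) = piA (l i)" using universal_groupD(3)[OF assms(1)] by blast
qed

lemma translation_core_infinite:
  assumes g: "g \<in> U" "translates T g l" and sc: "core_scopo T rvT W OT" "funnels T W OT" and W: "fst g ` W = W"
  shows "infinite W"
proof -
  have "range (\<lambda>i. tail T (l i)) \<subseteq> W"
    using tree_automorphism.translation_in_core[OF automorphism[OF g(1)] g(2) sc W] by blast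
  moreover have "inj (\<lambda>i. tail T (l i))" using g(2) unfolding translates_def line_def by blast
  ultimately show ?thesis by (meson infinite_super infinite_UNIV_int range_inj_infinite finite_imageD)
qed

lemma fixed_vertex_no_translation:
  assumes "fixed_vertex_type T U" shows "\<not> has_translation T U"
proof
  assume "has_translation T U"
  then obtain g l where gl: "g \<in> U" "translates T g l" unfolding has_translation_def by blast
  obtain x where x: "x \<in> verts T" "fst g x = x"
    using assms gl(1) unfolding fixed_vertex_type_def fixed_vertices_def by blast
  have "infinite {x}"
    by (rule translation_core_infinite[OF gl T.toward_core_scopo[OF x(1)] T.toward_funnels[OF x(1)]])
      (use x in simp)
  then show False by simp
qed

text \<open>
  The orientation towards \<open>x\<close> descends to one towards the image of \<open>x\<close>. A loop there would lift to an
  arc from \<open>x\<close> to another vertex of the fibre of \<open>x\<close>, but a fixed vertex is alone in its fibre.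
\<close>

lemma fixed_vertex_cotree:
  assumes x: "x \<in> fixed_vertices T U"
  shows "single_vertex_cotree \<Gamma> X (\<Gamma> \<restriction> {piV x})" "is_tree \<Gamma> rv"
    "corresponds T piA (cotree_scopo T (T \<restriction> {x})) (cotree_scopo \<Gamma> (\<Gamma> \<restriction> {piV x}))"
proof -
  have xT: "x \<in> verts T" and inv: "\<forall>g\<in>U. fst g ` {x} = {x}"
    using x unfolding fixed_vertices_def by auto
  have lx: "liftV {piV x} = {x}" using fixed_vertex_iff x by blast
  note c = invariant_core_scopo_cotree[OF _ T.toward_core_scopo[OF xT] T.toward_funnels[OF xT] inv]
  have c1: "cotree \<Gamma> X (\<Gamma> \<restriction> {piV x})" using c(1) by simp
  have c4: "cotree_scopo \<Gamma> (\<Gamma> \<restriction> {piV x}) = piA ` toward T x" using c(4) by simp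
  show "corresponds T piA (toward T x) (cotree_scopo \<Gamma> (\<Gamma> \<restriction> {piV x}))"
    unfolding corresponds_def c4 using c(3) by simp
  show "single_vertex_cotree \<Gamma> X (\<Gamma> \<restriction> {piV x})" unfolding single_vertex_cotree_def using c1 by simp
  let ?O = "piA ` toward T x"
  have sc: "core_scopo \<Gamma> rv {piV x} ?O" and fn: "funnels \<Gamma> {piV x} ?O"
    using cotree_core_scopo(1,2)[OF c1] c4 by simp_all
  interpret A: core_scopo_graph \<Gamma> rv "{piV x}" ?O by (rule core_scopo_graphI[OF sc])
  show "is_tree \<Gamma> rv"
  proof (rule is_treeI_orientation[OF conn _ _ sc])
    show "?O \<subseteq> arcs \<Gamma>" using A.scopo_arcs by blast
    fix a assume a: "a \<in> arcs \<Gamma>"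
    have "tail \<Gamma> a \<notin> {piV x} \<or> head \<Gamma> a \<notin> {piV x}"
    proof (rule ccontr)
      assume "\<not> ?thesis"
      then have l: "tail \<Gamma> a = piV x" "head \<Gamma> a = piV x" by auto
      obtain b where b: "b \<in> arcs T" "tail T b = x" "piA b = a" using lift_arc[OF xT a l(1)] by blast
      have "head T b \<in> liftV {piV x}" using head_piA[OF b(1)] b l by simp
      then have "head T b = x" using lx by blast
      then show False using T.no_loops[OF b(1)] b(2) by simp
    qed
    then show "a \<in> ?O \<longleftrightarrow> rv a \<notin> ?O" using A.scopo_rv_iff[OF a] by blast
  next
    fix r :: "nat \<Rightarrow> 'a" and n
    assume "\<And>i. r i \<in> ?O \<and> head \<Gamma> (r i) = tail \<Gamma> (r (Suc i))"
    then show "r n \<noteq> r 0" using A.funnels_no_flow[of r] fn by blast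
  qed
qed

text \<open>
  The vertices above a single vertex cotree span a subtree. Without loops in \<open>\<Gamma>\<close> this subtree has no
  arcs, hence only one vertex.
\<close>

lemma single_vertex_cotree_lift:
  assumes tr: "is_tree \<Gamma> rv" and C: "single_vertex_cotree \<Gamma> X C"
  shows "\<exists>x\<in>fixed_vertices T U. liftV (verts C) = {x} \<and> C = \<Gamma> \<restriction> {piV x}"
proof -
  interpret \<Gamma>: tree_graph \<Gamma> rv by (rule tree_graphI[OF tr])
  obtain v where v: "verts C = {v}" and ct: "cotree \<Gamma> X C" using C unfolding single_vertex_cotree_def by blast
  let ?W = "liftV (verts C)"
  have st: "subtree (T \<restriction> ?W) T rvT" using lift_cotree(1)[OF ct] unfolding invariant_subtree_def by blast
  interpret S: tree_graph "T \<restriction> ?W" rvT using st tree_graphI unfolding subtree_def by blast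
  have noarc: "arcs (T \<restriction> ?W) = {}"
  proof (rule ccontr)
    assume "arcs (T \<restriction> ?W) \<noteq> {}"
    then obtain b where b: "b \<in> arcs T" "piV (tail T b) = v" "piV (head T b) = v"
      using v by auto
    then show False using \<Gamma>.no_loops[OF piA_arcs[OF b(1)]] tail_piA[OF b(1)] head_piA[OF b(1)] by simp
  qed
  obtain x where x: "x \<in> ?W" using S.connected unfolding strongly_connected_def by auto
  have "y = x" if y: "y \<in> ?W" for y
    using S.out_arc_exists[OF S.connected, of y x] x y noarc by fastforce
  then have W: "?W = {x}" using x by blast
  have px: "piV x = v" "x \<in> verts T" using x v by auto
  then have "x \<in> fixed_vertices T U" using fixed_vertex_iff W v by simp
  moreover have "C = \<Gamma> \<restriction> {piV x}" using cotree_core_scopo(4)[OF ct] v px by simp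
  ultimately show ?thesis using W by blast
qed

theorem fixed_vertex_type_iff:
  "fixed_vertex_type T U \<longleftrightarrow> is_tree \<Gamma> rv \<and> (\<exists>C. single_vertex_cotree \<Gamma> X C)"
proof
  assume "fixed_vertex_type T U"
  then obtain x where "x \<in> fixed_vertices T U" unfolding fixed_vertex_type_def by auto
  then show "is_tree \<Gamma> rv \<and> (\<exists>C. single_vertex_cotree \<Gamma> X C)"
    using fixed_vertex_cotree(1,2)[of x] by blast
next
  assume "is_tree \<Gamma> rv \<and> (\<exists>C. single_vertex_cotree \<Gamma> X C)"
  then obtain C where "is_tree \<Gamma> rv" "single_vertex_cotree \<Gamma> X C" by blast
  from single_vertex_cotree_lift[OF this] show "fixed_vertex_type T U"
    unfolding fixed_vertex_type_def by auto
qed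

lemma cotree_corresponds_unique:
  assumes "cotree \<Gamma> X C" "cotree \<Gamma> X C'"
    "corresponds T piA OT (cotree_scopo \<Gamma> C)" "corresponds T piA OT (cotree_scopo \<Gamma> C')"
  shows "C = C'"
proof (rule cotree_eqI)
  show "graph_cotree \<Gamma> C" "graph_cotree \<Gamma> C'" using assms(1,2) unfolding cotree_def by auto
  show "cotree_scopo \<Gamma> C = cotree_scopo \<Gamma> C'"
    by (rule lift_inj) (use assms(3,4) in \<open>auto simp: corresponds_def cotree_scopo_def\<close>)
qed

lemma fixed_vertices_one_to_one:
  assumes "fixed_vertex_type T U"
  shows "one_to_one (fixed_vertices T U) {C. single_vertex_cotree \<Gamma> X C}
    (\<lambda>x C. corresponds T piA (cotree_scopo T (T \<restriction> {x})) (cotree_scopo \<Gamma> C))"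
  unfolding one_to_one_def
proof (intro conjI ballI)
  have tr: "is_tree \<Gamma> rv" using assms fixed_vertex_type_iff by blast
  fix x assume x: "x \<in> fixed_vertices T U"
  show "\<exists>!C. C \<in> {C. single_vertex_cotree \<Gamma> X C} \<and> corresponds T piA (toward T x) (cotree_scopo \<Gamma> C)"
  proof (rule ex1I[of _ "\<Gamma> \<restriction> {piV x}"])
    show "\<Gamma> \<restriction> {piV x} \<in> {C. single_vertex_cotree \<Gamma> X C} \<and> corresponds T piA (toward T x) (cotree_scopo \<Gamma> (\<Gamma> \<restriction> {piV x}))"
      using fixed_vertex_cotree[OF x] by simp
    fix C assume "C \<in> {C. single_vertex_cotree \<Gamma> X C} \<and> corresponds T piA (toward T x) (cotree_scopo \<Gamma> C)"
    then show "C = \<Gamma> \<restriction> {piV x}"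
      using cotree_corresponds_unique[of C "\<Gamma> \<restriction> {piV x}" "toward T x"] fixed_vertex_cotree[OF x]
      unfolding single_vertex_cotree_def by simp
  qed
next
  have tr: "is_tree \<Gamma> rv" using assms fixed_vertex_type_iff by blast
  fix C assume "C \<in> {C. single_vertex_cotree \<Gamma> X C}"
  then obtain x where x: "x \<in> fixed_vertices T U" "C = \<Gamma> \<restriction> {piV x}"
    using single_vertex_cotree_lift[OF tr] by blast
  show "\<exists>!x. x \<in> fixed_vertices T U \<and> corresponds T piA (toward T x) (cotree_scopo \<Gamma> C)"
  proof (rule ex1I[of _ x])
    show "x \<in> fixed_vertices T U \<and> corresponds T piA (toward T x) (cotree_scopo \<Gamma> C)"
      using x fixed_vertex_cotree(3) by simp
    fix y assume y: "y \<in> fixed_vertices T U \<and> corresponds T piA (toward T y) (cotree_scopo \<Gamma> C)"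
    have xy: "x \<in> verts T" "y \<in> verts T" using x y unfolding fixed_vertices_def by auto
    have "toward T y = toward T x"
      using y x fixed_vertex_cotree(3)[OF x(1)] unfolding corresponds_def by simp
    then have "T \<restriction> {y} = T \<restriction> {x}"
      using T.cotree_eqI[OF T.graph_cotree_vertex[OF xy(2)] T.graph_cotree_vertex[OF xy(1)]] by blast
    then have "verts (T \<restriction> {y}) = verts (T \<restriction> {x})" by simp
    then show "y = x" by simp
  qed
qed

lemma preserved_edgeE:
  assumes "e \<in> preserved_edges T rvT U"
  obtains b where "b \<in> arcs T" "e = {b, rvT b}" "tail T ` e = {tail T b, head T b}"
    "\<forall>g\<in>U. fst g ` {tail T b, head T b} = {tail T b, head T b}"
proof -
  obtain b where b: "b \<in> arcs T" "e = {b, rvT b}" and inv: "\<forall>g\<in>U. snd g ` e = e"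
    using assms unfolding preserved_edges_def edges_def by blast
  have te: "tail T ` e = {tail T b, head T b}" using b T.tail_rv by simp
  have eT: "e \<subseteq> arcs T" using b T.rv_in_arcs by simp
  have "fst g ` (tail T ` e) = tail T ` e" if g: "g \<in> U" for g
    using graph_automorphism.tails_image[OF _ eT, of rvT g] tree_automorphism.axioms(2)[OF automorphism[OF g]]
      bspec[OF inv g] by simp
  then have "\<forall>g\<in>U. fst g ` {tail T b, head T b} = {tail T b, head T b}" unfolding te by (rule ballI)
  then show ?thesis by (rule that[OF b te])
qed

text \<open>
  The orientation towards a preserved edge is invariant under the inversion of \<open>b\<close>, so it contains
  neither \<open>b\<close> nor its reverse. Hence both ends of \<open>b\<close> lie on the preserved edge.
\<close>

lemma inverted_edge_unique:
  assumes b: "b \<in> arcs T" and pres: "{b, rvT b} \<in> preserved_edges T rvT U"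
    and g: "g \<in> U" "snd g b = rvT b"
  shows "preserved_edges T rvT U = {{b, rvT b}}" "{b, rvT b} \<in> inverted_edges T rvT U"
proof -
  interpret g: tree_automorphism T rvT g by (rule automorphism[OF g(1)])
  have "snd g (rvT b) = b" using g.rv_image[OF b] g(2) T.rv_rv[OF b] by simp
  then show "{b, rvT b} \<in> inverted_edges T rvT U"
    unfolding inverted_edges_def using pres g T.rv_rv[OF b] by auto
  have "e = {b, rvT b}" if e: "e \<in> preserved_edges T rvT U" for e
  proof -
    obtain c where c: "c \<in> arcs T" "e = {c, rvT c}"
      and "\<forall>g\<in>U. fst g ` {tail T c, head T c} = {tail T c, head T c}"
      using e by (rule preserved_edgeE)
    then have gW: "fst g ` {tail T c, head T c} = {tail T c, head T c}" using g(1) by blast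
    obtain Or where sc: "core_scopo T rvT {tail T c, head T c} Or" "funnels T {tail T c, head T c} Or"
      using T.edge_core_scopo[OF c(1)] by blast
    interpret A: core_scopo_graph T rvT "{tail T c, head T c}" Or by (rule T.core_scopo_graphI[OF sc(1)])
    have "rvT b \<in> Or \<longleftrightarrow> b \<in> Or" using g.core_scopo_image_iff[OF sc gW b] g(2) by simp
    then have "tail T b \<in> {tail T c, head T c}" "head T b \<in> {tail T c, head T c}"
      using A.scopo_rv_iff[OF b] by blast+
    moreover have "tail T b \<noteq> head T b" "tail T c \<noteq> head T c" using T.no_loops b c by auto
    ultimately have "(tail T b = tail T c \<and> head T b = head T c) \<or> (tail T b = tail T (rvT c) \<and> head T b = head T (rvT c))"
      using T.tail_rv[OF c(1)] T.head_rv[OF c(1)] by auto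
    then have "b = c \<or> b = rvT c"
      using T.no_multi_arcs[of b c] T.no_multi_arcs[of b "rvT c"] b c(1) T.rv_in_arcs[OF c(1)]
      unfolding arc_to_ends_def by blast
    then show ?thesis using c T.rv_rv[OF c(1)] by auto
  qed
  then show "preserved_edges T rvT U = {{b, rvT b}}" using pres by blast
qed

text \<open>
  The two ends of an inverted edge form a fibre, and the fibre of the inverted arc has no second
  element at its tail because the edge is the only one between its ends.
\<close>

lemma inversion_type_cotree:
  assumes "inversion_type T rvT U" shows "\<exists>C. inversion_cotree \<Gamma> rv X C"
proof -
  obtain e where e: "e \<in> inverted_edges T rvT U" using assms unfolding inversion_type_def by blast
  then have "e \<in> preserved_edges T rvT U" unfolding inverted_edges_def by blast
  then obtain b where b: "b \<in> arcs T" "e = {b, rvT b}"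
    and inv: "\<forall>g\<in>U. fst g ` {tail T b, head T b} = {tail T b, head T b}" by (rule preserved_edgeE)
  obtain g where g: "g \<in> U" "snd g b = rvT b" using e b unfolding inverted_edges_def by blast
  let ?W = "{tail T b, head T b}"
  obtain Or where sc: "core_scopo T rvT ?W Or" "funnels T ?W Or"
    using T.edge_core_scopo[OF b(1)] by blast
  note c = invariant_core_scopo_cotree[OF _ sc inv]
  interpret g: tree_automorphism T rvT g by (rule automorphism[OF g(1)])
  have rvb: "rv (piA b) = piA b"
    using universal_groupD(3)[OF g(1) b(1)] g(2) piA_rvT[OF b(1)] by simp
  let ?v = "piV (tail T b)"
  have v: "piV (head T b) = ?v"
    using head_piA[OF b(1)] tail_piA[OF b(1)] tail_rv[OF piA_arcs[OF b(1)]] rvb by simp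
  then have pW: "piV ` ?W = {?v}" by auto
  have lW: "?W = liftV {?v}" using c(2) unfolding pW by simp
  have only: "d = b" if d: "d \<in> arcs T" "tail T d = tail T b" "head \<Gamma> (piA d) = ?v" for d
  proof -
    have "head T d \<in> ?W" unfolding lW using head_piA[OF d(1)] d by simp
    then have "head T d = head T b" using T.no_loops[OF d(1)] d(2) by auto
    then show ?thesis using T.no_multi_arcs[of d b] d b unfolding arc_to_ends_def by simp
  qed
  have C: "cotree \<Gamma> X (\<Gamma> \<restriction> {?v})" using c(1) unfolding pW by simp
  moreover have "arcs (\<Gamma> \<restriction> {?v}) = {piA b}"
  proof (intro equalityI subsetI)
    fix a assume a: "a \<in> arcs (\<Gamma> \<restriction> {?v})"
    then obtain d where d: "d \<in> arcs T" "tail T d = tail T b" "piA d = a"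
      using lift_arc[of "tail T b" a] b by auto
    then show "a \<in> {piA b}" using only[of d] a by simp
  qed (use piA_arcs[OF b(1)] tail_piA[OF b(1)] head_piA[OF b(1)] v in simp)
  moreover have "card (X (piA b)) = 1"
  proof -
    have "c = L b" if c: "c \<in> X (piA b)" for c
    proof -
      obtain d where d: "d \<in> arcs T" "tail T d = tail T b" "piA d = piA b" "L d = c"
        using colour_exists[of "tail T b" "piA b" c] b piA_arcs tail_piA c by auto
      then have "d = b" using only[of d] head_piA[OF b(1)] v by simp
      then show ?thesis using d by simp
    qed
    then have "X (piA b) = {L b}" using colour_in[OF b(1)] by blast
    then show ?thesis by simp
  qed
  ultimately show ?thesis unfolding inversion_cotree_def using rvb by (intro exI[of _ "\<Gamma> \<restriction> {?v}"]) auto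
qed

text \<open>
  In the subtree above the cotree exactly one arc leaves each vertex, so the subtree is a single
  edge. Transitivity on the fibre of its arcs provides the inversion.
\<close>

lemma inversion_cotree_edge:
  assumes C: "inversion_cotree \<Gamma> rv X C"
  shows "\<exists>e. preserved_edges T rvT U = {e} \<and> e \<in> inverted_edges T rvT U \<and> liftV (verts C) = tail T ` e"
proof -
  obtain v a where ct: "cotree \<Gamma> X C" and v: "verts C = {v}" and a: "arcs C = {a}" "rv a = a" "card (X a) = 1"
    using C unfolding inversion_cotree_def by blast
  note cc = cotree_core_scopo[OF ct]
  let ?W = "liftV (verts C)" and ?S = "T \<restriction> liftV (verts C)"
  have "arcs C = arcs (\<Gamma> \<restriction> verts C)" by (rule arg_cong[OF cc(4)])
  moreover have "arcs (\<Gamma> \<restriction> verts C) = {a \<in> arcs \<Gamma>. tail \<Gamma> a = v \<and> head \<Gamma> a = v}"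
    unfolding v by auto
  ultimately have arcsC: "arcs C = {a \<in> arcs \<Gamma>. tail \<Gamma> a = v \<and> head \<Gamma> a = v}" by (rule trans)
  have aG: "a \<in> arcs \<Gamma>" "tail \<Gamma> a = v" "head \<Gamma> a = v" using a arcsC by auto
  have a_only: "a' = a" if "a' \<in> arcs \<Gamma>" "tail \<Gamma> a' = v" "head \<Gamma> a' = v" for a'
    using that a arcsC by auto
  have st: "subtree ?S T rvT" using lift_cotree(1)[OF ct] unfolding invariant_subtree_def by blast
  interpret S: tree_graph ?S rvT using st tree_graphI unfolding subtree_def by blast
  obtain c0 where c0: "X a = {c0}" using a(3) by (meson card_1_singletonE)
  have over: "d = b" if "d \<in> arcs T" "b \<in> arcs T" "tail T d = tail T b" "piA d = a" "piA b = a" for b d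
    using colour_in[OF that(1)] colour_in[OF that(2)] colour_inj[OF that(1-3)] that(4,5) c0 by simp
  obtain x where x: "x \<in> ?W" using S.connected unfolding strongly_connected_def by auto
  obtain b where b: "b \<in> arcs T" "tail T b = x" "piA b = a" using lift_arc[of x a] x v aG by auto
  have hb: "head T b \<in> ?W" using head_piA[OF b(1)] b aG v by simp
  have rb: "rvT b \<in> arcs T" "tail T (rvT b) = head T b" "head T (rvT b) = x" "piA (rvT b) = a"
    using T.rv_in_arcs[OF b(1)] T.tail_rv[OF b(1)] T.head_rv[OF b(1)] piA_rvT[OF b(1)] b a by auto
  have W: "?W = {x, head T b}"
  proof (intro equalityI subsetI)
    fix y assume y: "y \<in> ?W"
    show "y \<in> {x, head T b}"
    proof (rule S.connected_induct[OF S.connected, where u = x and P = "\<lambda>z. z \<in> {x, head T b}"])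
      fix d assume d: "d \<in> arcs ?S" "tail ?S d \<in> {x, head T b}"
      have dT: "d \<in> arcs T" "piA d = a"
        using d(1) a_only[of "piA d"] piA_arcs tail_piA[of d] head_piA[of d] v by auto
      have "d = b \<or> d = rvT b" using d(2) over[OF dT(1) b(1)] over[OF dT(1) rb(1)] dT b rb by auto
      then show "head ?S d \<in> {x, head T b}" using rb by auto
    next
      show "x \<in> verts ?S" "y \<in> verts ?S" using x y by simp_all
    qed simp
  next
    fix y assume "y \<in> {x, head T b}"
    then show "y \<in> ?W" using x hb by blast
  qed
  let ?e = "{b, rvT b}"
  have te: "tail T ` ?e = ?W" using W b rb by simp
  have "snd h ` ?e = ?e" if h: "h \<in> U" for h
  proof -
    interpret h: tree_automorphism T rvT h by (rule automorphism[OF h])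
    have hbT: "snd h b \<in> arcs T" "piA (snd h b) = a"
      using h.arc_image[OF b(1)] universal_groupD(3)[OF h b(1)] b by auto
    have "tail T (snd h b) \<in> ?W"
      using hbT tail_piA[OF hbT(1)] aG v by simp
    then have "snd h b = b \<or> snd h b = rvT b"
      using over[OF hbT(1) b(1)] over[OF hbT(1) rb(1)] hbT b rb W by auto
    then show ?thesis using h.rv_image[OF b(1)] T.rv_rv[OF b(1)] by auto
  qed
  then have pres: "?e \<in> preserved_edges T rvT U"
    unfolding preserved_edges_def edges_def using b by blast
  obtain g where g: "g \<in> U" "snd g b = rvT b"
    using universal_group_transitive[OF b(1) rb(1)] b rb by auto
  show ?thesis using inverted_edge_unique[OF b(1) pres g] te by (intro exI[of _ ?e]) simp
qed

theorem inversion_type_iff: "inversion_type T rvT U \<longleftrightarrow> (\<exists>C. inversion_cotree \<Gamma> rv X C)"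
proof
  assume "\<exists>C. inversion_cotree \<Gamma> rv X C"
  then obtain C where "inversion_cotree \<Gamma> rv X C" by blast
  from inversion_cotree_edge[OF this] show "inversion_type T rvT U"
    unfolding inversion_type_def by (elim exE conjE) (intro exI conjI)
qed (rule inversion_type_cotree)

lemma liftV_inj:
  assumes "V \<subseteq> verts \<Gamma>" "V' \<subseteq> verts \<Gamma>" "liftV V = liftV V'" shows "V = V'"
proof -
  have "piV ` liftV V = V" if "V \<subseteq> verts \<Gamma>" for V
  proof (intro equalityI subsetI)
    fix v assume "v \<in> V"
    then have "v \<in> piV ` verts T" using that piV_surj by auto
    then show "v \<in> piV ` liftV V" using \<open>v \<in> V\<close> by auto
  qed auto
  from this[OF assms(1)] this[OF assms(2)] assms(3) show ?thesis by metis
qed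

lemma inversion_cotree_unique:
  assumes "inversion_cotree \<Gamma> rv X C" "inversion_cotree \<Gamma> rv X C'" shows "C = C'"
proof -
  have ct: "cotree \<Gamma> X C" "cotree \<Gamma> X C'" using assms unfolding inversion_cotree_def by auto
  obtain e where e: "preserved_edges T rvT U = {e}" "liftV (verts C) = tail T ` e"
    using inversion_cotree_edge[OF assms(1)] by (elim exE conjE)
  obtain e' where e': "preserved_edges T rvT U = {e'}" "liftV (verts C') = tail T ` e'"
    using inversion_cotree_edge[OF assms(2)] by (elim exE conjE)
  have "e = e'" using e(1) e'(1) by (metis singleton_inject)
  then have "liftV (verts C) = liftV (verts C')" using e(2) e'(2) by (metis (no_types))
  then have "verts C = verts C'"
    by (rule liftV_inj[OF cotree_core_scopo(6)[OF ct(1)] cotree_core_scopo(6)[OF ct(2)]])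
  then show ?thesis using cotree_core_scopo(4)[OF ct(1)] cotree_core_scopo(4)[OF ct(2)] by metis
qed

lemma inverted_edge_corresponds:
  assumes "e \<in> inverted_edges T rvT U" "inversion_cotree \<Gamma> rv X C"
  shows "corresponds T piA (cotree_scopo T (T \<restriction> (tail T ` e))) (cotree_scopo \<Gamma> C)"
proof -
  obtain e' where e': "preserved_edges T rvT U = {e'}" "liftV (verts C) = tail T ` e'"
    using inversion_cotree_edge[OF assms(2)] by blast
  then have "e = e'" using assms(1) unfolding inverted_edges_def by blast
  then show ?thesis
    using lift_cotree(2)[of C] assms(2) e'(2) unfolding inversion_cotree_def by simp
qed

end

section \<open>Cyclic cotrees and fixed ends\<close>

lemma (in rgraph) cyclic_orientation_iff: "cyclic_orientation G rv Or \<longleftrightarrow> core_scopo G rv {} Or"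
proof
  assume c: "cyclic_orientation G rv Or"
  then have arcs: "arcs G = Or \<union> rv ` Or" and disj: "Or \<inter> rv ` Or = {}"
    unfolding cyclic_orientation_def by auto
  have "a \<in> Or \<longleftrightarrow> rv a \<notin> Or" if a: "a \<in> arcs G" for a
  proof
    assume "a \<in> Or" then show "rv a \<notin> Or" using disj by blast
  next
    assume na: "rv a \<notin> Or"
    show "a \<in> Or"
    proof (rule ccontr)
      assume "a \<notin> Or"
      then obtain b where b: "b \<in> Or" "a = rv b" using a arcs by blast
      then have "rv a = b" using rv_rv arcs by blast
      then show False using na b by blast
    qed
  qed
  moreover have "\<exists>!a. a \<in> Or \<and> tail G a = v" if "v \<in> verts G" for v
  proof -
    have eq: "a \<in> out_arcs G v \<inter> Or \<longleftrightarrow> a \<in> Or \<and> tail G a = v" for a using arcs by auto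
    have "\<exists>!a. a \<in> out_arcs G v \<inter> Or" 
      using c that unfolding cyclic_orientation_def by (elim conjE) (erule bspec)
    then show ?thesis unfolding eq .
  qed
  ultimately show "core_scopo G rv {} Or" using arcs unfolding core_scopo_def by blast
next
  assume sc: "core_scopo G rv {} Or"
  interpret A: core_scopo_graph G rv "{}" Or by (rule core_scopo_graphI[OF sc])
  have "arcs G = Or \<union> rv ` Or"
  proof (intro equalityI subsetI)
    fix a assume a: "a \<in> arcs G"
    then have "a \<in> Or \<or> rv a \<in> Or" using A.scopo_rv_iff by blast
    then show "a \<in> Or \<union> rv ` Or" using rv_rv[OF a] by (metis UnI1 UnI2 image_eqI)
  qed (use A.scopo_arcs rv_in_arcs in auto)
  moreover have "Or \<inter> rv ` Or = {}" using A.scopo_rv_notin by blast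
  moreover have "\<exists>!a. a \<in> out_arcs G v \<inter> Or" if v: "v \<in> verts G" for v
  proof -
    obtain a where a: "a \<in> Or" "tail G a = v" using A.scopo_out[OF v] by auto
    show ?thesis
    proof (rule ex1I[of _ a])
      show "a \<in> out_arcs G v \<inter> Or" using a A.scopo_arcs by simp
    next
      fix b assume "b \<in> out_arcs G v \<inter> Or"
      then show "b = a" using a A.scopo_unique[of b a] by simp
    qed
  qed
  ultimately show "cyclic_orientation G rv Or" unfolding cyclic_orientation_def by blast
qed

lemma cyclic_graph_seq:
  assumes "cyclic_graph C rv"
  shows "rgraph C rv" "\<exists>n c. cyclic_seq C rv n c \<and> verts C = tail C ` range c \<and> arcs C = range c \<union> rv ` range c"
proof -
  obtain p where p: "graph_cycle C rv p" "verts C = tail C ` set p" "arcs C = set p \<union> rv ` set p"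
    using assms unfolding cyclic_graph_def by blast
  show rg: "rgraph C rv" using assms unfolding cyclic_graph_def by blast
  show "\<exists>n c. cyclic_seq C rv n c \<and> verts C = tail C ` range c \<and> arcs C = range c \<union> rv ` range c"
    using rgraph.graph_cycle_seq[OF rg p(1)] p(2,3) by (metis (no_types))
qed

lemma (in rgraph) cyclic_seq_tail:
  assumes c: "cyclic_seq G rv n c" and eq: "tail G (c i) = tail G (c j)" shows "c (i + k) = c (j + k)"
proof -
  have n: "n > 0" and per: "\<And>i. c (i + n) = c i" and inj: "inj_on (\<lambda>i. tail G (c i)) {..<n}"
    using c unfolding cyclic_seq_def by auto
  note md = periodic_shift(2)[of c n, OF per]
  have "tail G (c (i mod n)) = tail G (c (j mod n))" using eq md by simp
  then have "i mod n = j mod n" using inj_onD[OF inj] n by simp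
  then have "(i + k) mod n = (j + k) mod n" by (metis mod_add_left_eq)
  then show ?thesis using md[of "i + k"] md[of "j + k"] by simp
qed

text \<open>
  The arcs of a cycle form one cyclic orientation, their reverses another one.
\<close>

lemma cyclic_orientation_exists:
  assumes "cyclic_graph C rv"
  shows "\<exists>Or. cyclic_orientation C rv Or \<and> cyclic_orientation C rv (rv ` Or) \<and> Or \<noteq> rv ` Or"
proof -
  interpret rgraph C rv by (rule cyclic_graph_seq(1)[OF assms])
  obtain n c where c: "cyclic_seq C rv n c" and vC: "verts C = tail C ` range c"
    and aC: "arcs C = range c \<union> rv ` range c"
    using cyclic_graph_seq(2)[OF assms] by blast
  have n: "n > 0" and t: "\<And>i. turn C rv (c i) (c (Suc i))" and per: "\<And>i. c (i + n) = c i"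
    using c unfolding cyclic_seq_def by auto
  have cG: "c i \<in> arcs C" "head C (c i) = tail C (c (Suc i))" for i
    using t[of i] unfolding turn_def by auto
  have disj: "range c \<inter> rv ` range c = {}"
  proof (rule ccontr)
    assume "range c \<inter> rv ` range c \<noteq> {}"
    then obtain i j where ij: "c i = rv (c j)" by auto
    then have "tail C (c i) = tail C (c (Suc j))" using tail_rv[OF cG(1)] cG(2) by simp
    then have "c i = c (Suc j)" using cyclic_seq_tail[OF c, of i "Suc j" 0] by simp
    then show False using t[of j] ij unfolding turn_def by simp
  qed
  have same_tail: "c i = c j" if "tail C (c i) = tail C (c j)" for i j
    using cyclic_seq_tail[OF c that, of 0] by simp
  have same_head: "c i = c j" if "head C (c i) = head C (c j)" for i j
  proof -
    have "c (Suc i + (n - 1)) = c (Suc j + (n - 1))"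
      by (rule cyclic_seq_tail[OF c]) (use that cG(2) in simp)
    then show ?thesis using per n by simp
  qed
  have o1: "cyclic_orientation C rv (range c)"
    unfolding cyclic_orientation_def
  proof (intro conjI ballI)
    fix v assume "v \<in> verts C"
    then obtain i where i: "v = tail C (c i)" using vC by blast
    show "\<exists>!a. a \<in> out_arcs C v \<inter> range c"
      by (rule ex1I[of _ "c i"]) (use i cG same_tail in auto)
  qed (use aC disj in auto)
  have rr: "rv ` rv ` range c = range c"
    using rv_rv[OF cG(1)] by (auto simp: image_image)
  have o2: "cyclic_orientation C rv (rv ` range c)"
    unfolding cyclic_orientation_def rr
  proof (intro conjI ballI)
    fix v assume "v \<in> verts C"
    then obtain i where i: "v = tail C (c i)" using vC by blast
    have "c i = c (Suc (i + (n - 1)))" using per[of i] n by simp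
    then have v: "v = head C (c (i + (n - 1)))" using i cG(2) by simp
    show "\<exists>!a. a \<in> out_arcs C v \<inter> rv ` range c"
    proof (rule ex1I[of _ "rv (c (i + (n - 1)))"])
      show "rv (c (i + (n - 1))) \<in> out_arcs C v \<inter> rv ` range c"
        using v rv_in_arcs[OF cG(1)] tail_rv[OF cG(1)] by simp
      fix a assume a: "a \<in> out_arcs C v \<inter> rv ` range c"
      then obtain j where j: "a = rv (c j)" by blast
      then have "head C (c j) = v" using a tail_rv[OF cG(1)] by simp
      then have "c j = c (i + (n - 1))" using same_head v by simp
      then show "a = rv (c (i + (n - 1)))" using j by simp
    qed
  qed (use aC disj in auto)
  have "range c \<noteq> rv ` range c" using disj by auto
  then show ?thesis using o1 o2 by blast
qed

text \<open>
  By propagation a cyclic orientation contains all arcs of a traversal of the cycle or all their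
  reverses; in both cases it can be followed around the whole cycle.
\<close>

lemma cyclic_orientation_flow:
  assumes "cyclic_graph C rv" "cyclic_orientation C rv Or"
  shows "\<exists>r n. n > 0 \<and> (\<forall>i. r i \<in> Or \<and> head C (r i) = tail C (r (Suc i))) \<and> r n = r 0
    \<and> arcs C = range r \<union> rv ` range r"
proof -
  interpret rgraph C rv by (rule cyclic_graph_seq(1)[OF assms(1)])
  have sc: "core_scopo C rv {} Or" using assms(2) cyclic_orientation_iff by blast
  interpret A: core_scopo_graph C rv "{}" Or by (rule core_scopo_graphI[OF sc])
  obtain n c where c: "cyclic_seq C rv n c" and aC: "arcs C = range c \<union> rv ` range c"
    using cyclic_graph_seq(2)[OF assms(1)] by blast
  have n: "n > 0" and t: "\<And>i. turn C rv (c i) (c (Suc i))" and per: "\<And>i. c (i + n) = c i"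
    using c unfolding cyclic_seq_def by auto
  have cG: "c i \<in> arcs C" "head C (c i) = tail C (c (Suc i))" for i
    using t[of i] unfolding turn_def by auto
  show ?thesis
  proof (cases "\<exists>i. c i \<in> Or")
    case True
    then have "range c \<subseteq> Or" using cyclic_seq_oriented[OF c sc] by blast
    then show ?thesis using n cG(2) per[of 0] aC by (intro exI[of _ c] exI[of _ n]) auto
  next
    case False
    then have rO: "rv ` range c \<subseteq> Or" using A.scopo_rv_iff cG(1) by blast
    have rr: "rv ` rv ` range c = range c"
      using rv_rv[OF cG(1)] by (auto simp: image_image)
    \<comment> \<open>the reverses of the cycle are oriented, in the opposite order\<close>
    define r where "r i = rv (c (i * (n - 1)))" for i
    note rf = reversed_flow[OF c, folded r_def]
    have "r i \<in> Or" for i using rO unfolding r_def by blast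
    moreover have "arcs C = range r \<union> rv ` range r" unfolding rf(3) rr using aC by auto
    ultimately show ?thesis using n rf(1,2) by (intro exI[of _ r] exI[of _ n]) simp
  qed
qed

context local_action_diagram
begin

lemma cyclic_orientation_delta_end:
  assumes "cotree \<Gamma> X C" "rgraph C rv" "cyclic_orientation C rv Or" "\<forall>a\<in>Or. card (X a) = 1"
  shows "delta_end (cotree_scopo \<Gamma> C \<union> Or)"
proof -
  note cc = cotree_core_scopo[OF assms(1)]
  have "core_scopo C rv {} Or" using assms(3) rgraph.cyclic_orientation_iff[OF assms(2)] by blast
  then have "core_scopo (\<Gamma> \<restriction> verts C) rv {} Or" using cc(4) by simp
  from core_scopo_Un[OF cc(1) this] show ?thesis
    unfolding delta_end_def using cc(3) assms(4) by blast
qed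

lemma cyclic_orientation_Un_inj:
  assumes "cotree \<Gamma> X C" "rgraph C rv" "cyclic_orientation C rv Or" "cyclic_orientation C rv Or'"
    "cotree_scopo \<Gamma> C \<union> Or = cotree_scopo \<Gamma> C \<union> Or'"
  shows "Or = Or'"
proof -
  interpret C: rgraph C rv by (rule assms(2))
  have "tail C = tail \<Gamma>"
    using assms(1) unfolding cotree_def graph_cotree_def induced_subgraph_def subgraph_def compatible_def by auto
  then have "tail \<Gamma> a \<in> verts C" if "a \<in> arcs C" for a using C.tail_in_verts[OF that] by simp
  then have "a \<notin> cotree_scopo \<Gamma> C" if "a \<in> arcs C" for a using that unfolding cotree_scopo_def by blast
  moreover have "Or \<subseteq> arcs C" "Or' \<subseteq> arcs C" using assms(3,4) unfolding cyclic_orientation_def by auto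
  ultimately show ?thesis using assms(5) by blast
qed

text \<open>
  With empty core, the orientation is a map from vertices to vertices. A periodic flow of it runs
  around a cycle that the map does not leave. Whether a vertex eventually reaches the cycle does not
  change along an edge, so all vertices do, and the remaining arcs form the scopo of the cycle.
\<close>

lemma periodic_flow_cyclic_cotree:
  assumes de: "delta_end Or" and n: "n > 0"
    and r: "\<And>i. r i \<in> Or \<and> head \<Gamma> (r i) = tail \<Gamma> (r (Suc i))" and rn: "r n = r 0"
  shows "\<exists>C. cotree \<Gamma> X C \<and> cyclic_graph C rv \<and> cyclic_orientation C rv (range r)
    \<and> Or = cotree_scopo \<Gamma> C \<union> range r"
proof -
  have sc: "core_scopo \<Gamma> rv {} Or" using de unfolding delta_end_def by blast
  interpret A: core_scopo_graph \<Gamma> rv "{}" Or by (rule core_scopo_graphI[OF sc])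
  \<comment> \<open>the minimal period makes the vertices of the cycle distinct\<close>
  define m where "m = (LEAST n. n > 0 \<and> r n = r 0)"
  have m: "m > 0" "r m = r 0" using LeastI[of "\<lambda>n. n > 0 \<and> r n = r 0" n] n rn unfolding m_def by auto
  have m_min: "\<not> (k > 0 \<and> r k = r 0)" if "k < m" for k using not_less_Least that unfolding m_def by blast
  have rO: "r i \<in> Or" for i using r by blast
  note uniq = A.flow_unique[of r r, OF r r]
  have per: "r (i + m) = r i" for i using uniq[of m 0 i] m(2) by (simp add: add.commute)
  have inj: "inj_on (\<lambda>i. tail \<Gamma> (r i)) {..<m}"
  proof -
    have "False" if ij: "i < j" "j < m" "tail \<Gamma> (r i) = tail \<Gamma> (r j)" for i j
    proof -
      have "r i = r j" using A.scopo_unique r ij(3) by blast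
      then have "r (i + (m - j)) = r (j + (m - j))" by (rule uniq)
      then have "r (i + (m - j)) = r 0" using ij m(2) by simp
      moreover have "0 < i + (m - j)" "i + (m - j) < m" using ij by auto
      ultimately show False using m_min by blast
    qed
    then show ?thesis by (intro inj_onI) (metis lessThan_iff linorder_neqE_nat)
  qed
  have turn_r: "turn \<Gamma> rv (r i) (r (Suc i))" for i by (rule A.flow_turn[of r, OF r])
  define V where "V = tail \<Gamma> ` range r"
  let ?C = "\<Gamma> \<restriction> V" and ?O = "{a \<in> Or. tail \<Gamma> a \<notin> V}"
  have VG: "V \<subseteq> verts \<Gamma>" unfolding V_def using r A.scopo_arcs by auto
  interpret C: rgraph ?C rv by (rule rgraph_induce[OF VG])
  have in_range: "a \<in> range r" if a: "a \<in> Or" "tail \<Gamma> a \<in> V" for a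
  proof -
    obtain i where "tail \<Gamma> a = tail \<Gamma> (r i)" using a(2) unfolding V_def by blast
    then have "a = r i" using A.scopo_unique a(1) r by blast
    then show ?thesis by blast
  qed
  have rV: "tail \<Gamma> (r i) \<in> V" "head \<Gamma> (r i) \<in> V" for i
  proof -
    show t: "tail \<Gamma> (r i) \<in> V" for i unfolding V_def by blast
    show "head \<Gamma> (r i) \<in> V" using t[of "Suc i"] r[of i] by simp
  qed
  have rG: "r i \<in> arcs \<Gamma>" for i using r A.scopo_arcs by blast
  have arcs_C: "arcs ?C = range r \<union> rv ` range r"
  proof (intro equalityI subsetI)
    fix a assume a: "a \<in> arcs ?C"
    then have aG: "a \<in> arcs \<Gamma>" "tail \<Gamma> a \<in> V" "head \<Gamma> a \<in> V" by auto
    show "a \<in> range r \<union> rv ` range r"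
    proof (cases "a \<in> Or")
      case False
      then have "rv a \<in> Or" using A.scopo_rv_iff aG by blast
      then have "rv a \<in> range r" using in_range tail_rv aG by simp
      then have "rv (rv a) \<in> rv ` range r" by (rule imageI)
      then show ?thesis using rv_rv[OF aG(1)] by simp
    qed (use in_range aG in blast)
  next
    fix a assume "a \<in> range r \<union> rv ` range r"
    then obtain i where "a = r i \<or> a = rv (r i)" by blast
    then show "a \<in> arcs ?C"
      using rV[of i] rG[of i] rv_in_arcs[OF rG] tail_rv[OF rG] head_rv[OF rG] by auto
  qed
  have "cyclic_seq ?C rv m r"
    unfolding cyclic_seq_def
    using m(1) per inj turn_r rV rG by (auto simp: turn_def)
  from C.cyclic_seq_graph_cycle[OF this] C.cyclic_seq_range[OF this]
  have cyc: "graph_cycle ?C rv (map r [0..<m])" "set (map r [0..<m]) = range r" by auto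
  have cyclic: "cyclic_graph ?C rv"
    unfolding cyclic_graph_def
  proof (intro conjI exI[of _ "map r [0..<m]"])
    show "verts ?C = tail ?C ` set (map r [0..<m])" unfolding cyc(2) V_def by simp
    show "arcs ?C = set (map r [0..<m]) \<union> rv ` set (map r [0..<m])" unfolding cyc(2) by (rule arcs_C)
  qed (rule C.rgraph_axioms, rule cyc(1))
  have orient: "cyclic_orientation ?C rv (range r)"
    unfolding cyclic_orientation_def
  proof (intro conjI ballI)
    show "arcs ?C = range r \<union> rv ` range r" by (rule arcs_C)
    have "r i \<noteq> rv (r j)" for i j using A.scopo_rv_notin[OF rO[of j]] rO[of i] by auto
    then show "range r \<inter> rv ` range r = {}" by auto
    fix v assume "v \<in> verts ?C"
    then obtain i where i: "v = tail \<Gamma> (r i)" unfolding V_def by auto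
    show "\<exists>!a. a \<in> out_arcs ?C v \<inter> range r"
    proof (rule ex1I[of _ "r i"])
      show "r i \<in> out_arcs ?C v \<inter> range r" using i rV[of i] rG[of i] by simp
      fix a assume "a \<in> out_arcs ?C v \<inter> range r"
      then obtain j where "a = r j" "tail \<Gamma> (r j) = tail \<Gamma> (r i)" using i by auto
      then show "a = r i" using A.scopo_unique[OF rO rO] by simp
    qed
  qed
  have stay: "head \<Gamma> a \<in> V" if "a \<in> Or" "tail \<Gamma> a \<in> V" for a
    using in_range[OF that] rV(2) by auto
  have sc': "core_scopo \<Gamma> rv V ?O"
    unfolding core_scopo_def
  proof (intro conjI ballI impI)
    show "?O \<subseteq> arcs \<Gamma>" using A.scopo_arcs by blast
    show "\<exists>!a. a \<in> ?O \<and> tail \<Gamma> a = v" if v: "v \<in> verts \<Gamma> - V" for v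
    proof -
      obtain a where a: "a \<in> Or" "tail \<Gamma> a = v" using A.scopo_out[of v] v by auto
      show ?thesis by (rule ex1I[of _ a]) (use a v A.scopo_unique in auto)
    qed
    fix a assume a: "a \<in> arcs \<Gamma>" "tail \<Gamma> a \<notin> V \<or> head \<Gamma> a \<notin> V"
    have "rv a \<in> Or \<longleftrightarrow> a \<notin> Or" using A.scopo_rv_iff[OF a(1)] by simp
    then show "a \<in> ?O \<longleftrightarrow> rv a \<notin> ?O"
      using stay[of a] stay[of "rv a"] tail_rv[OF a(1)] head_rv[OF a(1)] a(2) by auto
  qed (use VG in auto)
  interpret B: core_scopo_graph \<Gamma> rv V ?O by (rule core_scopo_graphI[OF sc'])
  \<comment> \<open>\<open>Q v\<close> says that the orientation leads from \<open>v\<close> into the cycle\<close>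
  define Q where "Q v \<longleftrightarrow> v \<in> V \<or> (\<exists>a c. a \<in> ?O \<and> tail \<Gamma> a = v \<and> (follows \<Gamma> ?O)\<^sup>*\<^sup>* a c \<and> head \<Gamma> c \<in> V)" for v
  have Q: "Q v" if v: "v \<in> verts \<Gamma>" for v
  proof (rule connected_induct[OF conn, where u = "tail \<Gamma> (r 0)"])
    show "tail \<Gamma> (r 0) \<in> verts \<Gamma>" using rG by simp
    show "Q (tail \<Gamma> (r 0))" unfolding Q_def using rV by blast
    fix a assume a: "a \<in> arcs \<Gamma>" "Q (tail \<Gamma> a)"
    show "Q (head \<Gamma> a)"
    proof (cases "head \<Gamma> a \<in> V")
      case hV: False
      show ?thesis
      proof (cases "a \<in> Or")
        case True
        then have tV: "tail \<Gamma> a \<notin> V" using stay hV by blast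
        then obtain b c where b: "b \<in> ?O" "tail \<Gamma> b = tail \<Gamma> a" "(follows \<Gamma> ?O)\<^sup>*\<^sup>* b c" "head \<Gamma> c \<in> V"
          using a(2) unfolding Q_def by blast
        have "b = a" using A.scopo_unique b True by blast
        then have ac: "(follows \<Gamma> ?O)\<^sup>*\<^sup>* a c" "a \<noteq> c" using b hV by auto
        then obtain d where d: "follows \<Gamma> ?O a d" "(follows \<Gamma> ?O)\<^sup>*\<^sup>* d c"
          using tranclpD[of "follows \<Gamma> ?O" a c] rtranclpD[OF ac(1)] by blast
        then have "d \<in> ?O" "tail \<Gamma> d = head \<Gamma> a" unfolding follows_def by simp_all
        then show ?thesis unfolding Q_def using d(2) b(4) by (intro disjI2 exI[of _ d] exI[of _ c]) simp
      next
        case False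
        then have ra: "rv a \<in> ?O" using A.scopo_rv_iff[OF a(1)] hV tail_rv[OF a(1)] by simp
        show ?thesis
        proof (cases "tail \<Gamma> a \<in> V")
          case True
          then show ?thesis unfolding Q_def using ra tail_rv[OF a(1)] head_rv[OF a(1)]
            by (intro disjI2 exI[of _ "rv a"] exI[of _ "rv a"]) simp
        next
          case False
          then obtain b c where b: "b \<in> ?O" "tail \<Gamma> b = tail \<Gamma> a" "(follows \<Gamma> ?O)\<^sup>*\<^sup>* b c" "head \<Gamma> c \<in> V"
            using a(2) unfolding Q_def by blast
          have "follows \<Gamma> ?O (rv a) b" unfolding follows_def using b head_rv[OF a(1)] by simp
          then have "(follows \<Gamma> ?O)\<^sup>*\<^sup>* (rv a) c" using b(3) by (rule converse_rtranclp_into_rtranclp)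
          then show ?thesis unfolding Q_def using ra tail_rv[OF a(1)] b(4)
            by (intro disjI2 exI[of _ "rv a"] exI[of _ c]) simp
        qed
      qed
    qed (simp add: Q_def)
  qed (rule v)
  have fn: "funnels \<Gamma> V ?O"
    unfolding funnels_def
  proof
    fix a assume a: "a \<in> ?O"
    then have "tail \<Gamma> a \<in> verts \<Gamma>" using A.scopo_arcs by auto
    then obtain b c where b: "b \<in> ?O" "tail \<Gamma> b = tail \<Gamma> a" "(follows \<Gamma> ?O)\<^sup>*\<^sup>* b c" "head \<Gamma> c \<in> V"
      using Q[of "tail \<Gamma> a"] a unfolding Q_def by blast
    then have "b = a" using B.scopo_unique a by blast
    then show "\<exists>c. (follows \<Gamma> ?O)\<^sup>*\<^sup>* a c \<and> head \<Gamma> c \<in> V" using b by blast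
  qed
  have card: "\<forall>a\<in>?O. card (X a) = 1" using de unfolding delta_end_def by blast
  have "V \<noteq> {}" unfolding V_def by blast
  note ct = cotreeI[OF this sc' fn card]
  have "Or = ?O \<union> range r" using in_range rO by auto
  then show ?thesis using ct cyclic orient by (intro exI[of _ ?C]) simp
qed

lemma delta_end_is_tree:
  assumes de: "delta_end Or"
    and acyclic: "\<And>r n. n > 0 \<Longrightarrow> (\<And>i. r i \<in> Or \<and> head \<Gamma> (r i) = tail \<Gamma> (r (Suc i))) \<Longrightarrow> r n \<noteq> r 0"
  shows "is_tree \<Gamma> rv"
proof -
  have sc: "core_scopo \<Gamma> rv {} Or" using de unfolding delta_end_def by blast
  interpret A: core_scopo_graph \<Gamma> rv "{}" Or by (rule core_scopo_graphI[OF sc])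
  show ?thesis
  proof (rule is_treeI_orientation[OF conn _ _ sc])
    show "a \<in> Or \<longleftrightarrow> rv a \<notin> Or" if "a \<in> arcs \<Gamma>" for a using A.scopo_rv_iff[OF that] by simp
    show "Or \<subseteq> arcs \<Gamma>" using A.scopo_arcs by blast
  next
    fix r :: "nat \<Rightarrow> 'a" and n :: nat
    assume n: "n > 0" and r: "\<And>i. r i \<in> Or \<and> head \<Gamma> (r i) = tail \<Gamma> (r (Suc i))"
    show "r n \<noteq> r 0" by (rule acyclic[of n r, OF n r])
  qed
qed

lemma horocyclic_ends_eq:
  assumes "is_tree \<Gamma> rv" shows "horocyclic_ends \<Gamma> rv X = rays_in \<Gamma> ` Collect delta_end"
proof -
  interpret \<Gamma>: tree_graph \<Gamma> rv by (rule tree_graphI[OF assms])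
  show ?thesis
  proof (intro equalityI subsetI)
    fix \<xi> assume "\<xi> \<in> horocyclic_ends \<Gamma> rv X"
    then have \<xi>: "\<xi> \<in> ends \<Gamma>" "\<forall>a\<in>arcs_towards \<Gamma> \<xi>. card (X a) = 1" unfolding horocyclic_ends_def by auto
    then have "delta_end (arcs_towards \<Gamma> \<xi>)" unfolding delta_end_def using \<Gamma>.end_core_scopo(1) by blast
    moreover have "\<xi> = rays_in \<Gamma> (arcs_towards \<Gamma> \<xi>)" using \<Gamma>.end_core_scopo(2)[OF \<xi>(1)] by simp
    ultimately show "\<xi> \<in> rays_in \<Gamma> ` Collect delta_end" by blast
  next
    fix \<xi> assume "\<xi> \<in> rays_in \<Gamma> ` Collect delta_end"
    then obtain Or where Or: "delta_end Or" "\<xi> = rays_in \<Gamma> Or" by blast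
    then have sc: "core_scopo \<Gamma> rv {} Or" unfolding delta_end_def by blast
    then have "\<xi> \<in> ends \<Gamma>" using \<Gamma>.ends_iff Or(2) by blast
    moreover have "arcs_towards \<Gamma> \<xi> = Or" using \<Gamma>.arcs_towards_rays_in[OF sc] Or(2) by simp
    ultimately show "\<xi> \<in> horocyclic_ends \<Gamma> rv X"
      unfolding horocyclic_ends_def using assms Or(1) unfolding delta_end_def by simp
  qed
qed

lemma delta_end_tree_acyclic:
  assumes "is_tree \<Gamma> rv" "delta_end Or" "n > 0"
    "\<And>i. r i \<in> Or \<and> head \<Gamma> (r i) = tail \<Gamma> (r (Suc i))"
  shows "r n \<noteq> r 0"
proof -
  interpret \<Gamma>: tree_graph \<Gamma> rv by (rule tree_graphI[OF assms(1)])
  have sc: "core_scopo \<Gamma> rv {} Or" using assms(2) unfolding delta_end_def by blast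
  have "ray \<Gamma> r" by (rule \<Gamma>.flow_ray[of "{}" Or r, OF sc assms(4)])
  then have "inj (\<lambda>i. tail \<Gamma> (r i))" unfolding ray_def by blast
  from injD[OF this, of n 0] show ?thesis using assms(3) by auto
qed

end

context delta_action
begin

text \<open>
  A lift of the flow is a ray in the lifted orientation that meets the same fibre twice.
\<close>

lemma delta_end_translation:
  assumes de: "delta_end Or" and n: "n > 0"
    and r: "\<And>i. r i \<in> Or \<and> head \<Gamma> (r i) = tail \<Gamma> (r (Suc i))" and rn: "r n = r 0"
  shows "\<exists>g\<in>U. \<exists>l. translates T g l \<and> (\<forall>i. l i \<in> lift Or) \<and> (\<forall>i. piA (l (int i)) = r i)"
proof -
  have sc: "core_scopo \<Gamma> rv {} Or" using de unfolding delta_end_def by blast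
  interpret A: core_scopo_graph \<Gamma> rv "{}" Or by (rule core_scopo_graphI[OF sc])
  note scT = lift_delta_end[OF de]
  interpret B: core_scopo_graph T rvT "{}" "lift Or" by (rule T.core_scopo_graphI[OF scT])
  have "r 0 \<in> piA ` lift Or" using piA_lift[OF delta_end_arcs[OF de]] r[of 0] by simp
  then obtain b where b: "b \<in> lift Or" "piA b = r 0" by auto
  obtain s where s: "s 0 = b \<and> (\<forall>i. s i \<in> lift Or \<and> head T (s i) = tail T (s (Suc i)))"
    using flow_exists[OF scT T.wf_digraph_axioms b(1)] by (rule exE)
  then have s0: "s 0 = b" and sO: "\<And>i. s i \<in> lift Or" and sh: "\<And>i. head T (s i) = tail T (s (Suc i))" by auto
  have sT: "s i \<in> arcs T" for i using sO[of i] by simp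
  have sf: "s i \<in> lift Or \<and> head T (s i) = tail T (s (Suc i))" for i using sO sh by blast
  have pis: "piA (s i) = r i" for i
  proof (induction i)
    case (Suc i)
    have "tail \<Gamma> (piA (s (Suc i))) = tail \<Gamma> (r (Suc i))"
      using tail_piA[OF sT, of "Suc i"] head_piA[OF sT, of i] sh[of i] Suc r[of i] by simp
    then show ?case using A.scopo_unique[of "piA (s (Suc i))" "r (Suc i)"] sO[of "Suc i"] r[of "Suc i"] by simp
  qed (use s0 b in simp)
  have "leads T rvT (s 0) (s n)"
    by (rule leads_seq[of T rvT s, OF B.flow_turn[of s, OF sf] n])
  moreover have "piA (s 0) = piA (s n)" using pis rn by simp
  ultimately obtain g l where g: "g \<in> U" and l: "translates T g l" and l0: "l 0 = s 0"
    using translation_exists by blast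
  interpret g: tree_automorphism T rvT g by (rule automorphism[OF g])
  have "l 0 \<in> lift Or" using l0 sO by simp
  then have "rvT (l 0) \<notin> lift Or" by (rule B.scopo_rv_notin)
  moreover have "\<And>b. b \<in> arcs T \<Longrightarrow> snd g b \<in> lift Or \<longleftrightarrow> b \<in> lift Or" using lift_invariant[OF g] .
  ultimately have lO: "\<forall>i. l i \<in> lift Or" using g.translation_scopo_cases[OF l scT] by blast
  have "head T (l (int i)) = tail T (l (int (Suc i)))" for i
    using l unfolding translates_def line_def by (simp add: add.commute)
  then have lf: "l (int i) \<in> lift Or \<and> head T (l (int i)) = tail T (l (int (Suc i)))" for i using lO by blast
  have "l (int i) = s i" for i
    using B.flow_unique[of "\<lambda>i. l (int i)" s, OF lf sf, of 0 0 i] l0 by simp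
  then have "piA (l (int i)) = r i" for i using pis by simp
  then show ?thesis using g l lO by blast
qed

lemma line_rays:
  assumes l: "line T l"
  shows "ray T (forward_ray l)" "ray T (backward_ray rvT l)"
proof -
  show "ray T (forward_ray l)"
  proof (rule T.turn_ray)
    fix i show "turn T rvT (forward_ray l i) (forward_ray l (Suc i))"
      using T.line_turn[OF l, of "int i"] unfolding forward_ray_def by (simp add: add.commute)
  qed
  show "ray T (backward_ray rvT l)"
  proof (rule T.turn_ray)
    fix i show "turn T rvT (backward_ray rvT l i) (backward_ray rvT l (Suc i))"
      using T.turn_rv[OF T.line_turn[OF l, of "- 1 - int (Suc i)"]] unfolding backward_ray_def by simp
  qed
qed

lemma forward_ray_in_iff:
  assumes l: "line T l" and sc: "core_scopo T rvT {} OT"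
  shows "forward_ray l \<in> rays_in T OT \<longleftrightarrow> (\<forall>i. l i \<in> OT)"
    "backward_ray rvT l \<in> rays_in T OT \<longleftrightarrow> (\<forall>i. rvT (l i) \<in> OT)"
proof -
  interpret B: core_scopo_graph T rvT "{}" OT by (rule T.core_scopo_graphI[OF sc])
  note leads = T.leads_int_seq[of l, OF T.line_turn[OF l]]
  show "forward_ray l \<in> rays_in T OT \<longleftrightarrow> (\<forall>i. l i \<in> OT)"
  proof
    assume "forward_ray l \<in> rays_in T OT"
    then have f: "forward_ray l k \<in> OT" for k unfolding rays_in_def by auto
    show "\<forall>i. l i \<in> OT"
    proof
      fix i
      have "leads T rvT (l i) (l (int (nat i + 1)))" by (rule leads) simp
      moreover have "l (int (nat i + 1)) \<in> OT" using f[of "nat i + 1"] unfolding forward_ray_def .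
      ultimately show "l i \<in> OT" by (rule B.scopo_back_leads)
    qed
  next
    assume "\<forall>i. l i \<in> OT"
    then have "range (forward_ray l) \<subseteq> OT" unfolding forward_ray_def by auto
    then show "forward_ray l \<in> rays_in T OT" using line_rays(1)[OF l] unfolding rays_in_def by simp
  qed
  show "backward_ray rvT l \<in> rays_in T OT \<longleftrightarrow> (\<forall>i. rvT (l i) \<in> OT)"
  proof
    assume "backward_ray rvT l \<in> rays_in T OT"
    then have f: "backward_ray rvT l k \<in> OT" for k unfolding rays_in_def by auto
    show "\<forall>i. rvT (l i) \<in> OT"
    proof
      fix i
      have "leads T rvT (l (- 1 - int (nat (- i)))) (l i)" by (rule leads) simp
      then have "leads T rvT (rvT (l i)) (rvT (l (- 1 - int (nat (- i)))))" by (rule T.leads_rv)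
      moreover have "rvT (l (- 1 - int (nat (- i)))) \<in> OT" using f[of "nat (- i)"] unfolding backward_ray_def .
      ultimately show "rvT (l i) \<in> OT" by (rule B.scopo_back_leads)
    qed
  next
    assume "\<forall>i. rvT (l i) \<in> OT"
    then have "range (backward_ray rvT l) \<subseteq> OT" unfolding backward_ray_def by auto
    then show "backward_ray rvT l \<in> rays_in T OT" using line_rays(2)[OF l] unfolding rays_in_def by simp
  qed
qed

lemma rays_in_lift_disjoint:
  assumes "delta_end Or" "delta_end Or'" "r \<in> rays_in T (lift Or)" "r \<in> rays_in T (lift Or')"
  shows "Or = Or'"
proof (rule lift_inj[OF delta_end_arcs[OF assms(1)] delta_end_arcs[OF assms(2)]])
  have r: "ray T r" "range r \<subseteq> lift Or" "range r \<subseteq> lift Or'" using assms(3,4) unfolding rays_in_def by auto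
  show "lift Or = lift Or'"
    using T.arcs_into_eq[OF lift_delta_end[OF assms(1)] r(1,2)]
      T.arcs_into_eq[OF lift_delta_end[OF assms(2)] r(1,3)] by simp
qed

text \<open>
  A translation fixes no ends except the two ends of its axis.
\<close>

lemma axis_ends:
  assumes g: "g \<in> U" and l: "translates T g l" and de: "delta_end Or"
  shows "forward_ray l \<in> rays_in T (lift Or) \<or> backward_ray rvT l \<in> rays_in T (lift Or)"
proof -
  have line: "line T l" using l unfolding translates_def by blast
  note sc = lift_delta_end[OF de]
  have "(\<forall>i. l i \<in> lift Or) \<or> (\<forall>i. rvT (l i) \<in> lift Or)"
    using tree_automorphism.translation_scopo_cases[OF automorphism[OF g] l sc] lift_invariant[OF g] by blast
  then show ?thesis using forward_ray_in_iff[OF line sc] by simp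
qed

lemma translates_periodic:
  assumes g: "g \<in> U" and l: "translates T g l"
  shows "\<exists>n>0. \<forall>i. piA (l (i + int n)) = piA (l i)"
proof -
  obtain n where n: "n > 0" "\<And>i. snd g (l i) = l (i + n)" using l unfolding translates_def by blast
  have "l i \<in> arcs T" for i using l unfolding translates_def line_def by blast
  then have "piA (l (i + n)) = piA (l i)" for i using universal_groupD(3)[OF g, of "l i"] n(2) by simp
  then show ?thesis using n(1) by (intro exI[of _ "nat n"]) simp
qed

lemma axis_flow:
  assumes g: "g \<in> U" and l: "translates T g l" and de: "delta_end Or" and f: "forward_ray l \<in> rays_in T (lift Or)"
  defines "r \<equiv> \<lambda>i. piA (l (int i))"
  shows "r i \<in> Or \<and> head \<Gamma> (r i) = tail \<Gamma> (r (Suc i))" "\<exists>n>0. r n = r 0"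
proof -
  have line: "line T l" using l unfolding translates_def by blast
  then have lT: "l i \<in> arcs T" "head T (l i) = tail T (l (i + 1))" for i unfolding line_def by auto
  have lO: "\<forall>i. l i \<in> lift Or" using forward_ray_in_iff(1)[OF line lift_delta_end[OF de]] f by blast
  show "r i \<in> Or \<and> head \<Gamma> (r i) = tail \<Gamma> (r (Suc i))"
    unfolding r_def using lO head_piA[OF lT(1)] tail_piA[OF lT(1)] lT(2)[of "int i"] by (simp add: add.commute)
  show "\<exists>n>0. r n = r 0"
    using translates_periodic[OF g l] unfolding r_def by (metis add.left_neutral of_nat_0)
qed

lemma axis_cotree:
  assumes g: "g \<in> U" and l: "translates T g l" and de: "delta_end Or" and f: "forward_ray l \<in> rays_in T (lift Or)"
  shows "\<exists>C. cotree \<Gamma> X C \<and> cyclic_graph C rv \<and> cyclic_orientation C rv (range (\<lambda>i. piA (l (int i))))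
    \<and> Or = cotree_scopo \<Gamma> C \<union> range (\<lambda>i. piA (l (int i)))"
proof -
  obtain n where "n > 0" "piA (l (int n)) = piA (l (int 0))" using axis_flow(2)[OF assms] by blast
  then show ?thesis
    using periodic_flow_cyclic_cotree[of Or n "\<lambda>i. piA (l (int i))", OF de _ axis_flow(1)[OF assms]] by blast
qed

text \<open>
  A cyclic orientation whose arcs have singleton sets yields a fixed end together with a translation
  towards it, whose axis projects onto the cycle.
\<close>

lemma cyclic_cotree_axis:
  assumes C: "cotree \<Gamma> X C" "cyclic_graph C rv" "cyclic_orientation C rv Or" "\<forall>a\<in>Or. card (X a) = 1"
  shows "delta_end (cotree_scopo \<Gamma> C \<union> Or)"
    "\<exists>g\<in>U. \<exists>l. translates T g l \<and> forward_ray l \<in> rays_in T (lift (cotree_scopo \<Gamma> C \<union> Or))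
      \<and> arcs C = range (\<lambda>i. piA (l (int i))) \<union> rv ` range (\<lambda>i. piA (l (int i)))"
proof -
  let ?O = "cotree_scopo \<Gamma> C \<union> Or"
  show de: "delta_end ?O"
    by (rule cyclic_orientation_delta_end[OF C(1) cyclic_graph_seq(1)[OF C(2)] C(3,4)])
  obtain r n where r: "n > 0" "\<forall>i. r i \<in> Or \<and> head C (r i) = tail C (r (Suc i))" "r n = r 0"
    "arcs C = range r \<union> rv ` range r"
    using cyclic_orientation_flow[OF C(2,3)] by blast
  have th: "tail C = tail \<Gamma>" "head C = head \<Gamma>"
    using C(1) unfolding cotree_def graph_cotree_def induced_subgraph_def subgraph_def compatible_def by auto
  have rf: "r i \<in> ?O \<and> head \<Gamma> (r i) = tail \<Gamma> (r (Suc i))" for i using r(2) th by simp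
  obtain g l where g: "g \<in> U" "translates T g l" "\<forall>i. l i \<in> lift ?O" "\<forall>i. piA (l (int i)) = r i"
    using delta_end_translation[of ?O n r, OF de r(1) rf r(3)] by blast
  have line: "line T l" using g(2) unfolding translates_def by blast
  have "forward_ray l \<in> rays_in T (lift ?O)"
    using forward_ray_in_iff(1)[OF line lift_delta_end[OF de]] g(3) by blast
  moreover have "(\<lambda>i. piA (l (int i))) = r" using g(4) by auto
  ultimately show "\<exists>g\<in>U. \<exists>l. translates T g l \<and> forward_ray l \<in> rays_in T (lift ?O)
      \<and> arcs C = range (\<lambda>i. piA (l (int i))) \<union> rv ` range (\<lambda>i. piA (l (int i)))"
    using g(1,2) r(4) by auto
qed

lemma fixed_endE:
  assumes "\<xi> \<in> fixed_ends T U" obtains Or where "delta_end Or" "\<xi> = rays_in T (lift Or)"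
  using assms unfolding fixed_ends_eq by blast

text \<open>
  Both cyclic orientations give fixed ends. They are the two ends of the axis of a translation, so
  there is no third fixed end.
\<close>

lemma lineal_cotree_ends:
  assumes C: "lineal_cotree \<Gamma> rv X C"
  shows "\<exists>Or. cyclic_orientation C rv Or \<and> cyclic_orientation C rv (rv ` Or)
    \<and> delta_end (cotree_scopo \<Gamma> C \<union> Or) \<and> delta_end (cotree_scopo \<Gamma> C \<union> rv ` Or)
    \<and> fixed_ends T U = {rays_in T (lift (cotree_scopo \<Gamma> C \<union> Or)), rays_in T (lift (cotree_scopo \<Gamma> C \<union> rv ` Or))}
    \<and> lineal_type T rvT U"
proof -
  have ct: "cotree \<Gamma> X C" "cyclic_graph C rv" and card: "\<forall>a\<in>arcs C. card (X a) = 1"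
    using C unfolding lineal_cotree_def by blast+
  obtain Or where Or: "cyclic_orientation C rv Or" "cyclic_orientation C rv (rv ` Or)" "Or \<noteq> rv ` Or"
    using cyclic_orientation_exists[OF ct(2)] by blast
  have sub: "Or \<subseteq> arcs C" "rv ` Or \<subseteq> arcs C" using Or(1,2) unfolding cyclic_orientation_def by auto
  have card1: "\<forall>a\<in>Or. card (X a) = 1" "\<forall>a\<in>rv ` Or. card (X a) = 1" using sub card by auto
  note ax = cyclic_cotree_axis[OF ct Or(1) card1(1)]
  let ?O1 = "cotree_scopo \<Gamma> C \<union> Or" and ?O2 = "cotree_scopo \<Gamma> C \<union> rv ` Or"
  have de2: "delta_end ?O2" by (rule cyclic_cotree_axis(1)[OF ct Or(2) card1(2)])
  have ne: "?O1 \<noteq> ?O2"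
    using cyclic_orientation_Un_inj[OF ct(1) cyclic_graph_seq(1)[OF ct(2)] Or(1,2)] Or(3) by blast
  obtain g l where g: "g \<in> U" "translates T g l" "forward_ray l \<in> rays_in T (lift ?O1)" using ax(2) by blast
  have b: "backward_ray rvT l \<in> rays_in T (lift ?O2)"
    using axis_ends[OF g(1,2) de2] rays_in_lift_disjoint[OF ax(1) de2 g(3)] ne by blast
  have "O' = ?O1 \<or> O' = ?O2" if "delta_end O'" for O'
    using axis_ends[OF g(1,2) that] rays_in_lift_disjoint[OF that ax(1) _ g(3)]
      rays_in_lift_disjoint[OF that de2 _ b] by blast
  then have fe: "fixed_ends T U = {rays_in T (lift ?O1), rays_in T (lift ?O2)}"
    unfolding fixed_ends_eq using ax(1) de2 by blast
  have "rays_in T (lift ?O1) \<noteq> rays_in T (lift ?O2)" using rays_in_lift_inj[OF ax(1) de2] ne by blast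
  then have "lineal_type T rvT U"
    unfolding lineal_type_def using fe g b by blast
  then show ?thesis using Or ax(1) de2 fe by blast
qed

lemma lineal_type_cotree:
  assumes "lineal_type T rvT U" shows "\<exists>C. lineal_cotree \<Gamma> rv X C"
proof -
  obtain \<xi> \<eta> g l where fe: "fixed_ends T U = {\<xi>, \<eta>}" and g: "g \<in> U" "translates T g l"
    and f: "forward_ray l \<in> \<xi>" and b: "backward_ray rvT l \<in> \<eta>"
    using assms unfolding lineal_type_def by blast
  have "\<xi> \<in> fixed_ends T U" "\<eta> \<in> fixed_ends T U" using fe by auto
  then obtain O1 O2 where O1: "delta_end O1" "\<xi> = rays_in T (lift O1)" and O2: "delta_end O2" "\<eta> = rays_in T (lift O2)"
    by (elim fixed_endE) blast
  let ?R = "range (\<lambda>i. piA (l (int i)))"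
  obtain C where C: "cotree \<Gamma> X C" "cyclic_graph C rv" "cyclic_orientation C rv ?R" "O1 = cotree_scopo \<Gamma> C \<union> ?R"
    using axis_cotree[OF g O1(1)] f O1(2) by blast
  have line: "line T l" using g(2) unfolding translates_def by blast
  have lT: "l i \<in> arcs T" for i using line unfolding line_def by blast
  have lb: "\<forall>i. rvT (l i) \<in> lift O2"
    using forward_ray_in_iff(2)[OF line lift_delta_end[OF O2(1)]] b O2(2) by blast
  have "card (X a) = 1" if a: "a \<in> arcs C" for a
  proof -
    have "a \<in> ?R \<or> a \<in> rv ` ?R" using a C(3) unfolding cyclic_orientation_def by blast
    then show ?thesis
    proof
      assume "a \<in> ?R" then show ?thesis using C(4) O1(1) unfolding delta_end_def by blast
    next
      assume "a \<in> rv ` ?R"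
      then obtain i where "a = rv (piA (l (int i)))" by auto
      then have "a \<in> O2" using lb piA_rvT[OF lT] by simp
      then show ?thesis using O2(1) unfolding delta_end_def by blast
    qed
  qed
  then show ?thesis unfolding lineal_cotree_def using C by blast
qed

theorem lineal_type_iff: "lineal_type T rvT U \<longleftrightarrow> (\<exists>C. lineal_cotree \<Gamma> rv X C)"
proof
  assume "\<exists>C. lineal_cotree \<Gamma> rv X C"
  then obtain C where "lineal_cotree \<Gamma> rv X C" by (rule exE)
  from lineal_cotree_ends[OF this] show "lineal_type T rvT U" by (elim exE conjE)
qed (rule lineal_type_cotree)

lemma lineal_one_to_one:
  assumes C: "lineal_cotree \<Gamma> rv X C"
  shows "one_to_one (fixed_ends T U) {Or. cyclic_orientation C rv Or}
    (\<lambda>\<xi> Or. corresponds T piA (arcs_towards T \<xi>) (cotree_scopo \<Gamma> C \<union> Or))"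
proof -
  have ct: "cotree \<Gamma> X C" "cyclic_graph C rv" and card: "\<forall>a\<in>arcs C. card (X a) = 1"
    using C unfolding lineal_cotree_def by blast+
  obtain O1 where O1: "cyclic_orientation C rv O1" "cyclic_orientation C rv (rv ` O1)"
    and fe: "fixed_ends T U = {rays_in T (lift (cotree_scopo \<Gamma> C \<union> O1)), rays_in T (lift (cotree_scopo \<Gamma> C \<union> rv ` O1))}"
    using lineal_cotree_ends[OF C] by (elim exE conjE)
  have de: "delta_end (cotree_scopo \<Gamma> C \<union> Or)" if "cyclic_orientation C rv Or" for Or
  proof -
    have "\<forall>a\<in>Or. card (X a) = 1" using that card unfolding cyclic_orientation_def by blast
    then show ?thesis using cyclic_cotree_axis(1)[OF ct that] by blast
  qed
  have inj: "Or = Or'" if "cyclic_orientation C rv Or" "cyclic_orientation C rv Or'"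
    "lift (cotree_scopo \<Gamma> C \<union> Or) = lift (cotree_scopo \<Gamma> C \<union> Or')" for Or Or'
    using cyclic_orientation_Un_inj[OF ct(1) cyclic_graph_seq(1)[OF ct(2)] that(1,2)]
      lift_inj[OF delta_end_arcs[OF de[OF that(1)]] delta_end_arcs[OF de[OF that(2)]] that(3)] by blast
  show ?thesis unfolding one_to_one_def corresponds_def
  proof (intro conjI ballI)
    fix \<xi> assume "\<xi> \<in> fixed_ends T U"
    then obtain Or where Or: "cyclic_orientation C rv Or" "\<xi> = rays_in T (lift (cotree_scopo \<Gamma> C \<union> Or))"
      using fe O1 by blast
    have at: "arcs_towards T \<xi> = lift (cotree_scopo \<Gamma> C \<union> Or)"
      unfolding Or(2) by (rule delta_end_fixed_end(2)[OF de[OF Or(1)]])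
    show "\<exists>!Or. Or \<in> {Or. cyclic_orientation C rv Or} \<and> arcs_towards T \<xi> = lift (cotree_scopo \<Gamma> C \<union> Or)"
    proof (rule ex1I[of _ Or])
      show "Or \<in> {Or. cyclic_orientation C rv Or} \<and> arcs_towards T \<xi> = lift (cotree_scopo \<Gamma> C \<union> Or)"
        using Or(1) at by blast
      fix Or' assume Or': "Or' \<in> {Or. cyclic_orientation C rv Or} \<and> arcs_towards T \<xi> = lift (cotree_scopo \<Gamma> C \<union> Or')"
      have "lift (cotree_scopo \<Gamma> C \<union> Or') = lift (cotree_scopo \<Gamma> C \<union> Or)"
        by (rule trans[OF sym[OF conjunct2[OF Or']] at])
      then show "Or' = Or" by (rule inj[rotated 2]) (use Or' Or(1) in blast)+
    qed
  next
    fix Or assume "Or \<in> {Or. cyclic_orientation C rv Or}"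
    then have Or: "delta_end (cotree_scopo \<Gamma> C \<union> Or)" using de[of Or] by simp
    note fx = delta_end_fixed_end[OF Or]
    show "\<exists>!\<xi>. \<xi> \<in> fixed_ends T U \<and> arcs_towards T \<xi> = lift (cotree_scopo \<Gamma> C \<union> Or)"
    proof (rule ex1I[of _ "rays_in T (lift (cotree_scopo \<Gamma> C \<union> Or))"])
      show "rays_in T (lift (cotree_scopo \<Gamma> C \<union> Or)) \<in> fixed_ends T U
          \<and> arcs_towards T (rays_in T (lift (cotree_scopo \<Gamma> C \<union> Or))) = lift (cotree_scopo \<Gamma> C \<union> Or)"
        using fx by (rule conjI)
      fix \<xi> assume \<xi>: "\<xi> \<in> fixed_ends T U \<and> arcs_towards T \<xi> = lift (cotree_scopo \<Gamma> C \<union> Or)"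
      show "\<xi> = rays_in T (lift (cotree_scopo \<Gamma> C \<union> Or))"
        unfolding conjunct2[OF \<xi>, symmetric] by (rule fixed_end_delta_end(3)[OF conjunct1[OF \<xi>]])
    qed
  qed
qed

text \<open>
  A second fixed end would be the other end of the axis. Then the reverses of the arcs of the cyclic
  orientation would have singleton sets too, contrary to the choice of the cotree.
\<close>

lemma focal_cotree_end:
  assumes C: "focal_cotree \<Gamma> rv X C Or"
  shows "fixed_ends T U = {rays_in T (lift (cotree_scopo \<Gamma> C \<union> Or))}" "focal_type T U"
    "delta_end (cotree_scopo \<Gamma> C \<union> Or)"
proof -
  have ct: "cotree \<Gamma> X C" "cyclic_graph C rv" "cyclic_orientation C rv Or" and card: "\<forall>a\<in>Or. card (X a) = 1"
    and two: "\<exists>a\<in>arcs C - Or. \<exists>x\<in>X a. \<exists>y\<in>X a. x \<noteq> y"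
    using C unfolding focal_cotree_def by blast+
  let ?O1 = "cotree_scopo \<Gamma> C \<union> Or"
  note ax = cyclic_cotree_axis[OF ct card]
  show "delta_end ?O1" by (rule ax(1))
  obtain g l where g: "g \<in> U" "translates T g l" "forward_ray l \<in> rays_in T (lift ?O1)"
    and aC: "arcs C = range (\<lambda>i. piA (l (int i))) \<union> rv ` range (\<lambda>i. piA (l (int i)))"
    using ax(2) by blast
  have line: "line T l" using g(2) unfolding translates_def by blast
  have lT: "l i \<in> arcs T" for i using line unfolding line_def by blast
  have l1: "\<forall>i. l i \<in> lift ?O1" using forward_ray_in_iff(1)[OF line lift_delta_end[OF ax(1)]] g(3) by blast
  have "O' = ?O1" if O': "delta_end O'" for O'
  proof (rule ccontr)
    assume ne: "O' \<noteq> ?O1"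
    then have "backward_ray rvT l \<in> rays_in T (lift O')"
      using axis_ends[OF g(1,2) O'] rays_in_lift_disjoint[OF O' ax(1) _ g(3)] by blast
    then have lb: "\<forall>i. rvT (l i) \<in> lift O'" using forward_ray_in_iff(2)[OF line lift_delta_end[OF O']] by blast
    obtain a x y where a: "a \<in> arcs C" "x \<in> X a" "y \<in> X a" "x \<noteq> y" using two by blast
    then have "card (X a) \<noteq> 1" by (metis card_1_singletonE singletonD)
    moreover have "card (X a) = 1"
    proof -
      have "a \<in> range (\<lambda>i. piA (l (int i))) \<or> a \<in> rv ` range (\<lambda>i. piA (l (int i)))" using a(1) aC by blast
      then obtain i where "a = piA (l (int i)) \<or> a = rv (piA (l (int i)))" by auto
      then show ?thesis
      proof
        assume "a = piA (l (int i))"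
        then have "a \<in> ?O1" using l1 by simp
        then show ?thesis using ax(1) unfolding delta_end_def by blast
      next
        assume "a = rv (piA (l (int i)))"
        then have "a \<in> O'" using lb piA_rvT[OF lT] by simp
        then show ?thesis using O' unfolding delta_end_def by blast
      qed
    qed
    ultimately show False by blast
  qed
  then show fe: "fixed_ends T U = {rays_in T (lift ?O1)}" unfolding fixed_ends_eq using ax(1) by blast
  show "focal_type T U" unfolding focal_type_def using fe g by blast
qed

lemma lineal_or_focal_cotree:
  assumes "cotree \<Gamma> X C" "cyclic_graph C rv" "cyclic_orientation C rv Or" "\<forall>a\<in>Or. card (X a) = 1"
  shows "lineal_cotree \<Gamma> rv X C \<or> focal_cotree \<Gamma> rv X C Or"
proof (cases "\<exists>a\<in>arcs C - Or. \<exists>x\<in>X a. \<exists>y\<in>X a. x \<noteq> y")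
  case True
  then show ?thesis unfolding focal_cotree_def using assms by blast
next
  case False
  have "card (X a) = 1" if a: "a \<in> arcs C" for a
  proof (cases "a \<in> Or")
    case nOr: False
    have "arcs C \<subseteq> arcs \<Gamma>"
      using assms(1) unfolding cotree_def graph_cotree_def induced_subgraph_def subgraph_def by blast
    then obtain x where x: "x \<in> X a" using X_nonempty[of a] a by blast
    then have "X a = {x}" using False a nOr by blast
    then show ?thesis by simp
  qed (use assms(4) in blast)
  then show ?thesis unfolding lineal_cotree_def using assms by blast
qed

lemma focal_type_cotree:
  assumes "focal_type T U" shows "\<exists>C Or. focal_cotree \<Gamma> rv X C Or"
proof -
  obtain \<xi> g l where fe: "fixed_ends T U = {\<xi>}" and g: "g \<in> U" "translates T g l" and f: "forward_ray l \<in> \<xi>"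
    using assms unfolding focal_type_def by blast
  have "\<xi> \<in> fixed_ends T U" using fe by auto
  then obtain O1 where O1: "delta_end O1" "\<xi> = rays_in T (lift O1)" by (rule fixed_endE)
  let ?R = "range (\<lambda>i. piA (l (int i)))"
  obtain C where C: "cotree \<Gamma> X C" "cyclic_graph C rv" "cyclic_orientation C rv ?R" "O1 = cotree_scopo \<Gamma> C \<union> ?R"
    using axis_cotree[OF g O1(1)] f O1(2) by blast
  have card: "\<forall>a\<in>?R. card (X a) = 1" using C(4) O1(1) unfolding delta_end_def by blast
  have "\<not> lineal_cotree \<Gamma> rv X C"
  proof
    assume "lineal_cotree \<Gamma> rv X C"
    then have "lineal_type T rvT U" using lineal_type_iff by blast
    then obtain \<zeta> \<eta> where "\<zeta> \<noteq> \<eta>" "fixed_ends T U = {\<zeta>, \<eta>}" unfolding lineal_type_def by blast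
    then show False using fe by auto
  qed
  then show ?thesis using lineal_or_focal_cotree[OF C(1-3) card] by blast
qed

theorem focal_type_iff: "focal_type T U \<longleftrightarrow> (\<exists>C Or. focal_cotree \<Gamma> rv X C Or)"
proof
  assume "\<exists>C Or. focal_cotree \<Gamma> rv X C Or"
  then obtain C Or where "focal_cotree \<Gamma> rv X C Or" by (elim exE)
  then show "focal_type T U" by (rule focal_cotree_end(2))
qed (rule focal_type_cotree)

lemma focal_corresponds:
  assumes "focal_cotree \<Gamma> rv X C Or" "\<xi> \<in> fixed_ends T U"
  shows "corresponds T piA (arcs_towards T \<xi>) (cotree_scopo \<Gamma> C \<union> Or)"
  using focal_cotree_end(1)[OF assms(1)] delta_end_fixed_end(2)[OF focal_cotree_end(3)[OF assms(1)]] assms(2)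
  unfolding corresponds_def by auto

text \<open>
  The axis of a translation, in the direction that follows the orientation, projects to a periodic
  flow.
\<close>

lemma translation_periodic_flow:
  assumes ht: "has_translation T U" and de: "delta_end Or"
  shows "\<exists>r n. n > 0 \<and> (\<forall>i. r i \<in> Or \<and> head \<Gamma> (r i) = tail \<Gamma> (r (Suc i))) \<and> r n = r 0"
proof -
  obtain g l where g: "g \<in> U" "translates T g l" using ht unfolding has_translation_def by blast
  have line: "line T l" using g(2) unfolding translates_def by blast
  then have lT: "l i \<in> arcs T" "head T (l i) = tail T (l (i + 1))" for i unfolding line_def by auto
  show ?thesis using axis_ends[OF g de]
  proof
    assume f: "forward_ray l \<in> rays_in T (lift Or)"
    obtain n where "n > 0" "piA (l (int n)) = piA (l (int 0))" using axis_flow(2)[OF g de f] by blast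
    then show ?thesis using axis_flow(1)[OF g de f] by (intro exI[of _ "\<lambda>i. piA (l (int i))"] exI[of _ n]) simp
  next
    assume "backward_ray rvT l \<in> rays_in T (lift Or)"
    then have lb: "\<forall>i. rvT (l i) \<in> lift Or" using forward_ray_in_iff(2)[OF line lift_delta_end[OF de]] by blast
    \<comment> \<open>the axis points away from the end, so its reverse is followed\<close>
    define r where "r i = piA (rvT (l (- int i)))" for i :: nat
    have rvl: "rvT (l i) \<in> arcs T" for i using T.rv_in_arcs[OF lT(1)] .
    have rf: "r i \<in> Or \<and> head \<Gamma> (r i) = tail \<Gamma> (r (Suc i))" for i
      unfolding r_def using lb head_piA[OF rvl] tail_piA[OF rvl] T.head_rv[OF lT(1)] T.tail_rv[OF lT(1)]
        lT(2)[of "- int (Suc i)"] by simp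
    obtain n where n: "n > 0" "\<forall>i. piA (l (i + int n)) = piA (l i)" using translates_periodic[OF g] by blast
    have "piA (l (- int n + int n)) = piA (l (- int n))" using n(2) by blast
    then have "r n = r 0" unfolding r_def using piA_rvT[OF lT(1)] by simp
    then show ?thesis using n(1) rf by blast
  qed
qed

lemma tree_no_axis:
  assumes tr: "is_tree \<Gamma> rv" and de: "delta_end Or" shows "\<not> has_translation T U"
proof
  assume "has_translation T U"
  then obtain r n where "n > 0" "\<forall>i. r i \<in> Or \<and> head \<Gamma> (r i) = tail \<Gamma> (r (Suc i))" "r n = r 0"
    using translation_periodic_flow[OF _ de] by blast
  then show False using delta_end_tree_acyclic[of Or n r, OF tr de] by blast
qed

lemma delta_end_no_translation_tree:
  assumes de: "delta_end Or" and nt: "\<not> has_translation T U" shows "is_tree \<Gamma> rv"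
proof (rule delta_end_is_tree[OF de])
  fix r :: "nat \<Rightarrow> 'a" and n :: nat
  assume n: "n > 0" and r: "\<And>i. r i \<in> Or \<and> head \<Gamma> (r i) = tail \<Gamma> (r (Suc i))"
  show "r n \<noteq> r 0"
    using delta_end_translation[of Or n r, OF de n r] nt unfolding has_translation_def by blast
qed

lemma horocyclic_type_delta_end:
  assumes "horocyclic_type T U"
  shows "is_tree \<Gamma> rv \<and> (\<exists>Or. Collect delta_end = {Or})"
proof -
  obtain \<xi> where fe: "fixed_ends T U = {\<xi>}" using assms unfolding horocyclic_type_def by blast
  have "\<xi> \<in> fixed_ends T U" using fe by blast
  then obtain Or where Or: "delta_end Or" "\<xi> = rays_in T (lift Or)" by (rule fixed_endE)
  have "O' = Or" if "delta_end O'" for O'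
  proof -
    have "rays_in T (lift O') = rays_in T (lift Or)"
      using delta_end_fixed_end(1)[OF that] fe Or(2) by simp
    then show ?thesis by (rule rays_in_lift_inj[OF that Or(1)])
  qed
  then show ?thesis
    using delta_end_no_translation_tree[OF Or(1)] assms Or(1) unfolding horocyclic_type_def by blast
qed

text \<open>
  In a tree no flow is periodic, so there are no translations and the fixed ends correspond to the
  horocyclic ends.
\<close>

theorem horocyclic_type_iff:
  "horocyclic_type T U \<longleftrightarrow> is_tree \<Gamma> rv \<and> (\<exists>!\<xi>. \<xi> \<in> horocyclic_ends \<Gamma> rv X)
    \<and> \<not> (\<exists>C. single_vertex_cotree \<Gamma> X C)"
proof
  assume h: "horocyclic_type T U"
  then obtain Or where tr: "is_tree \<Gamma> rv" and Or: "Collect delta_end = {Or}"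
    using horocyclic_type_delta_end by blast
  have "horocyclic_ends \<Gamma> rv X = {rays_in \<Gamma> Or}" unfolding horocyclic_ends_eq[OF tr] Or by simp
  moreover have "\<not> fixed_vertex_type T U"
    using h unfolding horocyclic_type_def fixed_vertex_type_def by blast
  ultimately show "is_tree \<Gamma> rv \<and> (\<exists>!\<xi>. \<xi> \<in> horocyclic_ends \<Gamma> rv X) \<and> \<not> (\<exists>C. single_vertex_cotree \<Gamma> X C)"
    using tr fixed_vertex_type_iff by simp
next
  assume h: "is_tree \<Gamma> rv \<and> (\<exists>!\<xi>. \<xi> \<in> horocyclic_ends \<Gamma> rv X) \<and> \<not> (\<exists>C. single_vertex_cotree \<Gamma> X C)"
  then have tr: "is_tree \<Gamma> rv" by blast
  interpret \<Gamma>: tree_graph \<Gamma> rv by (rule tree_graphI[OF tr])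
  obtain \<eta> where \<eta>: "\<eta> \<in> horocyclic_ends \<Gamma> rv X" "\<And>\<zeta>. \<zeta> \<in> horocyclic_ends \<Gamma> rv X \<Longrightarrow> \<zeta> = \<eta>"
    using h by blast
  obtain Or where Or: "delta_end Or" "\<eta> = rays_in \<Gamma> Or" using \<eta>(1) unfolding horocyclic_ends_eq[OF tr] by blast
  have "O' = Or" if O': "delta_end O'" for O'
  proof -
    have eq: "rays_in \<Gamma> O' = rays_in \<Gamma> Or" using \<eta>(2) O' Or(2) unfolding horocyclic_ends_eq[OF tr] by blast
    have sc: "core_scopo \<Gamma> rv {} O'" "core_scopo \<Gamma> rv {} Or"
      using O' Or(1) unfolding delta_end_def by auto
    show ?thesis
      using \<Gamma>.arcs_towards_rays_in[OF sc(1)] \<Gamma>.arcs_towards_rays_in[OF sc(2)] unfolding eq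
      by (rule trans[OF sym])
  qed
  then have "Collect delta_end = {Or}" using Or(1) by blast
  then have "fixed_ends T U = {rays_in T (lift Or)}" unfolding fixed_ends_eq by simp
  moreover have "fixed_vertices T U = {}"
    using fixed_vertex_type_iff conjunct2[OF conjunct2[OF h]] unfolding fixed_vertex_type_def by auto
  ultimately show "horocyclic_type T U"
    unfolding horocyclic_type_def using tree_no_axis[OF tr Or(1)] by simp
qed

lemma horocyclic_corresponds:
  assumes h: "horocyclic_type T U" and \<xi>: "\<xi> \<in> fixed_ends T U" and \<eta>: "\<eta> \<in> horocyclic_ends \<Gamma> rv X"
  shows "corresponds T piA (arcs_towards T \<xi>) (arcs_towards \<Gamma> \<eta>)"
proof -
  obtain Or where tr: "is_tree \<Gamma> rv" and Or: "Collect delta_end = {Or}"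
    using horocyclic_type_delta_end[OF h] by blast
  interpret \<Gamma>: tree_graph \<Gamma> rv by (rule tree_graphI[OF tr])
  have de: "delta_end Or" using Or by blast
  have "\<xi> = rays_in T (lift Or)" using \<xi> Or unfolding fixed_ends_eq by simp
  moreover have "\<eta> = rays_in \<Gamma> Or" using \<eta> Or unfolding horocyclic_ends_eq[OF tr] by simp
  ultimately show ?thesis
    unfolding corresponds_def
    using delta_end_fixed_end(2)[OF de] \<Gamma>.arcs_towards_rays_in[of Or] de unfolding delta_end_def by simp
qed

end

section \<open>Actions without translations\<close>

context delta_action
begin

lemma no_translation_leads:
  assumes "\<not> has_translation T U" "leads T rvT b b'" shows "piA b \<noteq> piA b'"
  using translation_exists[OF assms(2)] assms(1) unfolding has_translation_def by blast

text \<open>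
  Take an arc on the line between the two ends. Its images lie on the same line in the same
  direction, so a nontrivial image would be coherent with it and produce a translation. Hence the
  line is fixed pointwise.
\<close>

lemma two_fixed_ends_fixed_vertex:
  assumes nt: "\<not> has_translation T U" and de: "delta_end Or" "delta_end Or'" and ne: "Or \<noteq> Or'"
  shows "fixed_vertex_type T U"
proof -
  note sc = lift_delta_end[OF de(1)] and sc' = lift_delta_end[OF de(2)]
  interpret A: core_scopo_graph T rvT "{}" "lift Or" by (rule T.core_scopo_graphI[OF sc])
  interpret B: core_scopo_graph T rvT "{}" "lift Or'" by (rule T.core_scopo_graphI[OF sc'])
  have "\<not> lift Or \<subseteq> lift Or'"
  proof
    assume "lift Or \<subseteq> lift Or'"
    then have "lift Or = lift Or'" by (rule T.core_scopo_empty_subset_eq[OF sc sc'])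
    then show False using lift_inj[OF delta_end_arcs[OF de(1)] delta_end_arcs[OF de(2)]] ne by blast
  qed
  then obtain b where b: "b \<in> lift Or" "b \<notin> lift Or'" by (meson subsetI)
  have bT: "b \<in> arcs T" using b(1) by simp
  have rb: "rvT b \<in> lift Or'" using B.scopo_rv_iff[OF bT] b(2) by simp
  have "fst g (tail T b) = tail T b" if g: "g \<in> U" for g
  proof -
    interpret g: tree_automorphism T rvT g by (rule automorphism[OF g])
    define c where "c = snd g b"
    have cT: "c \<in> arcs T" unfolding c_def by (rule g.arc_image[OF bT])
    have pc: "piA c = piA b" unfolding c_def by (rule universal_groupD(3)[OF g bT])
    have c1: "c \<in> lift Or" unfolding c_def using lift_invariant[OF g bT] b(1) by simp
    have c2: "rvT c \<in> lift Or'"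
      unfolding c_def g.rv_image[OF bT, symmetric] using lift_invariant[OF g T.rv_in_arcs[OF bT]] rb by simp
    have "c = b"
      using T.leads_tetrachotomy[OF bT cT]
    proof (elim disjE)
      assume "c = rvT b" then show ?thesis using A.scopo_rv_notin[OF b(1)] c1 by simp
    next
      assume "leads T rvT b c" then show ?thesis using no_translation_leads[OF nt] pc by metis
    next
      assume "leads T rvT b (rvT c)" then show ?thesis using B.scopo_back_leads c2 b(2) by blast
    next
      assume "leads T rvT (rvT b) c"
      then show ?thesis using A.scopo_back_leads[OF _ c1] A.scopo_rv_notin[OF b(1)] by blast
    next
      assume "leads T rvT (rvT b) (rvT c)"
      then have "leads T rvT c b" using T.leads_rv[of "rvT b" "rvT c"] T.rv_rv[OF bT] T.rv_rv[OF cT] by simp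
      then show ?thesis using no_translation_leads[OF nt] pc by metis
    qed simp
    then show ?thesis using g.tail_image[OF bT] unfolding c_def by simp
  qed
  then have "tail T b \<in> fixed_vertices T U" unfolding fixed_vertices_def using bT by simp
  then show ?thesis unfolding fixed_vertex_type_def by blast
qed

text \<open>
  Without translations two distinct arcs of a fibre never point in the same direction on a walk. If
  the fibre of \<open>b\<close> is closed under reversal, this leaves no room for a second edge in it.
\<close>

lemma no_translation_inversion:
  assumes nt: "\<not> has_translation T U" and b: "b \<in> arcs T" "piA (rvT b) = piA b"
  shows "inversion_type T rvT U"
proof -
  note nl = no_translation_leads[OF nt]
  have rb: "rvT b \<in> arcs T" using T.rv_in_arcs[OF b(1)] .
  have "snd g ` {b, rvT b} = {b, rvT b}" if g: "g \<in> U" for g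
  proof -
    interpret g: tree_automorphism T rvT g by (rule automorphism[OF g])
    define c where "c = snd g b"
    have cT: "c \<in> arcs T" unfolding c_def by (rule g.arc_image[OF b(1)])
    have pc: "piA c = piA b" unfolding c_def by (rule universal_groupD(3)[OF g b(1)])
    have prc: "piA (rvT c) = piA b" using piA_rvT[OF cT] piA_rvT[OF b(1)] pc b(2) by simp
    have "c = b \<or> c = rvT b"
      using T.leads_tetrachotomy[OF b(1) cT] nl[of b c] nl[of b "rvT c"] nl[of "rvT b" c] nl[of "rvT b" "rvT c"]
        pc prc b(2) by auto
    then show ?thesis using g.rv_image[OF b(1)] T.rv_rv[OF b(1)] unfolding c_def by auto
  qed
  then have pres: "{b, rvT b} \<in> preserved_edges T rvT U"
    unfolding preserved_edges_def edges_def using b(1) by blast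
  obtain g where g: "g \<in> U" "snd g b = rvT b" using universal_group_transitive[OF b(1) rb] b(2) by auto
  show ?thesis
    unfolding inversion_type_def using inverted_edge_unique[OF b(1) pres g] by blast
qed

text \<open>
  The arcs that point towards some other arc of their own fibre. Without translations or inversions,
  distinct arcs of a fibre either point towards each other or away from each other.
\<close>

definition converging :: "'b set" where
  "converging = {b \<in> arcs T. \<exists>b'\<in>arcs T. piA b' = piA b \<and> leads T rvT b (rvT b')}"

text \<open>
  An arc cannot point towards one element of its fibre and away from another one, since these two
  elements would be coherent. If two distinct converging arcs \<open>b\<close> and \<open>c\<close> left the same vertex, then the
  element that moves \<open>b\<close> to a partner would move \<open>c\<close> to an arc pointing away from \<open>c\<close>.
\<close>

lemma converging_scopo:
  assumes nt: "\<not> has_translation T U"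
    and ninv: "\<forall>b\<in>arcs T. piA (rvT b) \<noteq> piA b"
    and nfix: "\<forall>b\<in>arcs T. \<exists>c\<in>arcs T. piA c = piA b \<and> c \<noteq> b"
  shows "\<And>b. b \<in> arcs T \<Longrightarrow> b \<in> converging \<longleftrightarrow> rvT b \<notin> converging"
    "\<And>b c. b \<in> converging \<Longrightarrow> c \<in> converging \<Longrightarrow> tail T b = tail T c \<Longrightarrow> b = c"
proof -
  note nl = no_translation_leads[OF nt]
  have pr: "piA (rvT c) = piA (rvT b)" if "b \<in> arcs T" "c \<in> arcs T" "piA c = piA b" for b c
    using piA_rvT that by simp
  have total: "b \<in> converging \<or> rvT b \<in> converging" if b: "b \<in> arcs T" for b
  proof -
    obtain c where c: "c \<in> arcs T" "piA c = piA b" "c \<noteq> b" using bspec[OF nfix b] by blast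
    have rc: "rvT c \<in> arcs T" "rvT (rvT c) = c" "rvT b \<in> arcs T" "rvT (rvT b) = b"
      using T.rv_in_arcs T.rv_rv b c by auto
    show ?thesis using T.leads_tetrachotomy[OF b c(1)]
    proof (elim disjE)
      assume "c = rvT b" then show ?thesis using bspec[OF ninv b] c(2) by simp
    next
      assume "leads T rvT b c" then show ?thesis using nl[of b c] c(2) by simp
    next
      assume "leads T rvT b (rvT c)" then show ?thesis unfolding converging_def using b c by blast
    next
      assume "leads T rvT (rvT b) c"
      then have "rvT b \<in> converging"
        unfolding converging_def using rc pr[OF b c(1,2)] by (auto intro!: bexI[of _ "rvT c"])
      then show ?thesis by blast
    next
      assume "leads T rvT (rvT b) (rvT c)"
      then have "leads T rvT c b" using T.leads_rv[of "rvT b" "rvT c"] rc by simp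
      then show ?thesis using nl[of c b] c(2) by simp
    qed (use c in simp)
  qed
  have not_both: "rvT b \<notin> converging" if b: "b \<in> converging" for b
  proof
    assume "rvT b \<in> converging"
    then obtain c where c: "c \<in> arcs T" "piA c = piA (rvT b)" "leads T rvT (rvT b) (rvT c)"
      unfolding converging_def by blast
    obtain d where d: "d \<in> arcs T" "piA d = piA b" "leads T rvT b (rvT d)" and bT: "b \<in> arcs T"
      using b unfolding converging_def by blast
    have "leads T rvT c b"
      using T.leads_rv[OF c(3)] T.rv_rv[OF c(1)] T.rv_rv[OF bT] by simp
    then have "leads T rvT c (rvT d)" using d(3) by (rule tranclp_trans)
    moreover have "piA (rvT d) = piA c" using pr[OF bT d(1,2)] c(2) by simp
    ultimately show False using nl[of c "rvT d"] by simp
  qed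
  show "b \<in> converging \<longleftrightarrow> rvT b \<notin> converging" if "b \<in> arcs T" for b
    using total[OF that] not_both by blast
  fix b c assume b: "b \<in> converging" and c: "c \<in> converging" and bc: "tail T b = tail T c"
  show "b = c"
  proof (rule ccontr)
    assume ne: "b \<noteq> c"
    have bT: "b \<in> arcs T" and cT: "c \<in> arcs T" using b c unfolding converging_def by auto
    obtain b' where b': "b' \<in> arcs T" "piA b' = piA b" "leads T rvT b (rvT b')"
      using b unfolding converging_def by blast
    obtain g where g: "g \<in> U" "snd g b = b'" using universal_group_transitive[OF bT b'(1)] b'(2) by auto
    interpret g: tree_automorphism T rvT g by (rule automorphism[OF g(1)])
    define d where "d = snd g c"
    have dT: "d \<in> arcs T" unfolding d_def by (rule g.arc_image[OF cT])
    have td: "tail T d = tail T b'"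
      unfolding d_def using g.tail_image[OF cT] g.tail_image[OF bT] g(2) bc by simp
    have "d \<noteq> b'" unfolding d_def using g.arc_inj[OF cT bT] g(2) ne by simp
    then have t1: "turn T rvT (rvT b') d"
      unfolding turn_def using dT td T.rv_in_arcs[OF b'(1)] T.head_rv[OF b'(1)] T.rv_rv[OF b'(1)] by simp
    have t2: "turn T rvT (rvT c) b"
      unfolding turn_def using bT bc ne T.rv_in_arcs[OF cT] T.head_rv[OF cT] T.rv_rv[OF cT] by simp
    have "leads T rvT (rvT c) (rvT b')" using t2 b'(3) by (rule tranclp_into_tranclp2)
    then have "leads T rvT (rvT c) d" using t1 by (rule tranclp.trancl_into_trancl)
    moreover have "piA (rvT d) = piA (rvT c)"
      using pr[OF cT dT] universal_groupD(3)[OF g(1) cT] unfolding d_def by simp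
    ultimately have "rvT c \<in> converging"
      unfolding converging_def using T.rv_in_arcs[OF cT] T.rv_in_arcs[OF dT] T.rv_rv[OF dT]
      by (auto intro!: bexI[of _ "rvT d"])
    then show False using not_both[OF c] by blast
  qed
qed

lemma converging_invariant: "b \<in> converging \<Longrightarrow> c \<in> arcs T \<Longrightarrow> piA c = piA b \<Longrightarrow> c \<in> converging"
proof -
  assume b: "b \<in> converging" and c: "c \<in> arcs T" "piA c = piA b"
  obtain b' where b': "b' \<in> arcs T" "piA b' = piA b" "leads T rvT b (rvT b')" and bT: "b \<in> arcs T"
    using b unfolding converging_def by blast
  obtain g where g: "g \<in> U" "snd g b = c" using universal_group_transitive[OF bT c(1)] c(2) by auto
  interpret g: tree_automorphism T rvT g by (rule automorphism[OF g(1)])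
  have "leads T rvT c (rvT (snd g b'))"
    using g.leads_image[OF b'(3)] g(2) g.rv_image[OF b'(1)] by simp
  moreover have "piA (snd g b') = piA c" using universal_groupD(3)[OF g(1) b'(1)] b'(2) c(2) by simp
  ultimately show "c \<in> converging" unfolding converging_def using c(1) g.arc_image[OF b'(1)] by blast
qed

text \<open>
  If no edge is fixed or inverted, the converging arcs form an invariant orientation of all edges
  with at most one vertex as its core: the core vertex is fixed, and without a core the orientation
  points to a fixed end.
\<close>

theorem no_translation_cases:
  assumes nt: "\<not> has_translation T U"
  shows "fixed_vertex_type T U \<or> inversion_type T rvT U \<or> fixed_ends T U \<noteq> {}"
proof (rule ccontr)
  assume "\<not> ?thesis"
  then have nfv: "\<not> fixed_vertex_type T U" and ninv: "\<not> inversion_type T rvT U" and nfe: "fixed_ends T U = {}"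
    by auto
  have c1: "\<forall>b\<in>arcs T. piA (rvT b) \<noteq> piA b"
    using no_translation_inversion[OF nt] ninv by blast
  have c2: "\<forall>b\<in>arcs T. \<exists>c\<in>arcs T. piA c = piA b \<and> c \<noteq> b"
  proof (rule ballI, rule ccontr)
    fix b assume b: "b \<in> arcs T" and *: "\<not> (\<exists>c\<in>arcs T. piA c = piA b \<and> c \<noteq> b)"
    have "fst g (tail T b) = tail T b" if g: "g \<in> U" for g
    proof -
      interpret g: tree_automorphism T rvT g by (rule automorphism[OF g])
      have "snd g b = b" using * g.arc_image[OF b] universal_groupD(3)[OF g b] by blast
      then show ?thesis using g.tail_image[OF b] by simp
    qed
    then have "tail T b \<in> fixed_vertices T U" unfolding fixed_vertices_def using b by simp
    then show False using nfv unfolding fixed_vertex_type_def by blast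
  qed
  note conv = converging_scopo[OF nt c1 c2]
  \<comment> \<open>the vertices that no converging arc leaves\<close>
  define W where "W = {x \<in> verts T. \<forall>b\<in>converging. tail T b \<noteq> x}"
  have cT: "b \<in> arcs T" if "b \<in> converging" for b using that unfolding converging_def by blast
  have sc: "core_scopo T rvT W converging"
    unfolding core_scopo_def
  proof (intro conjI ballI impI)
    show "\<exists>!b. b \<in> converging \<and> tail T b = x" if x: "x \<in> verts T - W" for x
    proof -
      obtain b where b: "b \<in> converging" "tail T b = x" using x unfolding W_def by blast
      show ?thesis by (rule ex1I[of _ b]) (use b conv(2) in auto)
    qed
    show "b \<in> converging \<longleftrightarrow> rvT b \<notin> converging" if "b \<in> arcs T" for b by (rule conv(1)[OF that])
  qed (use cT in \<open>auto simp: W_def\<close>)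
  interpret A: core_scopo_graph T rvT W converging by (rule T.core_scopo_graphI[OF sc])
  \<comment> \<open>two such vertices would both have to be the target of the path between them\<close>
  have single: "x = y" if xy: "x \<in> W" "y \<in> W" for x y
  proof (rule ccontr)
    assume ne: "x \<noteq> y"
    have vT: "x \<in> verts T" "y \<in> verts T" using xy A.core_verts by auto
    interpret X: core_scopo_graph T rvT "{x}" "toward T x" by (rule T.toward_graph[OF vT(1)])
    obtain a where a: "a \<in> toward T x" "tail T a = y" using X.scopo_out[OF vT(2)] ne by auto
    obtain c where c: "c \<in> toward T x" "head T c = x" and ac: "(turn T rvT)\<^sup>*\<^sup>* a c"
      using T.toward_path[OF vT(1) a(1)] by blast
    have cT: "c \<in> arcs T" using X.scopo_arcs[OF c(1)] .
    have "rvT c \<notin> converging" using A.scopo_tail[of "rvT c"] T.tail_rv[OF cT] c(2) xy(1) by auto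
    then have "c \<in> converging" using conv(1)[OF cT] by blast
    then have "a \<in> converging" using turns_cases[OF ac] A.scopo_back_leads by blast
    then show False using A.scopo_tail[of a] a(2) xy(2) by simp
  qed
  show False
  proof (cases "W = {}")
    case True
    have "snd g b \<in> converging \<longleftrightarrow> b \<in> converging" if g: "g \<in> U" and b: "b \<in> arcs T" for g b
    proof -
      interpret g: tree_automorphism T rvT g by (rule automorphism[OF g])
      show ?thesis
        using converging_invariant[of b "snd g b"] converging_invariant[of "snd g b" b]
          g.arc_image[OF b] universal_groupD(3)[OF g b] b by auto
    qed
    note d = descend_core_scopo[OF sc this]
    have "delta_end (piA ` converging)" unfolding delta_end_def using d(1,2) True by simp
    then show False using delta_end_fixed_end(1) nfe by blast
  next
    case False
    then obtain x where x: "x \<in> W" by blast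
    then have xT: "x \<in> verts T" using A.core_verts by blast
    have "fst g x = x" if g: "g \<in> U" for g
    proof -
      interpret g: tree_automorphism T rvT g by (rule automorphism[OF g])
      have gx: "fst g x \<in> verts T" using bij_betw_apply[OF g.bij_verts xT] .
      have "fst g x \<in> W"
      proof (rule ccontr)
        assume "fst g x \<notin> W"
        then obtain c where c: "c \<in> converging" "tail T c = fst g x" using A.scopo_out[OF gx] by blast
        have "tail \<Gamma> (piA c) = piV x"
          using tail_piA[OF cT[OF c(1)]] c(2) universal_groupD(2)[OF g xT] by simp
        then obtain b where b: "b \<in> arcs T" "tail T b = x" "piA b = piA c"
          using lift_arc[OF xT piA_arcs[OF cT[OF c(1)]]] by blast
        then have "b \<in> converging" using converging_invariant[OF c(1)] by blast
        then show False using A.scopo_tail b(2) x by blast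
      qed
      then show ?thesis using single x by blast
    qed
    then have "x \<in> fixed_vertices T U" unfolding fixed_vertices_def using xT by simp
    then show False using nfv unfolding fixed_vertex_type_def by blast
  qed
qed

lemma inversion_no_translation:
  assumes "inversion_type T rvT U" shows "\<not> has_translation T U"
proof
  assume "has_translation T U"
  then obtain g l where g: "g \<in> U" "translates T g l" unfolding has_translation_def by blast
  obtain e where "e \<in> preserved_edges T rvT U" using assms unfolding inversion_type_def by blast
  then obtain b where b: "b \<in> arcs T"
    and "\<forall>g\<in>U. fst g ` {tail T b, head T b} = {tail T b, head T b}" by (rule preserved_edgeE)
  then have gW: "fst g ` {tail T b, head T b} = {tail T b, head T b}" using g(1) by blast
  obtain Or where sc: "core_scopo T rvT {tail T b, head T b} Or" "funnels T {tail T b, head T b} Or"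
    using T.edge_core_scopo[OF b] by blast
  have "infinite {tail T b, head T b}" by (rule translation_core_infinite[OF g sc gW])
  then show False by simp
qed

text \<open>
  With a translation and a fixed end, the projected axis is a cyclic cotree and the type is lineal or
  focal. Without translations there is a fixed vertex, an inverted edge or a fixed end; two fixed
  ends produce a fixed vertex, and a single one is the horocyclic case.
\<close>

theorem general_type_iff:
  "general_type T U \<longleftrightarrow> \<not> fixed_vertex_type T U \<and> \<not> inversion_type T rvT U
    \<and> \<not> lineal_type T rvT U \<and> \<not> focal_type T U \<and> \<not> horocyclic_type T U"
proof
  assume g: "general_type T U"
  then have "has_translation T U" "fixed_ends T U = {}" unfolding general_type_def by auto
  then show "\<not> fixed_vertex_type T U \<and> \<not> inversion_type T rvT U
    \<and> \<not> lineal_type T rvT U \<and> \<not> focal_type T U \<and> \<not> horocyclic_type T U"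
    using fixed_vertex_no_translation inversion_no_translation
    unfolding lineal_type_def focal_type_def horocyclic_type_def by auto
next
  assume n: "\<not> fixed_vertex_type T U \<and> \<not> inversion_type T rvT U
    \<and> \<not> lineal_type T rvT U \<and> \<not> focal_type T U \<and> \<not> horocyclic_type T U"
  have ht: "has_translation T U"
  proof (rule ccontr)
    assume nt: "\<not> has_translation T U"
    then obtain \<xi> where \<xi>: "\<xi> \<in> fixed_ends T U" using no_translation_cases n by blast
    then obtain Or where Or: "delta_end Or" "\<xi> = rays_in T (lift Or)" by (rule fixed_endE)
    have "O' = Or" if "delta_end O'" for O'
      using two_fixed_ends_fixed_vertex[OF nt that Or(1)] n by blast
    then have "fixed_ends T U = {\<xi>}" unfolding fixed_ends_eq using Or by blast
    then have "horocyclic_type T U"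
      unfolding horocyclic_type_def using nt n unfolding fixed_vertex_type_def by blast
    then show False using n by blast
  qed
  have "fixed_ends T U = {}"
  proof (rule ccontr)
    assume "fixed_ends T U \<noteq> {}"
    then obtain Or where de: "delta_end Or" unfolding fixed_ends_eq by blast
    obtain r m where r: "m > 0" "\<forall>i. r i \<in> Or \<and> head \<Gamma> (r i) = tail \<Gamma> (r (Suc i))" "r m = r 0"
      using translation_periodic_flow[OF ht de] by blast
    obtain C where C: "cotree \<Gamma> X C" "cyclic_graph C rv" "cyclic_orientation C rv (range r)"
      using periodic_flow_cyclic_cotree[of Or m r, OF de r(1) _ r(3)] r(2) by blast
    have "\<forall>a\<in>range r. card (X a) = 1" using de r(2) unfolding delta_end_def by blast
    then show False
      using lineal_or_focal_cotree[OF C] lineal_type_iff focal_type_iff n by blast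
  qed
  then show "general_type T U" unfolding general_type_def using ht by blast
qed

section \<open>The minimal invariant subtree\<close>

text \<open>
  The arcs on axes of translations, as \<open>translation_exists\<close> shows.
\<close>

definition axis_arcs :: "'b set" where
  "axis_arcs = {b. \<exists>c. leads T rvT b c \<and> piA c = piA b}"

lemma axis_arcs_fibre:
  assumes "b \<in> axis_arcs" "c \<in> arcs T" "piA c = piA b" shows "c \<in> axis_arcs"
proof -
  obtain d where d: "leads T rvT b d" "piA d = piA b" using assms(1) unfolding axis_arcs_def by blast
  have bT: "b \<in> arcs T" "d \<in> arcs T" using T.leads_arcs[OF d(1)] by auto
  obtain g where g: "g \<in> U" "snd g b = c" using universal_group_transitive[OF bT(1) assms(2)] assms(3) by auto
  interpret g: tree_automorphism T rvT g by (rule automorphism[OF g(1)])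
  have "leads T rvT c (snd g d)" using g.leads_image[OF d(1)] g(2) by simp
  moreover have "piA (snd g d) = piA c" using universal_groupD(3)[OF g(1) bT(2)] d(2) assms(3) by simp
  ultimately show ?thesis unfolding axis_arcs_def by blast
qed

lemma axis_arcs_in: "b \<in> axis_arcs \<Longrightarrow> b \<in> arcs T"
  unfolding axis_arcs_def by (auto dest: T.leads_arcs)

lemma axis_arcs_rv: "b \<in> axis_arcs \<Longrightarrow> rvT b \<in> axis_arcs"
proof -
  assume "b \<in> axis_arcs"
  then obtain d where d: "leads T rvT b d" "piA d = piA b" unfolding axis_arcs_def by blast
  have bT: "b \<in> arcs T" "d \<in> arcs T" using T.leads_arcs[OF d(1)] by auto
  have p: "piA (rvT b) = piA (rvT d)" using piA_rvT bT d(2) by simp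
  then have "rvT d \<in> axis_arcs" unfolding axis_arcs_def using T.leads_rv[OF d(1)] by blast
  then show ?thesis using axis_arcs_fibre T.rv_in_arcs[OF bT(1)] p by blast
qed

lemma axis_translation: "b \<in> axis_arcs \<Longrightarrow> \<exists>g\<in>U. \<exists>l. translates T g l \<and> l 0 = b"
proof -
  assume "b \<in> axis_arcs"
  then obtain c where "leads T rvT b c" "piA b = piA c" unfolding axis_arcs_def by auto
  then show ?thesis by (rule translation_exists)
qed

text \<open>
  Let \<open>d\<close> point towards an axis and let \<open>g\<close> be a translation along it. If \<open>d\<close> and its image are coherent,
  then \<open>d\<close> lies on an axis itself. Otherwise they point towards each other: both point towards the
  image of \<open>c\<close>, so they do not point away from each other, and \<open>g\<close> does not fix \<open>d\<close>.
\<close>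

lemma leads_axis_arc:
  assumes c: "c \<in> axis_arcs" and dc: "leads T rvT d c"
  shows "d \<in> axis_arcs \<or> (\<exists>d'\<in>arcs T. piA d' = piA d \<and> leads T rvT d (rvT d'))"
proof -
  have dT: "d \<in> arcs T" and cT: "c \<in> arcs T" using T.leads_arcs[OF dc] by auto
  obtain g l where g: "g \<in> U" and l: "translates T g l" "l 0 = c" using axis_translation[OF c] by blast
  interpret g: tree_automorphism T rvT g by (rule automorphism[OF g])
  have cg: "leads T rvT c (snd g c)" using translation_leads(1)[OF g l(1), of 0] l(2) by simp
  define d' where "d' = snd g d"
  have d'T: "d' \<in> arcs T" unfolding d'_def by (rule g.arc_image[OF dT])
  have pd: "piA d' = piA d" unfolding d'_def by (rule universal_groupD(3)[OF g dT])
  have d1: "leads T rvT d (snd g c)" using dc cg by (rule tranclp_trans)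
  have d2: "leads T rvT d' (snd g c)" unfolding d'_def by (rule g.leads_image[OF dc])
  have hc: "head T (snd g c) \<in> verts T" using g.arc_image[OF cT] by simp
  interpret H: core_scopo_graph T rvT "{head T (snd g c)}" "toward T (head T (snd g c))"
    by (rule T.toward_graph[OF hc])
  have nd: "\<not> leads T rvT (rvT d) (snd g c)"
    using H.scopo_rv_notin[OF T.leads_in_toward[OF d1]] T.leads_in_toward by blast
  show ?thesis using T.leads_tetrachotomy[OF dT d'T]
  proof (elim disjE)
    assume "d' = d"
    then have fx: "fst g ` {tail T d} = {tail T d}" using g.tail_image[OF dT] unfolding d'_def by simp
    have tv: "tail T d \<in> verts T" using dT by simp
    have "infinite {tail T d}"
      by (rule translation_core_infinite[OF g l(1) T.toward_core_scopo[OF tv] T.toward_funnels[OF tv] fx])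
    then show ?thesis by simp
  next
    assume "d' = rvT d" then show ?thesis using nd d2 by simp
  next
    assume "leads T rvT d d'" then show ?thesis unfolding axis_arcs_def using pd by blast
  next
    assume "leads T rvT d (rvT d')" then show ?thesis using d'T pd by blast
  next
    assume "leads T rvT (rvT d) d'"
    then show ?thesis using nd tranclp_trans[OF _ d2] by blast
  next
    assume "leads T rvT (rvT d) (rvT d')"
    then have "leads T rvT d' d" using T.leads_rv[of "rvT d" "rvT d'"] T.rv_rv[OF dT] T.rv_rv[OF d'T] by simp
    then have "d' \<in> axis_arcs" unfolding axis_arcs_def using pd by auto
    then show ?thesis using axis_arcs_fibre dT pd by simp
  qed
qed

text \<open>
  Between two axes, \<open>d\<close> points towards an arc of its own fibre at the far side, and so does its reverse
  at the near side. Moving the second configuration to the end of the first one shows that \<open>d\<close> is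
  coherent with a third arc of its fibre.
\<close>

lemma axis_arcs_convex:
  assumes b: "b \<in> axis_arcs" and c: "c \<in> axis_arcs" and bd: "leads T rvT b d" and dc: "leads T rvT d c"
  shows "d \<in> axis_arcs"
proof (rule ccontr)
  assume nd: "d \<notin> axis_arcs"
  have dT: "d \<in> arcs T" using T.leads_arcs[OF bd] by blast
  have rd: "rvT d \<in> arcs T" "rvT (rvT d) = d" using T.rv_in_arcs[OF dT] T.rv_rv[OF dT] by auto
  have nrd: "rvT d \<notin> axis_arcs" using axis_arcs_rv[of "rvT d"] rd(2) nd by auto
  obtain d' where d': "d' \<in> arcs T" "piA d' = piA d" "leads T rvT d (rvT d')"
    using leads_axis_arc[OF c dc] nd by blast
  obtain e where e: "e \<in> arcs T" "piA e = piA (rvT d)" "leads T rvT (rvT d) (rvT e)"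
    using leads_axis_arc[OF axis_arcs_rv[OF b] T.leads_rv[OF bd]] nrd by blast
  obtain h where h: "h \<in> U" "snd h d = d'" using universal_group_transitive[OF dT d'(1)] d'(2) by auto
  interpret h: tree_automorphism T rvT h by (rule automorphism[OF h(1)])
  have "leads T rvT (rvT d') (snd h (rvT e))"
    using h.leads_image[OF e(3)] h.rv_image[OF dT] h(2) by simp
  then have "leads T rvT d (snd h (rvT e))" by (rule tranclp_trans[OF d'(3)])
  moreover have "piA (snd h (rvT e)) = piA d"
    using universal_groupD(3)[OF h(1) T.rv_in_arcs[OF e(1)]] piA_rvT[OF e(1)] e(2) piA_rvT[OF dT]
      rv_rv[OF piA_arcs[OF dT]] by simp
  ultimately show False using nd unfolding axis_arcs_def by blast
qed

abbreviation axis_verts :: "'w set" where "axis_verts \<equiv> tail T ` axis_arcs"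

text \<open>
  A path between two vertices on axes can be prolonged at both ends by an arc of an axis, so that
  convexity applies to all of its arcs.
\<close>

lemma axis_verts_core_scopo:
  assumes "has_translation T U"
  shows "axis_verts \<noteq> {}" "\<exists>Or. core_scopo T rvT axis_verts Or \<and> funnels T axis_verts Or"
    "\<forall>g\<in>U. fst g ` axis_verts = axis_verts"
proof -
  obtain g l where g: "g \<in> U" "translates T g l" using assms unfolding has_translation_def by blast
  have "l 0 \<in> axis_arcs" unfolding axis_arcs_def using translation_leads[OF g] by blast
  then obtain c where c: "c \<in> axis_arcs" by blast
  then show "axis_verts \<noteq> {}" by blast
  let ?w = "tail T c"
  have VT: "axis_verts \<subseteq> verts T" using axis_arcs_in by auto
  have wT: "?w \<in> verts T" using c VT by blast
  interpret H: core_scopo_graph T rvT "{?w}" "toward T ?w" by (rule T.toward_graph[OF wT])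
  have stay: "head T a \<in> axis_verts" if a: "a \<in> toward T ?w" "tail T a \<in> axis_verts" for a
  proof -
    obtain b where b: "b \<in> axis_arcs" "tail T b = tail T a" using a(2) by force
    obtain e where ae: "e \<in> toward T ?w" "(turn T rvT)\<^sup>*\<^sup>* a e" and e: "head T e = ?w"
      using T.toward_path[OF wT a(1)] by blast
    have aT: "a \<in> arcs T" "e \<in> arcs T" "b \<in> arcs T" "c \<in> arcs T"
      using H.scopo_arcs a(1) ae(1) axis_arcs_in b(1) c by auto
    have "\<exists>b1\<in>axis_arcs. b1 = a \<or> leads T rvT b1 a"
    proof (cases "a = b")
      case False
      then have "turn T rvT (rvT b) a"
        unfolding turn_def using aT b(2) T.rv_in_arcs[OF aT(3)] T.head_rv[OF aT(3)] T.rv_rv[OF aT(3)] by simp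
      then have "leads T rvT (rvT b) a" by (rule tranclp.r_into_trancl)
      then show ?thesis using axis_arcs_rv[OF b(1)] by blast
    qed (use b in blast)
    then obtain b1 where b1: "b1 \<in> axis_arcs" "b1 = a \<or> leads T rvT b1 a" by blast
    have "\<exists>c1\<in>axis_arcs. c1 = a \<or> leads T rvT a c1"
    proof (cases "c = rvT e")
      case True
      then have "e \<in> axis_arcs" using axis_arcs_rv[OF c] T.rv_rv[OF aT(2)] by simp
      then show ?thesis using turns_cases[OF ae(2)] by blast
    next
      case False
      then have "turn T rvT e c" unfolding turn_def using aT e by simp
      then have "leads T rvT a c" using ae(2) by (rule rtranclp_into_tranclp1[rotated])
      then show ?thesis using c by blast
    qed
    then obtain c1 where c1: "c1 \<in> axis_arcs" "c1 = a \<or> leads T rvT a c1" by blast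
    have "a \<in> axis_arcs" using b1 c1 axis_arcs_convex by blast
    then have "tail T (rvT a) \<in> axis_verts" using axis_arcs_rv by blast
    then show ?thesis using T.tail_rv[OF aT(1)] by simp
  qed
  have "?w \<in> axis_verts" using c by blast
  from T.core_scopo_closed[OF this VT stay]
  show "\<exists>Or. core_scopo T rvT axis_verts Or \<and> funnels T axis_verts Or" by blast
  show "\<forall>g\<in>U. fst g ` axis_verts = axis_verts"
  proof
    fix h assume h: "h \<in> U"
    interpret h: tree_automorphism T rvT h by (rule automorphism[OF h])
    have "snd h ` axis_arcs = axis_arcs"
    proof (rule bij_betw_invariant_image[OF h.bij_arcs])
      show "axis_arcs \<subseteq> arcs T" using axis_arcs_in by blast
      fix b assume b: "b \<in> arcs T"
      show "snd h b \<in> axis_arcs \<longleftrightarrow> b \<in> axis_arcs"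
        using axis_arcs_fibre[of b "snd h b"] axis_arcs_fibre[of "snd h b" b]
          h.arc_image[OF b] universal_groupD(3)[OF h b] b by auto
    qed
    then show "fst h ` axis_verts = axis_verts" using h.tails_image[of axis_arcs] axis_arcs_in by auto
  qed
qed

lemma axis_verts_minimal:
  assumes S: "invariant_subtree T rvT U S" shows "axis_verts \<subseteq> verts S"
proof
  fix x assume "x \<in> axis_verts"
  then obtain b where b: "b \<in> axis_arcs" "x = tail T b" by blast
  obtain g l where g: "g \<in> U" and l: "translates T g l" "l 0 = b" using axis_translation[OF b(1)] by blast
  have st: "subtree S T rvT" and inv: "fst g ` verts S = verts S"
    using S g unfolding invariant_subtree_def by auto
  obtain Or where "core_scopo T rvT (verts S) Or" "funnels T (verts S) Or"
    using T.subtree_core_scopo[OF st] by blast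
  then have "tail T (l 0) \<in> verts S"
    using tree_automorphism.translation_in_core[OF automorphism[OF g] l(1) _ _ inv] by blast
  then show "x \<in> verts S" using l(2) b(2) by simp
qed

lemma general_type_no_delta_end: "general_type T U \<Longrightarrow> \<not> delta_end Or"
  using delta_end_fixed_end(1)[of Or] unfolding general_type_def by blast

lemma general_type_horocyclic_ends:
  assumes "general_type T U" shows "horocyclic_ends \<Gamma> rv X = {}"
proof (cases "is_tree \<Gamma> rv")
  case True
  then show ?thesis using horocyclic_ends_eq[OF True] general_type_no_delta_end[OF assms] by simp
next
  case False
  then show ?thesis unfolding horocyclic_ends_def by simp
qed

text \<open>
  The union of all axes is an invariant subtree, contained in every other one, and its image is the
  smallest cotree. An end of this subtree fixed by the group would become a fixed end of \<open>T\<close> after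
  adding the orientation towards the subtree.
\<close>

theorem general_type_structure:
  assumes gen: "general_type T U"
  shows "\<exists>C S. (\<forall>C'. smallest_cotree \<Gamma> X C' \<longleftrightarrow> C' = C)
     \<and> \<not> (is_tree \<Gamma> rv \<and> single_vertex_cotree \<Gamma> X C)
     \<and> \<not> inversion_cotree \<Gamma> rv X C
     \<and> \<not> lineal_cotree \<Gamma> rv X C
     \<and> \<not> (\<exists>Or. focal_cotree \<Gamma> rv X C Or)
     \<and> (\<forall>S'. minimal_invariant_subtree T rvT U S' \<longleftrightarrow> S' = S)
     \<and> geometrically_dense S rvT U
     \<and> corresponds T piA (cotree_scopo T S) (cotree_scopo \<Gamma> C)"
proof -
  have ht: "has_translation T U" using gen unfolding general_type_def by blast
  note ax = axis_verts_core_scopo[OF ht]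
  obtain OW where OW: "core_scopo T rvT axis_verts OW" "funnels T axis_verts OW" using ax(2) by blast
  note d = invariant_core_scopo_cotree[OF ax(1) OW ax(3)]
  define V where "V = piV ` axis_verts"
  define C where "C = \<Gamma> \<restriction> V"
  define S where "S = T \<restriction> axis_verts"
  have vC: "verts C = V" and vS: "verts S = axis_verts" unfolding C_def S_def by simp_all
  have ct: "cotree \<Gamma> X C" unfolding C_def V_def by (rule d(1))
  have lV: "liftV (verts C) = axis_verts" unfolding vC V_def by (rule d(2)[symmetric])
  have inv: "invariant_subtree T rvT U S" using lift_cotree(1)[OF ct] unfolding lV S_def .
  have corr: "corresponds T piA (cotree_scopo T S) (cotree_scopo \<Gamma> C)"
    using lift_cotree(2)[OF ct] unfolding lV S_def .
  have small: "subgraph C C'" if C': "cotree \<Gamma> X C'" for C'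
  proof -
    have "axis_verts \<subseteq> verts (T \<restriction> liftV (verts C'))" by (rule axis_verts_minimal[OF lift_cotree(1)[OF C']])
    then have "V \<subseteq> verts C'" unfolding V_def by auto
    then have "subgraph C (\<Gamma> \<restriction> verts C')" unfolding C_def by (rule induce_subgraph_mono[OF wf_digraph_axioms])
    then show ?thesis using cotree_core_scopo(4)[OF C'] by simp
  qed
  have smallest: "smallest_cotree \<Gamma> X C' \<longleftrightarrow> C' = C" for C'
  proof
    assume C': "smallest_cotree \<Gamma> X C'"
    then have ct': "cotree \<Gamma> X C'" and "subgraph C' C" using ct unfolding smallest_cotree_def by auto
    then have "verts C' = verts C" using small[OF ct'] unfolding subgraph_def by blast
    then show "C' = C" using cotree_core_scopo(4)[OF ct'] cotree_core_scopo(4)[OF ct] by metis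
  qed (use ct small in \<open>simp add: smallest_cotree_def\<close>)
  have S_eq: "S' = S" if S': "invariant_subtree T rvT U S'" "verts S' \<subseteq> verts S" for S'
  proof -
    have "verts S' = axis_verts" using axis_verts_minimal[OF S'(1)] S'(2) vS by blast
    moreover have "subtree S' T rvT" using S'(1) unfolding invariant_subtree_def by blast
    ultimately show ?thesis unfolding S_def using T.subtree_eq_induce[of S'] by simp
  qed
  have minimal: "minimal_invariant_subtree T rvT U S' \<longleftrightarrow> S' = S" for S'
  proof
    assume m: "minimal_invariant_subtree T rvT U S'"
    then have S': "invariant_subtree T rvT U S'" unfolding minimal_invariant_subtree_def by blast
    then have st: "subtree S' T rvT" unfolding invariant_subtree_def by blast
    have "subgraph (T \<restriction> axis_verts) (T \<restriction> verts S')"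
      by (rule induce_subgraph_mono[OF T.wf_digraph_axioms axis_verts_minimal[OF S']])
    then have "subgraph S S'" using T.subtree_eq_induce[OF st] unfolding S_def by simp
    then show "S' = S" using m inv unfolding minimal_invariant_subtree_def by blast
  next
    assume "S' = S"
    then show "minimal_invariant_subtree T rvT U S'"
      unfolding minimal_invariant_subtree_def using inv S_eq unfolding subgraph_def by blast
  qed
  have stS: "subtree S T rvT" using inv unfolding invariant_subtree_def by blast
  interpret S: tree_graph S rvT by (rule tree_graphI) (use stS in \<open>simp add: subtree_def\<close>)
  have dense: "geometrically_dense S rvT U"
    unfolding geometrically_dense_def
  proof (intro conjI allI impI)
    fix S' assume S': "invariant_subtree S rvT U S'"
    then have sub: "subgraph S' S" unfolding invariant_subtree_def subtree_def by blast
    have "subgraph S' T" using sub stS unfolding subtree_def by (auto intro: subgraph_trans)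
    then have "invariant_subtree T rvT U S'" using S' unfolding invariant_subtree_def subtree_def by blast
    then show "S' = S" by (rule S_eq) (use sub in \<open>simp add: subgraph_def\<close>)
  next
    show "fixed_ends S U = {}"
    proof (rule ccontr)
      assume "fixed_ends S U \<noteq> {}"
      then obtain \<xi> where \<xi>: "\<xi> \<in> ends S" "\<And>g. g \<in> U \<Longrightarrow> (\<lambda>r. snd g \<circ> r) ` \<xi> = \<xi>"
        unfolding fixed_ends_def by blast
      let ?O = "arcs_towards S \<xi>"
      note e = S.end_core_scopo[OF \<xi>(1)]
      have im: "snd g ` ?O = ?O" if "g \<in> U" for g
        by (rule S.invariant_end_scopo[OF e(1)]) (use \<xi>(2)[OF that] e(2) in simp)
      have OT: "?O \<subseteq> arcs T" using e(1) unfolding core_scopo_def S_def by auto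
      have sc: "core_scopo T rvT {} (OW \<union> ?O)"
        by (rule T.core_scopo_Un[OF OW(1)]) (use e(1) in \<open>simp add: S_def\<close>)
      have "snd g b \<in> OW \<union> ?O \<longleftrightarrow> b \<in> OW \<union> ?O" if g: "g \<in> U" and b: "b \<in> arcs T" for g b
      proof -
        interpret g: tree_automorphism T rvT g by (rule automorphism[OF g])
        have "snd g b \<in> OW \<longleftrightarrow> b \<in> OW" using g.core_scopo_image_iff[OF OW _ b] ax(3) g by blast
        moreover have "snd g b \<in> ?O \<longleftrightarrow> b \<in> ?O"
        proof
          assume "snd g b \<in> ?O"
          then have "snd g b \<in> snd g ` ?O" unfolding im[OF g] .
          then obtain c where c: "c \<in> ?O" "snd g b = snd g c" by (rule imageE) blast
          then have "b = c" using g.arc_inj[OF b, of c] OT by auto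
          then show "b \<in> ?O" using c by simp
        next
          assume "b \<in> ?O"
          then have "snd g b \<in> snd g ` ?O" by (rule imageI)
          then show "snd g b \<in> ?O" unfolding im[OF g] .
        qed
        ultimately show ?thesis by blast
      qed
      note dd = descend_core_scopo[OF sc this]
      have "delta_end (piA ` (OW \<union> ?O))" unfolding delta_end_def using dd(1,2) by simp
      then show False using general_type_no_delta_end[OF gen] by blast
    qed
  qed
  have "\<not> fixed_vertex_type T U" "\<not> inversion_type T rvT U" "\<not> lineal_type T rvT U" "\<not> focal_type T U"
    using gen general_type_iff by auto
  then have "\<not> (is_tree \<Gamma> rv \<and> single_vertex_cotree \<Gamma> X C) \<and> \<not> inversion_cotree \<Gamma> rv X C
      \<and> \<not> lineal_cotree \<Gamma> rv X C \<and> \<not> (\<exists>Or. focal_cotree \<Gamma> rv X C Or)"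
    using fixed_vertex_type_iff inversion_type_iff lineal_type_iff focal_type_iff by blast
  then show ?thesis
    using smallest minimal dense corr by (intro exI[of _ C] exI[of _ S]) simp
qed

end

section \<open>The classification\<close>

theorem theorem2p6:
  fixes \<Gamma> :: "('v, 'a) pre_digraph" and rv :: "'a \<Rightarrow> 'a"
    and X :: "'a \<Rightarrow> 'x set" and Gv :: "'v \<Rightarrow> ('x \<Rightarrow> 'x) set"
    and T :: "('w, 'b) pre_digraph" and rvT :: "'b \<Rightarrow> 'b"
    and piV :: "'w \<Rightarrow> 'v" and piA :: "'b \<Rightarrow> 'a" and L :: "'b \<Rightarrow> 'x"
    and G :: "(('w \<Rightarrow> 'w) \<times> ('b \<Rightarrow> 'b)) set"
  assumes "local_action_diagram \<Gamma> rv X Gv"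
    and "delta_tree \<Gamma> rv X T rvT piV piA L"
    and "G = universal_group \<Gamma> X Gv T rvT piV piA L"
  shows
    "(fixed_vertex_type T G \<longleftrightarrow> is_tree \<Gamma> rv \<and> (\<exists>C. single_vertex_cotree \<Gamma> X C))
   \<and> (fixed_vertex_type T G \<longrightarrow>
        one_to_one (fixed_vertices T G) {C. single_vertex_cotree \<Gamma> X C}
          (\<lambda>x C. corresponds T piA (cotree_scopo T (T \<restriction> {x})) (cotree_scopo \<Gamma> C)))

   \<and> (inversion_type T rvT G \<longleftrightarrow> (\<exists>C. inversion_cotree \<Gamma> rv X C))
   \<and> (\<forall>C C'. inversion_cotree \<Gamma> rv X C \<and> inversion_cotree \<Gamma> rv X C' \<longrightarrow> C = C')
   \<and> (inversion_type T rvT G \<longrightarrow>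
        (\<forall>e\<in>inverted_edges T rvT G. \<forall>C. inversion_cotree \<Gamma> rv X C \<longrightarrow>
          corresponds T piA (cotree_scopo T (T \<restriction> (tail T ` e))) (cotree_scopo \<Gamma> C)))

   \<and> (lineal_type T rvT G \<longleftrightarrow> (\<exists>C. lineal_cotree \<Gamma> rv X C))
   \<and> (lineal_type T rvT G \<longrightarrow> (\<forall>C. lineal_cotree \<Gamma> rv X C \<longrightarrow>
        one_to_one (fixed_ends T G) {Or. cyclic_orientation C rv Or}
          (\<lambda>\<xi> Or. corresponds T piA (arcs_towards T \<xi>) (cotree_scopo \<Gamma> C \<union> Or))))

   \<and> (focal_type T G \<longleftrightarrow> (\<exists>C Or. focal_cotree \<Gamma> rv X C Or))
   \<and> (focal_type T G \<longrightarrow> (\<forall>C Or. focal_cotree \<Gamma> rv X C Or \<longrightarrow>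
        (\<forall>\<xi>\<in>fixed_ends T G.
          corresponds T piA (arcs_towards T \<xi>) (cotree_scopo \<Gamma> C \<union> Or))))

   \<and> (horocyclic_type T G \<longleftrightarrow> is_tree \<Gamma> rv \<and> (\<exists>!\<xi>. \<xi> \<in> horocyclic_ends \<Gamma> rv X)
        \<and> \<not> (\<exists>C. single_vertex_cotree \<Gamma> X C))
   \<and> (horocyclic_type T G \<longrightarrow>
        (\<forall>\<xi>\<in>fixed_ends T G. \<forall>\<eta>\<in>horocyclic_ends \<Gamma> rv X.
          corresponds T piA (arcs_towards T \<xi>) (arcs_towards \<Gamma> \<eta>)))

   \<and> (general_type T G \<longleftrightarrow> \<not> fixed_vertex_type T G \<and> \<not> inversion_type T rvT G
        \<and> \<not> lineal_type T rvT G \<and> \<not> focal_type T G \<and> \<not> horocyclic_type T G)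
   \<and> (general_type T G \<longrightarrow>
        (\<exists>C S. (\<forall>C'. smallest_cotree \<Gamma> X C' \<longleftrightarrow> C' = C)
           \<and> \<not> (is_tree \<Gamma> rv \<and> single_vertex_cotree \<Gamma> X C)
           \<and> \<not> inversion_cotree \<Gamma> rv X C
           \<and> \<not> lineal_cotree \<Gamma> rv X C
           \<and> \<not> (\<exists>Or. focal_cotree \<Gamma> rv X C Or)
           \<and> (\<forall>S'. minimal_invariant_subtree T rvT G S' \<longleftrightarrow> S' = S)
           \<and> geometrically_dense S rvT G
           \<and> corresponds T piA (cotree_scopo T S) (cotree_scopo \<Gamma> C))
        \<and> horocyclic_ends \<Gamma> rv X = {})"
proof -
  interpret delta_action \<Gamma> rv X Gv T rvT piV piA L
    using assms(1,2) by (rule delta_action.intro)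
  show ?thesis
    unfolding assms(3)
  proof (intro conjI impI allI ballI, goal_cases)
    case 1 show ?case by (rule fixed_vertex_type_iff)
  next
    case 2 then show ?case by (rule fixed_vertices_one_to_one)
  next
    case 3 show ?case by (rule inversion_type_iff)
  next
    case (4 C C') then show ?case using inversion_cotree_unique by blast
  next
    case (5 e C) then show ?case using inverted_edge_corresponds by blast
  next
    case 6 show ?case by (rule lineal_type_iff)
  next
    case (7 C) then show ?case using lineal_one_to_one by blast
  next
    case 8 show ?case by (rule focal_type_iff)
  next
    case (9 C Or \<xi>) then show ?case using focal_corresponds by blast
  next
    case 10 show ?case by (rule horocyclic_type_iff)
  next
    case (11 \<xi> \<eta>) then show ?case using horocyclic_corresponds by blast
  next
    case 12 show ?case by (rule general_type_iff)
  next
    case 13 then show ?case by (rule general_type_structure)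
  next
    case 14 then show ?case by (rule general_type_horocyclic_ends)
  qed
qed

end
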